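(* Let $\mathcal V\subset\mathfrak{sl}(N,\mathbb C)$ be a hypersurface orbital variety with associated standard Young tableau $T$, and let $\mathcal V_R$ be the Richardson orbital variety with $\tau(\mathcal V_R)=\tau(\mathcal V)$, with associated tableau $T_R$ of shape $\lambda$ and chains $C_1,\dots,C_{\lambda_1}$. Assume that $T$ is obtained from $T_R$ by dropping down one row the box containing the largest number $j$ of a chain $C_t$ ($1\le t\le\lambda_1$). Let $I:=|C_t|$. Let $C_s$ ($s<t$) be the chain of $T_R$ of length $I$ such that there is no other chain of length $I$ between $C_s$ and $C_t$, and let $i$ be the smallest number in $C_s$. Then $$\sigma(\mathcal V)=\{\alpha_i,\alpha_{i+1},\dots,\alpha_{j-1}\}.$$ (The integer $I=|C_s|$ is then called the thickness of $\sigma(\mathcal V)$, written $\mathrm{thick}(\sigma)$.)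
   Context: Let $\mathfrak n$ be the strictly upper-triangular $N\times N$ complex matrices, with simple roots $\Pi=\{\alpha_1,\dots,\alpha_{N-1}\}$ and positive roots $R^+=\{\alpha(i,j)=\alpha_i+\cdots+\alpha_j : 1\le i\le j\le N-1\}$. The root vector $X_{\alpha(i,j)}$ spans the matrix position $(i,j+1)$, and $x_{i,j+1}$ is the corresponding coordinate. Identify $S(\mathfrak n)$ with $\mathbb C[x_{ij}: 1\le i<j\le N]$. For $\omega\subseteq\Pi$, $R^+(\omega)$ is the set of positive roots that are sums of elements of $\omega$. Orbital varieties: for a partition $\lambda$ of $N$, $\mathcal O_\lambda$ is the set of nilpotent matrices with Jordan blocks of sizes $\lambda_1,\lambda_2,\dots$. An orbital variety is an irreducible component of $\mathcal O_\lambda\cap\mathfrak n$ for some $\lambda$. Orbital varieties contained in $\mathcal O_\lambda$ are in bijection with standard Young tableaux of shape $\lambda$ (via the Robinson-Schensted correspondence). The tableau $T$ associated to $\mathcal V$ is the one in which, for each $k$, the boxes with entries $\le k$ form the Young diagram of the Jordan type of the upper-left $k\times k$ submatrix of a generic $x\in\mathcal V$. $\tau$-invariant: $\tau(\mathcal V)\subseteq\Pi$ is the set of simple roots $\alpha$ such that the subgroup generated by the root subgroups of $\pm\alpha$ stabilizes $\mathcal V$ under conjugation. Equivalently, $\alpha_i\in\tau(\mathcal V)$ iff $i$ lies in a strictly higher row than $i+1$ in $T$. For $\tau\subseteq\Pi$ let $\mathfrak m_\tau=\bigoplus_{\alpha\in R^+\setminus R^+(\tau)}\mathbb C X_\alpha$.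 The Richardson orbital variety with $\tau$-invariant $\tau$ is the unique orbital variety $\mathcal V_R$ with $\tau(\mathcal V_R)=\tau$ and $\overline{\mathcal V}_R=\mathfrak m_\tau$. A hypersurface orbital variety is an orbital variety $\mathcal V$ whose closure is a hypersurface (codimension one) in $\mathfrak m_{\tau(\mathcal V)}$. Non-linear generator: with $\tau=\tau(\mathcal V)$, the ideal of $\overline{\mathcal V}$ is generated by the coordinates $x_{st}$ with $\alpha(s,t-1)\in R^+(\tau)$ together with one irreducible homogeneous polynomial $f$ of degree $\ge2$ in the remaining coordinates, unique up to a nonzero scalar. $\sigma$-set: $\sigma(\mathcal V)$ is the smallest connected subset $\sigma$ of $\Pi$ (i.e. of the form $\{\alpha_a,\alpha_{a+1},\dots,\alpha_b\}$) such that $f\in S(\mathfrak n_\sigma)$, where $\mathfrak n_\sigma$ is the subalgebra of $\mathfrak n$ generated by the $X_\alpha$, $\alpha\in\sigma$. Chains of $T_R$: the orbits on $\{1,\dots,N\}$ of the group generated by the transpositions $(i\ i+1)$, $\alpha_i\in\tau(\mathcal V_R)$. They are intervals of consecutive integers, numbered $C_1,\dots,C_{\lambda_1}$ in increasing order. $|C|$ denotes the cardinality (length) of $C$. The number of chains of length $i$ equals the number of columns of length $i$ in $T_R$. Dropping a box down one row: the entry is moved to the next row, every other entry stays in its row, and each row is left-justified and written in increasing order. (For every hypersurface orbital variety, $T$ is obtained from $T_R$ by dropping the box of the largest element of some chain in this way.) *)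

theory Defs
  imports
    "HOL-Analysis.Abstract_Topology"
    "HOL-Library.Poly_Mapping"
    "HOL-Library.Extended_Nat"
    "HOL-Algebra.Generated_Groups"
    "HOL-Algebra.Group_Action"
    "HOL-Algebra.Sym_Groups"
    "HOL-Algebra.Ring_Divisibility"
    "Jordan_Normal_Form.Jordan_Normal_Form"
begin

text \<open>The variable \<open>x\<^bsub>st\<^esub>\<close> is the pair \<open>(s, t)\<close>, with the 1-based matrix indices of the
  mathematical text; matrices in \<^theory>\<open>Jordan_Normal_Form.Matrix\<close> are indexed from 0.\<close>

type_synonym mpoly = "((nat \<times> nat) \<Rightarrow>\<^sub>0 nat) \<Rightarrow>\<^sub>0 complex"

definition coord :: "complex mat \<Rightarrow> nat \<times> nat \<Rightarrow> complex" where
  "coord A v = A $$ (fst v - 1, snd v - 1)"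

definition var :: "nat \<times> nat \<Rightarrow> mpoly" where
  "var v = Poly_Mapping.single (Poly_Mapping.single v 1) 1"

definition const :: "complex \<Rightarrow> mpoly" where
  "const c = Poly_Mapping.single 0 c"

definition vars :: "mpoly \<Rightarrow> (nat \<times> nat) set" where
  "vars p = (\<Union>m\<in>Poly_Mapping.keys p. Poly_Mapping.keys m)"

definition eval_mpoly :: "mpoly \<Rightarrow> complex mat \<Rightarrow> complex" where
  "eval_mpoly p A =
     (\<Sum>m\<in>Poly_Mapping.keys p. Poly_Mapping.lookup p m *
       (\<Prod>v\<in>Poly_Mapping.keys m. coord A v ^ Poly_Mapping.lookup m v))"

definition homogeneous :: "nat \<Rightarrow> mpoly \<Rightarrow> bool" where
  "homogeneous d p \<longleftrightarrow>
     (\<forall>m\<in>Poly_Mapping.keys p. (\<Sum>v\<in>Poly_Mapping.keys m. Poly_Mapping.lookup m v) = d)"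

text \<open>The principal open sets of the affine space of \<open>N \<times> N\<close> matrices form a basis of the
  Zariski topology.\<close>

definition zariski :: "nat \<Rightarrow> complex mat topology" where
  "zariski N = topology_generated_by
     {{A \<in> carrier_mat N N. eval_mpoly p A \<noteq> 0} | p. vars p \<subseteq> {1..N} \<times> {1..N}}"

definition irreducible_in :: "'a topology \<Rightarrow> 'a set \<Rightarrow> bool" where
  "irreducible_in X Z \<longleftrightarrow> Z \<subseteq> topspace X \<and> Z \<noteq> {} \<and>
     (\<forall>C D. closedin X C \<and> closedin X D \<and> Z \<subseteq> C \<union> D \<longrightarrow> Z \<subseteq> C \<or> Z \<subseteq> D)"

definition irreducible_component_of :: "'a topology \<Rightarrow> 'a set \<Rightarrow> 'a set \<Rightarrow> bool" where
  "irreducible_component_of X S Z \<longleftrightarrow> Z \<subseteq> S \<and> irreducible_in X Z \<and>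
     (\<forall>W. W \<subseteq> S \<and> irreducible_in X W \<and> Z \<subseteq> W \<longrightarrow> W = Z)"

text \<open>Codimension of the irreducible closed set \<open>Y\<close> in \<open>X\<close>: the supremum of the lengths of chains
  of irreducible closed sets that start at \<open>Y\<close> and stay inside \<open>X\<close>.\<close>

definition codim :: "'a topology \<Rightarrow> 'a set \<Rightarrow> 'a set \<Rightarrow> enat" where
  "codim T Y X = Sup {enat n | n. \<exists>Z :: nat \<Rightarrow> 'a set. Z 0 = Y \<and> Z n \<subseteq> X \<and>
     (\<forall>k\<le>n. closedin T (Z k) \<and> irreducible_in T (Z k)) \<and> (\<forall>k<n. Z k \<subset> Z (Suc k))}"

text \<open>The simple root \<open>\<alpha>\<^sub>k\<close> is represented by its index \<open>k \<in> {1..<N}\<close> and the positive root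
  \<open>\<alpha>(i,j) = \<alpha>\<^sub>i + \<dots> + \<alpha>\<^sub>j\<close> by the pair \<open>(i, j)\<close>. As the simple roots are linearly independent,
  \<open>\<alpha>(i,j)\<close> is a sum of elements of \<open>\<omega>\<close> iff \<open>\<alpha>\<^sub>i, \<dots>, \<alpha>\<^sub>j\<close> all lie in \<open>\<omega>\<close>.\<close>

definition simple_roots :: "nat \<Rightarrow> nat set" where
  "simple_roots N = {1..<N}"

definition pos_roots :: "nat \<Rightarrow> (nat \<times> nat) set" where
  "pos_roots N = {(i, j). 1 \<le> i \<and> i \<le> j \<and> j < N}"

definition pos_roots_of :: "nat \<Rightarrow> nat set \<Rightarrow> (nat \<times> nat) set" where
  "pos_roots_of N \<omega> = {(i, j) \<in> pos_roots N. {i..j} \<subseteq> \<omega>}"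

definition pos_of_root :: "nat \<times> nat \<Rightarrow> nat \<times> nat" where
  "pos_of_root \<beta> = (fst \<beta>, Suc (snd \<beta>))"

definition root_vec :: "nat \<Rightarrow> nat \<times> nat \<Rightarrow> complex mat" where
  "root_vec N \<beta> =
     Matrix.mat N N (\<lambda>(r, c). if (Suc r, Suc c) = pos_of_root \<beta> then 1 else 0)"

definition strict_upper :: "nat \<Rightarrow> complex mat set" where
  "strict_upper N = {A \<in> carrier_mat N N. \<forall>r<N. \<forall>c<N. c \<le> r \<longrightarrow> A $$ (r, c) = 0}"

text \<open>The span of the \<open>X\<^sub>\<beta>\<close> for \<open>\<beta> \<in> R\<^sup>+ - R\<^sup>+(\<tau>)\<close>.\<close>

definition m_space :: "nat \<Rightarrow> nat set \<Rightarrow> complex mat set" where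
  "m_space N \<tau> = {A \<in> strict_upper N. \<forall>\<beta>\<in>pos_roots_of N \<tau>. coord A (pos_of_root \<beta>) = 0}"

inductive_set n_sub :: "nat \<Rightarrow> nat set \<Rightarrow> complex mat set"
  for N :: nat and \<sigma> :: "nat set" where
    gen: "k \<in> \<sigma> \<Longrightarrow> root_vec N (k, k) \<in> n_sub N \<sigma>"
  | zero: "0\<^sub>m N N \<in> n_sub N \<sigma>"
  | add: "A \<in> n_sub N \<sigma> \<Longrightarrow> B \<in> n_sub N \<sigma> \<Longrightarrow> A + B \<in> n_sub N \<sigma>"
  | smult: "A \<in> n_sub N \<sigma> \<Longrightarrow> c \<cdot>\<^sub>m A \<in> n_sub N \<sigma>"
  | bracket: "A \<in> n_sub N \<sigma> \<Longrightarrow> B \<in> n_sub N \<sigma> \<Longrightarrow> A * B - B * A \<in> n_sub N \<sigma>"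

text \<open>The element of \<open>S(\<nn>)\<close> given by a matrix in \<open>\<nn>\<close>, under the identification of the root vector
  \<open>X\<^sub>\<beta>\<close> with the variable at its matrix position.\<close>

definition linear_elem :: "nat \<Rightarrow> complex mat \<Rightarrow> mpoly" where
  "linear_elem N A =
     (\<Sum>\<beta>\<in>pos_roots N. const (coord A (pos_of_root \<beta>)) * var (pos_of_root \<beta>))"

inductive_set sym_alg :: "nat \<Rightarrow> complex mat set \<Rightarrow> mpoly set"
  for N :: nat and L :: "complex mat set" where
    const: "const c \<in> sym_alg N L"
  | linear: "A \<in> L \<Longrightarrow> linear_elem N A \<in> sym_alg N L"
  | add: "p \<in> sym_alg N L \<Longrightarrow> q \<in> sym_alg N L \<Longrightarrow> p + q \<in> sym_alg N L"
  | mult: "p \<in> sym_alg N L \<Longrightarrow> q \<in> sym_alg N L \<Longrightarrow> p * q \<in> sym_alg N L"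

definition S_ring :: "nat \<Rightarrow> mpoly ring" where
  "S_ring N = \<lparr>carrier = {p. vars p \<subseteq> pos_of_root ` pos_roots N},
     monoid.mult = (*), one = 1, ring.zero = 0, add = (+)\<rparr>"

definition partition_of :: "nat \<Rightarrow> nat list \<Rightarrow> bool" where
  "partition_of N lam \<longleftrightarrow> sum_list lam = N \<and> 0 \<notin> set lam \<and> sorted_wrt (\<ge>) lam"

definition nilp_orbit :: "nat \<Rightarrow> nat list \<Rightarrow> complex mat set" where
  "nilp_orbit N lam = {A \<in> carrier_mat N N. jordan_nf A (map (\<lambda>n. (n, 0)) lam)}"

definition orbital_variety :: "nat \<Rightarrow> complex mat set \<Rightarrow> bool" where
  "orbital_variety N V \<longleftrightarrow> (\<exists>lam. partition_of N lam \<and>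
     irreducible_component_of (zariski N) (nilp_orbit N lam \<inter> strict_upper N) V)"

text \<open>A tableau is the list of its rows, the longest row first.\<close>

definition standard_tableau :: "nat \<Rightarrow> nat list list \<Rightarrow> bool" where
  "standard_tableau N T \<longleftrightarrow>
     distinct (concat T) \<and> set (concat T) = {1..N} \<and>
     partition_of N (map length T) \<and>
     (\<forall>row\<in>set T. sorted_wrt (<) row) \<and>
     (\<forall>a b. Suc a < length T \<and> b < length (T ! Suc a) \<longrightarrow> T ! a ! b < T ! Suc a ! b)"

definition shape_upto :: "nat \<Rightarrow> nat list list \<Rightarrow> nat list" where
  "shape_upto k T = filter (\<lambda>n. n \<noteq> 0) (map (\<lambda>row. length (filter (\<lambda>x. x \<le> k) row)) T)"

text \<open>\<open>x \<in> V\<close> is generic if it lies in a suitable nonempty relatively open subset of \<open>V\<close>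
  (which is dense, \<open>V\<close> being irreducible).\<close>

definition tableau_of :: "nat \<Rightarrow> complex mat set \<Rightarrow> nat list list \<Rightarrow> bool" where
  "tableau_of N V T \<longleftrightarrow> standard_tableau N T \<and>
     (\<forall>k\<le>N. \<exists>U. openin (zariski N) U \<and> U \<inter> V \<noteq> {} \<and>
        (\<forall>A\<in>U \<inter> V. Matrix.mat k k (\<lambda>(r, c). A $$ (r, c)) \<in> nilp_orbit k (shape_upto k T)))"

text \<open>Moves the entry \<open>j\<close> to the next row; a new row is opened if \<open>j\<close> is in the last row.\<close>

definition drop_box :: "nat \<Rightarrow> nat list list \<Rightarrow> nat list list" where
  "drop_box j T =
     (let a = (THE a. a < length T \<and> j \<in> set (T ! a)); T' = map (remove1 j) T
      in if Suc a < length T then T'[Suc a := insort j (T' ! Suc a)] else T' @ [[j]])"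

definition GL :: "nat \<Rightarrow> complex mat monoid" where
  "GL N = units_of (ring_mat TYPE(complex) N ())"

definition root_group :: "nat \<Rightarrow> nat \<Rightarrow> complex mat set" where
  "root_group N k = generate (GL N)
     (range (\<lambda>c. 1\<^sub>m N + c \<cdot>\<^sub>m root_vec N (k, k)) \<union>
      range (\<lambda>c. 1\<^sub>m N + c \<cdot>\<^sub>m transpose_mat (root_vec N (k, k))))"

definition tau :: "nat \<Rightarrow> complex mat set \<Rightarrow> nat set" where
  "tau N V = {k \<in> simple_roots N.
     \<forall>g\<in>root_group N k. (\<lambda>A. g * A * inv\<^bsub>GL N\<^esub> g) ` V = V}"

definition richardson_orbital_variety :: "nat \<Rightarrow> nat set \<Rightarrow> complex mat set \<Rightarrow> bool" where
  "richardson_orbital_variety N \<tau> V \<longleftrightarrow>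
     orbital_variety N V \<and> tau N V = \<tau> \<and> zariski N closure_of V = m_space N \<tau>"

definition hypersurface_orbital_variety :: "nat \<Rightarrow> complex mat set \<Rightarrow> bool" where
  "hypersurface_orbital_variety N V \<longleftrightarrow> orbital_variety N V \<and>
     zariski N closure_of V \<subseteq> m_space N (tau N V) \<and>
     codim (zariski N) (zariski N closure_of V) (m_space N (tau N V)) = 1"

text \<open>The chains: orbits of the group generated by the transpositions \<open>(k k+1)\<close>, \<open>k \<in> \<tau>\<close>,
  listed in increasing order and numbered from 1.\<close>

definition chain_group :: "nat \<Rightarrow> nat set \<Rightarrow> (nat \<Rightarrow> nat) monoid" where
  "chain_group N \<tau> = (sym_group N)
     \<lparr>carrier := generate (sym_group N) ((\<lambda>k. Transposition.transpose k (Suc k)) ` \<tau>)\<rparr>"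

definition chain :: "nat \<Rightarrow> nat set \<Rightarrow> nat \<Rightarrow> nat set" where
  "chain N \<tau> q =
     sorted_key_list_of_set Min (Group_Action.orbits (chain_group N \<tau>) {1..N} (\<lambda>g. g)) ! (q - 1)"

definition vanishing_ideal :: "nat \<Rightarrow> complex mat set \<Rightarrow> mpoly set" where
  "vanishing_ideal N W = {p \<in> carrier (S_ring N). \<forall>A\<in>W. eval_mpoly p A = 0}"

definition nonlinear_generator :: "nat \<Rightarrow> complex mat set \<Rightarrow> mpoly \<Rightarrow> bool" where
  "nonlinear_generator N V f \<longleftrightarrow>
     vars f \<subseteq> pos_of_root ` (pos_roots N - pos_roots_of N (tau N V)) \<and>
     (\<exists>d\<ge>2. homogeneous d f) \<and> ring_irreducible\<^bsub>S_ring N\<^esub> f \<and>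
     vanishing_ideal N (zariski N closure_of V) =
       Idl\<^bsub>S_ring N\<^esub> (insert f ((\<lambda>\<beta>. var (pos_of_root \<beta>)) ` pos_roots_of N (tau N V)))"

definition connected_roots :: "nat \<Rightarrow> nat set \<Rightarrow> bool" where
  "connected_roots N \<sigma> \<longleftrightarrow> (\<exists>a b. 1 \<le> a \<and> a \<le> b \<and> b < N \<and> \<sigma> = {a..b})"

definition is_sigma_set :: "nat \<Rightarrow> mpoly \<Rightarrow> nat set \<Rightarrow> bool" where
  "is_sigma_set N f \<sigma> \<longleftrightarrow> connected_roots N \<sigma> \<and> f \<in> sym_alg N (n_sub N \<sigma>) \<and>
     (\<forall>\<sigma>'. connected_roots N \<sigma>' \<and> f \<in> sym_alg N (n_sub N \<sigma>') \<longrightarrow> \<sigma> \<subseteq> \<sigma>')"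

text \<open>Well defined since the non-linear generator is unique up to a nonzero scalar.\<close>

definition sigma_set :: "nat \<Rightarrow> complex mat set \<Rightarrow> nat set" where
  "sigma_set N V = (THE \<sigma>. \<exists>f. nonlinear_generator N V f \<and> is_sigma_set N f \<sigma>)"

end

theory Submission
  imports Defs "HOL-Library.Product_Lexorder"
begin

text \<open>Number the chains by levels and consider, in \<open>z + x\<close> with \<open>x\<close> in the nilradical, the minor whose
  rows run from the first element of \<open>C\<^sub>s\<close> to the last one before \<open>C\<^sub>t\<close> and whose columns run from the
  first element after \<open>C\<^sub>s\<close> to the last one of \<open>C\<^sub>t\<close>. Its expansion runs over systems of \<open>I\<close> disjoint
  paths from \<open>C\<^sub>s\<close> to \<open>C\<^sub>t\<close>, the power of \<open>z\<close> counting the vertices left out. A path meets a chain at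
  most once, so at least \<open>c - I\<close> vertices of a chain of length \<open>c\<close> are left out, and the minor is divisible
  by \<open>z\<^sup>d\<close> where \<open>d\<close> is the sum of these numbers. Let \<open>f\<close> be the coefficient of \<open>z\<^sup>d\<close>.

  The Jordan type of a corner of \<open>x\<close> is the divisibility by \<open>z\<close> of the corner of \<open>z + x\<close> bordered by
  constant rows and columns. Dropping the box \<open>j\<close> raises the divisibility of the \<open>j\<close>-th corner with \<open>I\<close>
  border rows by one. As all \<open>I\<close> paths have to cross a chain of length \<open>I\<close> completely, the lowest
  coefficient of the bordered determinant factors at \<open>C\<^sub>s\<close> and \<open>C\<^sub>t\<close> with \<open>f\<close> as one factor, so \<open>f\<close>
  vanishes on \<open>\<V>\<close>.

  The polynomial \<open>f\<close> is multilinear. If \<open>f = g h\<close>, then \<open>g\<close> and \<open>h\<close> have no variable in common, and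
  exchanging parts of path systems shows that one of them is constant, because no chain in between has
  length \<open>I\<close>. Hence \<open>f\<close> is the non-linear generator for reasons of dimension. Its variables lie in the
  rows from \<open>i\<close> on and the columns up to \<open>j\<close>, and both row \<open>i\<close> and column \<open>j\<close> occur.\<close>

section \<open>Polynomials in the matrix entries\<close>

text \<open>The sigma set depends only on the variables of the generator, and any two generators
  divide each other. So it is enough to exhibit one explicit f and to compute the full vanishing
  ideal of its zero set. Multilinearity keeps this elementary. As f is linear in each variable, its
  zero set can be solved for one coordinate, which replaces the Nullstellensatz; and multilinear
  polynomials split into primes by induction on the number of variables, which replaces unique
  factorization. The tableau enters only through the number of its entries up to k below the first I
  rows. Quantifying over all borders makes this number a similarity invariant, while for matrices in
  the nilradical it is accessible by counting paths through levels. Codimension one is used in the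
  form that no irreducible closed set lies strictly between the closure and the nilradical. The
  remaining obstacle is degree one: if I = 1 and the two chains follow each other, f is a single
  coordinate. This case is excluded because the variety would then have a larger
  tau-invariant.\<close>

definition mon_val :: "(nat \<times> nat \<Rightarrow> 'r::comm_ring_1) \<Rightarrow> ((nat \<times> nat) \<Rightarrow>\<^sub>0 nat) \<Rightarrow> 'r" where
  "mon_val g m = (\<Prod>v\<in>Poly_Mapping.keys m. g v ^ Poly_Mapping.lookup m v)"

text \<open>The universal property of the polynomial ring: coefficients go through \<open>h\<close>,
  variables through \<open>g\<close>. Evaluation at a point (\<open>ev\<close>), expansion in one
  variable (\<open>in_var\<close>) and killing of variables (\<open>restrict_vars\<close>) are
  instances, so one set of homomorphism laws serves all of them.\<close>

definition poly_subst ::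
    "(complex \<Rightarrow> 'r::comm_ring_1) \<Rightarrow> (nat \<times> nat \<Rightarrow> 'r) \<Rightarrow> mpoly \<Rightarrow> 'r" where
  "poly_subst h g p =
     (\<Sum>m\<in>Poly_Mapping.keys p. h (Poly_Mapping.lookup p m) * mon_val g m)"

lemma mon_val_superset:
  assumes "finite S" "Poly_Mapping.keys m \<subseteq> S"
  shows "mon_val g m = (\<Prod>v\<in>S. g v ^ Poly_Mapping.lookup m v)"
  unfolding mon_val_def
  by (rule prod.mono_neutral_left) (use assms in \<open>auto simp: in_keys_iff\<close>)

lemma mon_val_zero [simp]: "mon_val g 0 = 1"
  by (simp add: mon_val_def)

lemma mon_val_add: "mon_val g (m + m') = mon_val g m * mon_val g m'"
proof -
  let ?S = "Poly_Mapping.keys m \<union> Poly_Mapping.keys m'"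
  have "mon_val g (m + m') = (\<Prod>v\<in>?S. g v ^ Poly_Mapping.lookup (m + m') v)"
    by (rule mon_val_superset) (simp_all add: Poly_Mapping.keys_add)
  also have "\<dots> = (\<Prod>v\<in>?S. g v ^ Poly_Mapping.lookup m v) * (\<Prod>v\<in>?S. g v ^ Poly_Mapping.lookup m' v)"
    by (simp add: lookup_add power_add prod.distrib)
  also have "\<dots> = mon_val g m * mon_val g m'"
    by (subst (1 2) mon_val_superset[of ?S]) auto
  finally show ?thesis .
qed

lemma mon_val_single [simp]: "mon_val g (Poly_Mapping.single v k) = g v ^ k"
  by (simp add: mon_val_def)

lemma poly_mapping_sum_single:
  "(\<Sum>m\<in>Poly_Mapping.keys p. Poly_Mapping.single m (Poly_Mapping.lookup p m)) = p"
  by (rule poly_mapping_eqI)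
    (auto simp: lookup_sum lookup_single when_def in_keys_iff)

locale coeff_hom = comm_ring_hom h for h :: "complex \<Rightarrow> 'r::comm_ring_1"
begin

lemma subst_zero [simp]: "poly_subst h g 0 = 0"
  by (simp add: poly_subst_def)

lemma subst_single: "poly_subst h g (Poly_Mapping.single m c) = h c * mon_val g m"
  by (simp add: poly_subst_def)

lemma subst_add: "poly_subst h g (p + q) = poly_subst h g p + poly_subst h g q"
  unfolding poly_subst_def
  by (rule setsum_keys_plus_distrib) (simp_all add: hom_add distrib_right)

lemma subst_sum: "poly_subst h g (sum F A) = (\<Sum>x\<in>A. poly_subst h g (F x))"
  by (induction A rule: infinite_finite_induct) (simp_all add: subst_add)

lemma subst_mult: "poly_subst h g (p * q) = poly_subst h g p * poly_subst h g q"
proof -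
  let ?s = "\<lambda>p m. Poly_Mapping.single m (Poly_Mapping.lookup p m)"
  have "p * q = (\<Sum>m\<in>Poly_Mapping.keys p. \<Sum>m'\<in>Poly_Mapping.keys q. ?s p m * ?s q m')"
    by (subst (1 2) poly_mapping_sum_single[symmetric]) (simp add: sum_product)
  then have "poly_subst h g (p * q) = (\<Sum>m\<in>Poly_Mapping.keys p. \<Sum>m'\<in>Poly_Mapping.keys q.
      poly_subst h g (?s p m) * poly_subst h g (?s q m'))"
    by (simp add: subst_sum mult_single subst_single hom_mult mon_val_add mult_ac)
  also have "\<dots> = poly_subst h g (sum (?s p) (Poly_Mapping.keys p)) *
      poly_subst h g (sum (?s q) (Poly_Mapping.keys q))"
    by (simp add: subst_sum sum_product)
  finally show ?thesis
    by (simp add: poly_mapping_sum_single)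
qed

lemma subst_const [simp]: "poly_subst h g (const c) = h c"
  by (simp add: const_def subst_single)

lemma subst_var [simp]: "poly_subst h g (var v) = g v"
  by (simp add: var_def subst_single hom_one)

lemma subst_one [simp]: "poly_subst h g 1 = 1"
  using subst_const[of g 1] by (simp add: const_def hom_one)

lemma subst_hom: "comm_ring_hom (poly_subst h g)"
  by unfold_locales (simp_all add: subst_add subst_mult)

end

lemma const_hom: "coeff_hom const"
  unfolding coeff_hom_def
  by unfold_locales (simp_all add: const_def single_add mult_single)

interpretation const: coeff_hom const
  by (rule const_hom)

lemma mon_val_var: "mon_val var m = Poly_Mapping.single m 1"
proof -
  have pow: "var v ^ k = Poly_Mapping.single (Poly_Mapping.single v k) 1" for v k
    by (induction k) (simp_all add: var_def mult_single flip: single_add)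
  have prd: "(\<Prod>v\<in>A. Poly_Mapping.single (f v) (1::complex)) = Poly_Mapping.single (\<Sum>v\<in>A. f v) 1"
    for A :: "(nat \<times> nat) set" and f :: "nat \<times> nat \<Rightarrow> (nat \<times> nat) \<Rightarrow>\<^sub>0 nat"
    by (induction A rule: infinite_finite_induct) (simp_all add: mult_single)
  show ?thesis
    by (simp add: mon_val_def pow prd poly_mapping_sum_single)
qed

lemma mpoly_expand: "poly_subst const var p = p"
  by (simp add: poly_subst_def mon_val_var const_def mult_single poly_mapping_sum_single)

lemma hom_poly_subst:
  assumes "comm_ring_hom F"
  shows "F p = poly_subst (\<lambda>c. F (const c)) (\<lambda>v. F (var v)) p"
proof -
  interpret F: comm_ring_hom F by fact
  have "F (mon_val var m) = mon_val (\<lambda>v. F (var v)) m" for m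
    by (simp add: mon_val_def F.hom_prod F.hom_power)
  then have "F (poly_subst const var p) = poly_subst (\<lambda>c. F (const c)) (\<lambda>v. F (var v)) p"
    by (simp add: poly_subst_def F.hom_sum F.hom_mult)
  then show ?thesis
    by (simp add: mpoly_expand)
qed

text \<open>A homomorphism is determined by its values on constants and variables, and only the
  variables of \<open>p\<close> enter. Identities between substitutions are reduced to this.\<close>

lemma mpoly_hom_eqI:
  assumes "comm_ring_hom F" "comm_ring_hom G"
    and "\<And>c. F (const c) = G (const c)" "\<And>v. v \<in> vars p \<Longrightarrow> F (var v) = G (var v)"
  shows "F p = G p"
proof -
  have "F (var v) = G (var v)" if "m \<in> Poly_Mapping.keys p" "v \<in> Poly_Mapping.keys m" for m v
    using that by (intro assms(4)) (auto simp: vars_def)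
  then have "mon_val (\<lambda>v. F (var v)) m = mon_val (\<lambda>v. G (var v)) m" if "m \<in> Poly_Mapping.keys p" for m
    unfolding mon_val_def using that by (intro prod.cong) auto
  then show ?thesis
    by (subst (1 2) hom_poly_subst) (simp_all add: assms poly_subst_def)
qed

lemma vars_zero [simp]: "vars 0 = {}"
  by (simp add: vars_def)

lemma vars_const [simp]: "vars (const c) = {}"
  by (simp add: vars_def const_def)

lemma vars_one [simp]: "vars 1 = {}"
  by (simp add: vars_def)

lemma vars_var [simp]: "vars (var v) = {v}"
  by (simp add: vars_def var_def)

lemma vars_uminus [simp]: "vars (- p) = vars p"
  by (simp add: vars_def)

lemma vars_add: "vars (p + q) \<subseteq> vars p \<union> vars q"
  unfolding vars_def using Poly_Mapping.keys_add[of p q] by blast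

lemma vars_mult: "vars (p * q) \<subseteq> vars p \<union> vars q"
proof
  fix v assume "v \<in> vars (p * q)"
  then obtain m where m: "m \<in> Poly_Mapping.keys (p * q)" "v \<in> Poly_Mapping.keys m"
    by (auto simp: vars_def)
  then obtain a b where "m = a + b" "a \<in> Poly_Mapping.keys p" "b \<in> Poly_Mapping.keys q"
    using keys_mult[of p q] by blast
  then show "v \<in> vars p \<union> vars q"
    using m Poly_Mapping.keys_add[of a b] by (auto simp: vars_def)
qed

lemma vars_sum: "vars (sum F A) \<subseteq> (\<Union>x\<in>A. vars (F x))"
proof (induction A rule: infinite_finite_induct)
  case (insert x A)
  then show ?case
    using vars_add[of "F x" "sum F A"] by auto
qed auto

lemma vars_prod: "vars (prod F A) \<subseteq> (\<Union>x\<in>A. vars (F x))"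
proof (induction A rule: infinite_finite_induct)
  case (insert x A)
  then show ?case
    using vars_mult[of "F x" "prod F A"] by auto
qed auto

lemma vars_power: "vars (p ^ k) \<subseteq> vars p"
  by (induction k) (use vars_mult in auto)

lemma finite_vars [simp]: "finite (vars p)"
  by (simp add: vars_def)

lemma const_eq_0_iff [simp]: "const c = 0 \<longleftrightarrow> c = 0"
  by (metis const_def lookup_single_eq lookup_zero single_zero)

lemma vars_empty_const: "vars p = {} \<Longrightarrow> \<exists>c. p = const c"
proof -
  assume *: "vars p = {}"
  have "Poly_Mapping.lookup p m = Poly_Mapping.lookup (const (Poly_Mapping.lookup p 0)) m" for m
  proof (cases "m = 0")
    case False
    have "m \<notin> Poly_Mapping.keys p"
    proof
      assume "m \<in> Poly_Mapping.keys p"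
      then have "Poly_Mapping.keys m = {}"
        using * by (auto simp: vars_def)
      then show False using False by simp
    qed
    then show ?thesis using False by (simp add: const_def in_keys_iff lookup_single)
  qed (simp add: const_def)
  then show ?thesis by (metis poly_mapping_eqI)
qed

lemma var_neq_zero [simp]: "var v \<noteq> 0"
  by (metis vars_var vars_zero insert_not_empty)

section \<open>Evaluation at points and expansion in one variable\<close>

abbreviation ev :: "(nat \<times> nat \<Rightarrow> complex) \<Rightarrow> mpoly \<Rightarrow> complex" where
  "ev \<equiv> poly_subst id"

lemma id_coeff_hom: "coeff_hom (id :: complex \<Rightarrow> complex)"
  unfolding coeff_hom_def by unfold_locales simp_all

interpretation ev: coeff_hom "id :: complex \<Rightarrow> complex"
  by (rule id_coeff_hom)

interpretation ev_hom: comm_ring_hom "ev \<alpha>" for \<alpha>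
  by (rule ev.subst_hom)

lemma eval_mpoly_ev: "eval_mpoly p A = ev (coord A) p"
  by (simp add: eval_mpoly_def poly_subst_def mon_val_def)

lemma ev_cong: "(\<And>v. v \<in> vars p \<Longrightarrow> \<alpha> v = \<beta> v) \<Longrightarrow> ev \<alpha> p = ev \<beta> p"
  using mpoly_hom_eqI[where F = "ev \<alpha>" and G = "ev \<beta>" and p = p, OF ev.subst_hom ev.subst_hom] by simp

text \<open>The coefficients stay in the full ring \<open>mpoly\<close> instead of a ring with fewer
  variables; that \<open>x\<close> does not occur in them is the separate fact
  \<open>vars_coeff_in_var\<close>. The degree of the result is the degree in
  \<open>x\<close>.\<close>

definition in_var :: "nat \<times> nat \<Rightarrow> mpoly \<Rightarrow> mpoly poly" where
  "in_var x = poly_subst (\<lambda>c. [:const c:]) (\<lambda>v. if v = x then [:0, 1:] else [:var v:])"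

lemma const_poly_hom: "coeff_hom (\<lambda>c. [:const c:])"
  unfolding coeff_hom_def
  by unfold_locales (simp_all add: const.hom_add const.hom_mult one_pCons)

interpretation const_poly: coeff_hom "\<lambda>c. [:const c:]"
  by (rule const_poly_hom)

interpretation in_var_hom: comm_ring_hom "in_var x" for x
  unfolding in_var_def by (rule const_poly.subst_hom)

lemma in_var_const [simp]: "in_var x (const c) = [:const c:]"
  by (simp add: in_var_def)

lemma in_var_var: "in_var x (var v) = (if v = x then [:0, 1:] else [:var v:])"
  by (simp add: in_var_def)

lemma poly_in_var: "poly (in_var x p) (var x) = p"
proof -
  have "comm_ring_hom (\<lambda>p. poly (in_var x p) (var x))"
    by unfold_locales (simp_all add: in_var_hom.hom_add in_var_hom.hom_mult)
  moreover have "comm_ring_hom (\<lambda>p::mpoly. p)"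
    by unfold_locales simp_all
  ultimately show ?thesis
    using mpoly_hom_eqI[of "\<lambda>p. poly (in_var x p) (var x)" "\<lambda>p. p" p] by (simp add: in_var_var)
qed

lemma in_var_free:
  assumes "x \<notin> vars p" shows "in_var x p = [:p:]"
proof -
  have "comm_ring_hom (\<lambda>p::mpoly. [:p:])"
    by unfold_locales (simp_all add: one_pCons)
  from mpoly_hom_eqI[where F = "in_var x" and p = p, OF in_var_hom.comm_ring_hom_axioms this] show ?thesis
    using assms by (metis in_var_const in_var_var)
qed

lemma vars_coeff_in_var: "vars (coeff (in_var x p) k) \<subseteq> vars p - {x}"
proof -
  define P where "P = (\<lambda>q::mpoly poly. \<forall>k. vars (coeff q k) \<subseteq> vars p - {x})"
  have add: "P (q + r)" if "P q" "P r" for q r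
    using that vars_add unfolding P_def coeff_add by blast
  have mult: "P (q * r)" if qr: "P q" "P r" for q r
    unfolding P_def
  proof
    fix k
    have "vars (coeff (q * r) k) \<subseteq> (\<Union>i\<le>k. vars (coeff q i * coeff r (k - i)))"
      unfolding coeff_mult by (rule vars_sum)
    also have "\<dots> \<subseteq> vars p - {x}"
      using qr vars_mult unfolding P_def by blast
    finally show "vars (coeff (q * r) k) \<subseteq> vars p - {x}" .
  qed
  have const: "P [:r:]" if "vars r \<subseteq> vars p - {x}" for r
    using that by (auto simp: P_def coeff_pCons split: nat.splits)
  have X: "P [:0, 1:]"
    by (auto simp: P_def coeff_pCons split: nat.splits)
  have one: "P 1" and zero: "P 0"
    using const[of 1] by (simp_all add: P_def one_pCons)
  have sum: "P (sum F A)" if "\<And>a. a \<in> A \<Longrightarrow> P (F a)" for F and A :: "((nat \<times> nat) \<Rightarrow>\<^sub>0 nat) set"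
    using that by (induction A rule: infinite_finite_induct) (auto simp: zero add)
  have prod: "P (prod F A)" if "\<And>a. a \<in> A \<Longrightarrow> P (F a)" for F and A :: "(nat \<times> nat) set"
    using that by (induction A rule: infinite_finite_induct) (auto simp: one mult)
  have power: "P (q ^ n)" if "P q" for q n
    using that by (induction n) (auto simp: one mult)
  have "P (in_var x p)"
    unfolding in_var_def poly_subst_def mon_val_def
  proof (intro sum mult prod power const)
    fix m v assume "m \<in> Poly_Mapping.keys p" "v \<in> Poly_Mapping.keys m"
    then have "v \<in> vars p" by (auto simp: vars_def)
    then show "P (if v = x then [:0, 1:] else [:var v:])"
      using X const[of "var v"] by simp
  qed simp
  then show ?thesis
    by (simp add: P_def)
qed

lemma degree_in_var_eq_0_iff: "degree (in_var x p) = 0 \<longleftrightarrow> x \<notin> vars p"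
proof
  assume "degree (in_var x p) = 0"
  then obtain c where c: "in_var x p = [:c:]"
    by (auto elim: degree_eq_zeroE)
  then have "p = c"
    using poly_in_var[of x p] by simp
  then show "x \<notin> vars p"
    using vars_coeff_in_var[of x p 0] c by auto
qed (simp add: in_var_free)

lemma in_var_eq_0_iff [simp]: "in_var x p = 0 \<longleftrightarrow> p = 0"
  using poly_in_var[of x p] by auto

lemma degree_in_var_mult:
  "p \<noteq> 0 \<Longrightarrow> q \<noteq> 0 \<Longrightarrow> degree (in_var x (p * q)) = degree (in_var x p) + degree (in_var x q)"
  by (simp add: in_var_hom.hom_mult degree_mult_eq)

text \<open>A variable occurs exactly if the degree in it is positive, and over a domain degrees
  add, so no variable is lost in a product of nonzero polynomials.\<close>

lemma vars_mult_eq: "p \<noteq> 0 \<Longrightarrow> q \<noteq> 0 \<Longrightarrow> vars (p * q) = vars p \<union> vars q"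
proof (rule Set.set_eqI)
  fix x assume "p \<noteq> 0" "q \<noteq> 0"
  then show "x \<in> vars (p * q) \<longleftrightarrow> x \<in> vars p \<union> vars q"
    using degree_in_var_mult[of p q x] degree_in_var_eq_0_iff[of x p] degree_in_var_eq_0_iff[of x q]
      degree_in_var_eq_0_iff[of x "p * q"] by (metis Un_iff add_is_0)
qed

lemma ev_in_var:
  "ev \<alpha> p = poly (map_poly (ev \<alpha>) (in_var x p)) (\<alpha> x)"
proof -
  interpret m: map_poly_comm_ring_hom "ev \<alpha>" ..
  have "comm_ring_hom (\<lambda>p. poly (map_poly (ev \<alpha>) (in_var x p)) (\<alpha> x))"
    by unfold_locales (simp_all add: in_var_hom.hom_add in_var_hom.hom_mult m.hom_add m.hom_mult)
  moreover have "map_poly (ev \<alpha>) [:c:] = [:ev \<alpha> c:]" "map_poly (ev \<alpha>) [:0, 1:] = [:0, 1:]" for c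
    by (intro poly_eqI; simp add: coeff_map_poly coeff_pCons split: nat.split)+
  ultimately show ?thesis
    using mpoly_hom_eqI[where F = "ev \<alpha>" and p = p, OF ev.subst_hom] by (simp add: in_var_var)
qed

lemma ev_upd_in_var:
  "ev (\<alpha>(x := t)) p = poly (map_poly (ev \<alpha>) (in_var x p)) t"
proof -
  have "map_poly (ev (\<alpha>(x := t))) (in_var x p) = map_poly (ev \<alpha>) (in_var x p)"
  proof (rule poly_eqI)
    fix n show "coeff (map_poly (ev (\<alpha>(x := t))) (in_var x p)) n = coeff (map_poly (ev \<alpha>) (in_var x p)) n"
      using vars_coeff_in_var[of x p n] by (auto simp: coeff_map_poly intro!: ev_cong)
  qed
  then show ?thesis
    using ev_in_var[of "\<alpha>(x := t)" p x] by simp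
qed

text \<open>Induction on the number of variables. Varying the value at \<open>x\<close> alone gives
  a complex polynomial in one indeterminate with all values zero, so each coefficient of the
  expansion in \<open>x\<close>, which has fewer variables, again vanishes at every point.\<close>

lemma ev_all_zero:
  assumes "\<And>\<alpha>. ev \<alpha> p = 0" shows "p = 0"
  using assms
proof (induction "card (vars p)" arbitrary: p rule: less_induct)
  case less
  show ?case
  proof (cases "vars p = {}")
    case True
    then obtain c where "p = const c" by (auto dest: vars_empty_const)
    then show ?thesis using less.prems[of "\<lambda>_. 0"] by simp
  next
    case False
    then obtain x where x: "x \<in> vars p" by auto
    have "coeff (in_var x p) k = 0" for k
    proof (rule less.hyps)
      show "card (vars (coeff (in_var x p) k)) < card (vars p)"
        using vars_coeff_in_var[of x p k] x by (intro psubset_card_mono) auto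
      fix \<alpha>
      have "poly (map_poly (ev \<alpha>) (in_var x p)) t = 0" for t
        using less.prems[of "\<alpha>(x := t)"] by (simp add: ev_upd_in_var)
      then have "map_poly (ev \<alpha>) (in_var x p) = 0"
        using poly_all_0_iff_0 by blast
      then show "ev \<alpha> (coeff (in_var x p) k) = 0"
        by (metis coeff_0 coeff_map_poly ev_hom.hom_zero)
    qed
    then have "in_var x p = 0" by (simp add: poly_eq_iff)
    then show ?thesis by simp
  qed
qed

section \<open>Multilinear polynomials\<close>

definition multilinear :: "mpoly \<Rightarrow> bool" where
  "multilinear p \<longleftrightarrow> (\<forall>x. degree (in_var x p) \<le> 1)"

lemma multilinear_mult:
  assumes "multilinear (p * q)" "p * q \<noteq> 0"
  shows "multilinear p" "multilinear q" "vars p \<inter> vars q = {}"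
proof -
  have *: "degree (in_var x p) + degree (in_var x q) \<le> 1" for x
    using assms degree_in_var_mult[of p q x] unfolding multilinear_def by (metis mult_not_zero)
  show "multilinear p" "multilinear q"
    unfolding multilinear_def using * by (meson add_leD1 add_leD2)+
  show "vars p \<inter> vars q = {}"
  proof (rule ccontr)
    assume "vars p \<inter> vars q \<noteq> {}"
    then obtain x where "x \<in> vars p" "x \<in> vars q" by auto
    then have "degree (in_var x p) > 0" "degree (in_var x q) > 0"
      by (simp_all add: degree_in_var_eq_0_iff flip: neq0_conv)
    then show False using *[of x] by simp
  qed
qed

lemma linear_in_var:
  assumes "degree (in_var x p) \<le> 1"
  shows "p = coeff (in_var x p) 1 * var x + coeff (in_var x p) 0"
proof -
  have "in_var x p = [:coeff (in_var x p) 0, coeff (in_var x p) 1:]"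
    using assms by (intro poly_eqI) (auto simp: coeff_pCons coeff_eq_0 split: nat.splits)
  then have "poly (in_var x p) (var x) = poly [:coeff (in_var x p) 0, coeff (in_var x p) 1:] (var x)"
    by simp
  then show ?thesis
    by (simp add: poly_in_var algebra_simps)
qed

lemma degree_in_var_linear:
  assumes "x \<notin> vars a" "x \<notin> vars b"
  shows "in_var x (a * var x + b) = [:b, a:]"
  by (simp add: in_var_hom.hom_add in_var_hom.hom_mult in_var_var in_var_free assms)

text \<open>Pseudo-division: modulo \<open>a * var x + b\<close> one may replace
  \<open>a * var x\<close> by \<open>- b\<close>. Multiplying \<open>g\<close> by \<open>a\<close>
  to the power of its degree in \<open>x\<close> provides enough factors \<open>a\<close> for every
  power of \<open>x\<close>.\<close>

lemma pseudo_reduce: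
  assumes "x \<notin> vars a" "x \<notin> vars b"
  shows "\<exists>n r. x \<notin> vars r \<and> (a * var x + b) dvd a ^ n * g - r"
proof -
  define G n where "G = in_var x g" and "n = degree G"
  define r where "r = (\<Sum>k\<le>n. coeff G k * (a ^ (n - k) * (- b) ^ k))"
  have "vars r \<subseteq> (\<Union>k\<in>{..n}. vars (coeff G k * (a ^ (n - k) * (- b) ^ k)))"
    unfolding r_def by (rule vars_sum)
  also have "\<dots> \<subseteq> (\<Union>k\<in>{..n}. vars (coeff G k) \<union> (vars a \<union> vars b))"
  proof (intro UN_mono order.refl)
    fix k
    have "vars (a ^ (n - k) * (- b) ^ k) \<subseteq> vars a \<union> vars b"
      using vars_mult[of "a ^ (n - k)" "(- b) ^ k"] vars_power[of a "n - k"] vars_power[of "- b" k] by auto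
    then show "vars (coeff G k * (a ^ (n - k) * (- b) ^ k)) \<subseteq> vars (coeff G k) \<union> (vars a \<union> vars b)"
      using vars_mult[of "coeff G k" "a ^ (n - k) * (- b) ^ k"] by auto
  qed
  finally have "x \<notin> vars r"
    using assms vars_coeff_in_var[of x g] by (auto simp: G_def)
  moreover have "(a * var x + b) dvd a ^ n * g - r"
  proof -
    have "g = (\<Sum>k\<le>n. coeff G k * var x ^ k)"
      using poly_in_var[of x g] by (simp add: poly_altdef G_def n_def)
    then have "a ^ n * g = (\<Sum>k\<le>n. a ^ n * (coeff G k * var x ^ k))"
      by (simp add: sum_distrib_left)
    also have "\<dots> = (\<Sum>k\<le>n. coeff G k * (a ^ (n - k) * (a * var x) ^ k))"
    proof (rule sum.cong)
      fix k assume "k \<in> {..n}"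
      then have "a ^ n = a ^ (n - k) * a ^ k" by (simp flip: power_add)
      then show "a ^ n * (coeff G k * var x ^ k) = coeff G k * (a ^ (n - k) * (a * var x) ^ k)"
        by (simp only: power_mult_distrib mult_ac)
    qed simp
    finally have "a ^ n * g = (\<Sum>k\<le>n. coeff G k * (a ^ (n - k) * (a * var x) ^ k))" .
    then have "a ^ n * g - r = (\<Sum>k\<le>n. coeff G k * (a ^ (n - k) * ((a * var x) ^ k - (- b) ^ k)))"
      by (simp add: r_def right_diff_distrib flip: sum_subtractf)
    moreover have "a * var x + b dvd (a * var x) ^ k - (- b) ^ k" for k
      using power_diff_sumr2[of "a * var x" k "- b"] by simp
    ultimately show ?thesis
      by (auto intro!: dvd_sum dvd_mult)
  qed
  ultimately show ?thesis by blast
qed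

text \<open>A substitute for the Gauss lemma. Up to powers of \<open>a\<close>, which can be
  cancelled by assumption, every polynomial is congruent to one without \<open>x\<close>, and for
  degree reasons the only multiple of \<open>a * var x + b\<close> without \<open>x\<close> is 0. So
  if a product is divisible, the remainder of one factor is 0.\<close>

lemma prime_elem_linear:
  assumes x: "x \<notin> vars a" "x \<notin> vars b" and a: "a \<noteq> 0"
    and cancel: "\<And>g. (a * var x + b) dvd a * g \<Longrightarrow> (a * var x + b) dvd g"
  shows "prime_elem (a * var x + b)"
proof (rule prime_elemI)
  let ?f = "a * var x + b"
  have deg: "degree (in_var x ?f) = 1"
    using a by (simp add: degree_in_var_linear x)
  show nz: "?f \<noteq> 0" using deg by (metis degree_0 in_var_hom.hom_zero zero_neq_one)
  have low: "r = 0" if dvd: "?f dvd r" and "x \<notin> vars r" for r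
  proof (rule ccontr)
    assume "r \<noteq> 0"
    obtain q where q: "r = ?f * q" using dvd unfolding dvd_def by blast
    have "q \<noteq> 0" using q \<open>r \<noteq> 0\<close> by (intro notI) (simp only: mult_zero_right)
    with q have "degree (in_var x r) \<ge> 1"
      using degree_in_var_mult[OF nz, of q x] deg by simp
    then show False using \<open>x \<notin> vars r\<close> degree_in_var_eq_0_iff[of x r] by simp
  qed
  show "\<not> ?f dvd 1" using low[of 1] by auto
  have pow: "?f dvd g" if "?f dvd a ^ n * g" for n g
    using that
  proof (induction n)
    case (Suc n)
    then have "?f dvd a * (a ^ n * g)" by (simp add: mult_ac)
    from Suc.IH[OF cancel[OF this]] show ?case .
  qed simp
  fix g h assume gh: "?f dvd g * h"
  obtain n r where r: "x \<notin> vars r" "?f dvd a ^ n * g - r"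
    using pseudo_reduce[OF x] by blast
  obtain m s where s: "x \<notin> vars s" "?f dvd a ^ m * h - s"
    using pseudo_reduce[OF x] by blast
  have "a ^ n * g * (a ^ m * h) - r * s = (a ^ n * g - r) * (a ^ m * h) + r * (a ^ m * h - s)"
    by (simp add: algebra_simps)
  then have "?f dvd a ^ n * g * (a ^ m * h) - r * s"
    using r(2) s(2) by (metis dvd_add dvd_mult dvd_mult2)
  moreover have "a ^ n * g * (a ^ m * h) = a ^ n * a ^ m * (g * h)"
    by (simp only: mult_ac)
  then have "?f dvd a ^ n * g * (a ^ m * h)"
    by (simp only: dvd_mult[OF gh])
  ultimately have "?f dvd a ^ n * g * (a ^ m * h) - (a ^ n * g * (a ^ m * h) - r * s)"
    by (metis dvd_diff)
  then have "?f dvd r * s"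
    by (simp only: diff_diff_eq2 add_diff_cancel_left')
  moreover have "x \<notin> vars (r * s)" using r(1) s(1) vars_mult[of r s] by auto
  ultimately have "r * s = 0" using low by blast
  then have "?f dvd a ^ n * g \<or> ?f dvd a ^ m * h"
    using r(2) s(2) by (metis diff_zero mult_eq_0_iff)
  then show "?f dvd g \<or> ?f dvd h"
    using pow by blast
qed

lemma const_dvd_one: "c \<noteq> 0 \<Longrightarrow> const c dvd 1"
  by (rule dvdI[of _ _ "const (inverse c)"]) (simp flip: const.hom_mult)

text \<open>For a variable other than \<open>x\<close>, the contributions of \<open>a\<close> and
  \<open>b\<close> to a coefficient are separated by the power of \<open>x\<close>, so high powers
  cannot cancel between the two parts.\<close>

lemma multilinear_linear_part:
  assumes "multilinear (a * var x + b)" "x \<notin> vars a" "x \<notin> vars b"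
  shows "multilinear a"
proof -
  have *: "coeff (in_var y a) k = 0 \<and> coeff (in_var y b) k = 0" if "k > 1" for y k
  proof (cases "y = x")
    case True
    then show ?thesis using that assms by (simp add: in_var_free coeff_pCons split: nat.splits)
  next
    case False
    define c d where "c = coeff (in_var y a) k" and "d = coeff (in_var y b) k"
    have "degree (in_var y (a * var x + b)) < k"
      using assms(1) that by (metis multilinear_def le_less_trans)
    then have "coeff (in_var y (a * var x + b)) k = 0"
      by (rule coeff_eq_0)
    then have "c * var x + d = 0"
      using False by (simp add: c_def d_def in_var_hom.hom_add in_var_hom.hom_mult in_var_var mult_ac)
    moreover have "x \<notin> vars c" "x \<notin> vars d"
      using vars_coeff_in_var assms(2,3) unfolding c_def d_def by blast+
    ultimately have "[:d, c:] = 0"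
      using degree_in_var_linear[of x c d] by simp
    then show ?thesis by (simp add: c_def d_def)
  qed
  show ?thesis
    unfolding multilinear_def by (auto intro!: degree_le simp: *)
qed

text \<open>Induction on the number of variables, with \<open>p = a * var x + b\<close> and the
  prime factors of \<open>a\<close> known. A prime factor of \<open>a\<close> that divides
  \<open>b\<close> splits off from \<open>p\<close>, and by multilinearity the quotient has fewer
  variables. If there is none, \<open>a\<close> can be cancelled modulo \<open>p\<close>, and
  \<open>p\<close> is itself prime.\<close>

lemma multilinear_prime_factors:
  assumes "multilinear p" "p \<noteq> 0"
  shows "\<exists>u ps. u dvd 1 \<and> (\<forall>\<pi>\<in>set ps. prime_elem \<pi>) \<and> p = u * prod_list ps"
  using assms
proof (induction "card (vars p)" arbitrary: p rule: less_induct)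
  case less
  show ?case
  proof (cases "vars p = {}")
    case True
    then obtain c where c: "p = const c" by (auto dest: vars_empty_const)
    then have "p dvd 1" using less.prems const_dvd_one[of c] by auto
    then show ?thesis by (intro exI[of _ p] exI[of _ "[]"]) auto
  next
    case False
    then obtain x where x: "x \<in> vars p" by auto
    define a b where "a = coeff (in_var x p) 1" and "b = coeff (in_var x p) 0"
    have p: "p = a * var x + b"
      using linear_in_var[of x p] less.prems(1) unfolding a_def b_def multilinear_def by blast
    have va: "vars a \<subseteq> vars p - {x}" and vb: "vars b \<subseteq> vars p - {x}"
      unfolding a_def b_def by (rule vars_coeff_in_var)+
    have a: "a \<noteq> 0"
      using p x vb by auto
    have ml: "multilinear a"
      using multilinear_linear_part[of a x b] less.prems(1) va vb p by blast
    have "card (vars a) < card (vars p)"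
      using va x by (intro psubset_card_mono) auto
    then obtain u ps where ps: "u dvd 1" "\<forall>\<pi>\<in>set ps. prime_elem \<pi>" "a = u * prod_list ps"
      using less.hyps[of a] a ml by blast
    show ?thesis
    proof (cases "\<exists>\<pi>\<in>set ps. \<pi> dvd b")
      case True
      then obtain \<pi> where \<pi>: "\<pi> \<in> set ps" "\<pi> dvd b" by auto
      have "\<pi> dvd a" using \<pi>(1) ps(3) by (simp add: prod_list_dvd)
      then have "\<pi> dvd p" using \<pi>(2) by (simp add: p)
      then obtain q where q: "p = \<pi> * q" by auto
      have prime: "prime_elem \<pi>" using \<pi> ps by auto
      have q0: "q \<noteq> 0" "\<pi> \<noteq> 0" using q less.prems(2) by auto
      have "vars \<pi> \<noteq> {}"
      proof
        assume "vars \<pi> = {}"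
        then obtain c where "\<pi> = const c" by (auto dest: vars_empty_const)
        then have "\<pi> dvd 1" using q0 const_dvd_one[of c] by auto
        then show False using prime by (simp add: prime_elem_def)
      qed
      moreover have "vars \<pi> \<inter> vars q = {}" "multilinear q" "vars p = vars \<pi> \<union> vars q"
        using multilinear_mult[of \<pi> q] less.prems q vars_mult_eq[of \<pi> q] q0 by auto
      ultimately have "card (vars q) < card (vars p)"
        by (intro psubset_card_mono) auto
      then obtain w qs where "w dvd 1" "\<forall>\<pi>\<in>set qs. prime_elem \<pi>" "q = w * prod_list qs"
        using less.hyps[of q] \<open>multilinear q\<close> q0 by metis
      then show ?thesis
        using prime q by (intro exI[of _ w] exI[of _ "\<pi> # qs"]) (auto simp: mult_ac)
    next
      case False
      \<comment> \<open>Such a prime divides \<open>a\<close> but not \<open>b\<close>, hence not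
        \<open>p\<close>; in \<open>\<pi> * g = p * q\<close> it must divide \<open>q\<close> and
        can be cancelled.\<close>
      have one: "p dvd g" if dvd: "p dvd \<pi> * g" and "\<pi> \<in> set ps" for \<pi> g
      proof -
        obtain q where q: "\<pi> * g = p * q" using dvd unfolding dvd_def by blast
        have prime: "prime_elem \<pi>" using that ps by auto
        have "\<pi> dvd a" using that ps(3) by (simp add: prod_list_dvd)
        then have "\<not> \<pi> dvd p" using False that(2) p by (metis dvd_add_right_iff dvd_mult2)
        moreover have "\<pi> dvd p * q" using q by (metis dvd_triv_left)
        ultimately have "\<pi> dvd q" using prime by (simp add: prime_elem_dvd_mult_iff)
        then obtain q' where "q = \<pi> * q'" by auto
        then have "\<pi> * g = \<pi> * (p * q')" using q by (simp add: mult_ac)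
        then have "g = p * q'" using prime by (simp add: prime_elem_def)
        then show ?thesis by simp
      qed
      have list: "p dvd g" if "p dvd prod_list rs * g" "set rs \<subseteq> set ps" for rs g
        using that
      proof (induction rs arbitrary: g)
        case (Cons r rs)
        then have "p dvd r * (prod_list rs * g)" by (simp only: prod_list.Cons mult.assoc)
        then have "p dvd prod_list rs * g" using one Cons.prems(2) by (meson list.set_intros(1) subsetD)
        then show ?case using Cons.IH Cons.prems(2) by (meson list.set_intros(2) subset_code(1))
      qed simp
      have "p dvd g" if "p dvd a * g" for g
      proof -
        have "a * g = prod_list ps * (u * g)" by (simp only: ps(3) mult_ac)
        then have "p dvd prod_list ps * (u * g)" using that by (simp only:)
        then have "p dvd u * g" using list by blast
        moreover obtain w where "1 = u * w" using ps(1) unfolding dvd_def by blast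
        then have "g = w * (u * g)" by (metis mult.commute mult.left_commute mult_1)
        ultimately show ?thesis by (metis dvd_mult)
      qed
      then have "prime_elem p"
        using prime_elem_linear[of x a b] va vb a unfolding p by blast
      then show ?thesis by (intro exI[of _ 1] exI[of _ "[p]"]) auto
    qed
  qed
qed

text \<open>By irreducibility a single prime factor already takes all variables; what remains is a
  nonzero constant, so \<open>p\<close> is associated to that prime.\<close>

lemma multilinear_irreducible_prime:
  assumes "multilinear p" "vars p \<noteq> {}"
    and irr: "\<And>g h. p = g * h \<Longrightarrow> vars g = {} \<or> vars h = {}"
  shows "prime_elem p"
proof -
  have p0: "p \<noteq> 0" using assms(2) by auto
  obtain u ps where ps: "u dvd 1" "\<forall>\<pi>\<in>set ps. prime_elem \<pi>" "p = u * prod_list ps"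
    using multilinear_prime_factors[OF assms(1) p0] by blast
  have unit: "q dvd 1" if "vars q = {}" "q \<noteq> 0" for q
    using that const_dvd_one vars_empty_const[of q] by auto
  obtain w where w: "1 = u * w" using ps(1) unfolding dvd_def by blast
  have "vars u = {}"
  proof -
    have "u \<noteq> 0" "w \<noteq> 0" using w by auto
    then show ?thesis using vars_mult_eq[of u w] w vars_one by auto
  qed
  then have "ps \<noteq> []" using ps(3) assms(2) by auto
  then obtain \<pi> qs where qs: "ps = \<pi> # qs" by (cases ps) auto
  have \<pi>: "prime_elem \<pi>" using ps(2) qs by simp
  have p: "p = \<pi> * (u * prod_list qs)" using ps(3) qs by (simp add: mult.left_commute)
  have nz: "\<pi> \<noteq> 0" "u * prod_list qs \<noteq> 0" using p p0 by auto
  have "vars \<pi> \<noteq> {}" using unit[of \<pi>] \<pi> nz by (auto simp: prime_elem_def)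
  then have "vars (u * prod_list qs) = {}" using irr[OF p] by auto
  then have "u * prod_list qs dvd 1" using unit nz by blast
  then obtain v where v: "1 = u * prod_list qs * v" unfolding dvd_def by blast
  have "\<pi> = \<pi> * (u * prod_list qs * v)" by (simp add: v[symmetric])
  also have "\<dots> = p * v" by (simp only: p mult.assoc)
  finally have pv: "\<pi> = p * v" .
  show ?thesis
  proof (rule prime_elemI)
    show "p \<noteq> 0" by fact
    show "\<not> p dvd 1"
    proof
      assume "p dvd 1"
      then have "\<pi> dvd 1" using p by (metis dvd_mult_left)
      then show False using \<pi> by (simp add: prime_elem_def)
    qed
    fix a b assume "p dvd a * b"
    then have "\<pi> dvd a * b" using p by (metis dvd_mult_left)
    then have "\<pi> dvd a \<or> \<pi> dvd b" using \<pi> prime_elem_dvd_mult_iff by blast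
    then show "p dvd a \<or> p dvd b" using pv by (metis dvd_mult_left)
  qed
qed

text \<open>An elementary Nullstellensatz. Where \<open>a\<close> is nonzero, the equation
  \<open>f = 0\<close> can be solved for \<open>x\<close>, so the remainder \<open>r\<close> of
  \<open>g\<close> without \<open>x\<close> vanishes there; thus \<open>r * a\<close> vanishes
  everywhere and \<open>r = 0\<close>. Then \<open>f\<close> divides a power of \<open>a\<close>
  times \<open>g\<close>, and it does not divide \<open>a\<close>, in which \<open>x\<close> does
  not occur.\<close>

lemma prime_multilinear_vanishing:
  assumes "multilinear f" "prime_elem f"
    and van: "\<And>\<alpha>. ev \<alpha> f = 0 \<Longrightarrow> ev \<alpha> g = 0"
  shows "f dvd g"
proof -
  have f0: "f \<noteq> 0" "\<not> f dvd 1" using assms(2) by (auto simp: prime_elem_def)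
  have "vars f \<noteq> {}" using f0 const_dvd_one vars_empty_const[of f] by auto
  then obtain x where x: "x \<in> vars f" by auto
  define a b where "a = coeff (in_var x f) 1" and "b = coeff (in_var x f) 0"
  have f: "f = a * var x + b"
    using linear_in_var[of x f] assms(1) unfolding a_def b_def multilinear_def by blast
  have va: "x \<notin> vars a" "x \<notin> vars b"
    using vars_coeff_in_var unfolding a_def b_def by blast+
  have a0: "a \<noteq> 0" using f x va by auto
  obtain n r where r: "x \<notin> vars r" "f dvd a ^ n * g - r"
    using pseudo_reduce[OF va] f by metis
  have "ev \<alpha> (r * a) = 0" for \<alpha>
  proof (cases "ev \<alpha> a = 0")
    case False
    define \<beta> where "\<beta> = \<alpha>(x := - ev \<alpha> b / ev \<alpha> a)"
    have eq: "ev \<beta> q = ev \<alpha> q" if "x \<notin> vars q" for q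
      using that by (intro ev_cong) (auto simp: \<beta>_def)
    have "ev \<beta> f = 0"
      unfolding f using False by (simp add: ev.subst_add ev.subst_mult eq va) (simp add: \<beta>_def)
    moreover from this have "ev \<beta> g = 0" by (rule van)
    moreover obtain q where "a ^ n * g - r = f * q" using r(2) unfolding dvd_def by blast
    ultimately have "ev \<beta> r = 0"
      by (metis ev.subst_mult ev.subst_one ev_hom.hom_minus cancel_comm_monoid_add_class.diff_cancel
          diff_zero eq_iff_diff_eq_0 mult_zero_left mult_zero_right)
    then show ?thesis using eq[OF r(1)] by (simp add: ev.subst_mult)
  qed (simp add: ev.subst_mult)
  then have "r * a = 0" by (rule ev_all_zero)
  then have "r = 0" using a0 by simp
  then have "f dvd a ^ n * g" using r(2) by simp
  moreover have "\<not> f dvd a"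
  proof
    assume "f dvd a"
    then obtain q where q: "a = f * q" unfolding dvd_def by blast
    then have "q \<noteq> 0" using a0 by auto
    then show False using vars_mult_eq[OF f0(1), of q] q x va(1) by auto
  qed
  then have "\<not> f dvd a ^ n" using assms(2) prime_elem_dvd_power by blast
  ultimately show ?thesis using assms(2) prime_elem_dvd_mult_iff by blast
qed

text \<open>Restriction of functions to the coordinate subspace on which the variables outside
  \<open>X\<close> are 0. With \<open>X\<close> the positions of the nilradical, it reduces
  polynomials modulo the linear generators of the ideal.\<close>

definition restrict_vars :: "(nat \<times> nat) set \<Rightarrow> mpoly \<Rightarrow> mpoly" where
  "restrict_vars X = poly_subst const (\<lambda>v. if v \<in> X then var v else 0)"

interpretation restrict_vars: comm_ring_hom "restrict_vars X" for X
  unfolding restrict_vars_def by (rule const.subst_hom)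

lemma restrict_vars_const [simp]: "restrict_vars X (const c) = const c"
  by (simp add: restrict_vars_def)

lemma restrict_vars_var: "restrict_vars X (var v) = (if v \<in> X then var v else 0)"
  by (simp add: restrict_vars_def)

lemma restrict_vars_id:
  assumes "vars p \<subseteq> X" shows "restrict_vars X p = p"
proof -
  have "comm_ring_hom (\<lambda>p::mpoly. p)"
    by unfold_locales simp_all
  from mpoly_hom_eqI[where F = "restrict_vars X" and p = p, OF restrict_vars.comm_ring_hom_axioms this]
  show ?thesis
    using assms by (metis restrict_vars_const restrict_vars_var subsetD)
qed

lemma ev_restrict_vars: "ev \<alpha> (restrict_vars X p) = ev (\<lambda>v. if v \<in> X then \<alpha> v else 0) p"
proof -
  have "comm_ring_hom (\<lambda>p. ev \<alpha> (restrict_vars X p))"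
    by unfold_locales (simp_all add: restrict_vars.hom_add restrict_vars.hom_mult ev.subst_add ev.subst_mult)
  from mpoly_hom_eqI[where G = "ev (\<lambda>v. if v \<in> X then \<alpha> v else 0)" and p = p, OF this ev.subst_hom]
  show ?thesis
    by (simp add: restrict_vars_var)
qed

lemma vars_subst_subset:
  assumes "\<And>v. v \<in> vars p \<Longrightarrow> vars (g v) \<subseteq> X"
  shows "vars (poly_subst const g p) \<subseteq> X"
proof -
  have "vars (const (Poly_Mapping.lookup p m) * mon_val g m) \<subseteq> X" if "m \<in> Poly_Mapping.keys p" for m
  proof -
    have "vars (mon_val g m) \<subseteq> (\<Union>v\<in>Poly_Mapping.keys m. vars (g v ^ Poly_Mapping.lookup m v))"
      unfolding mon_val_def by (rule vars_prod)
    also have "\<dots> \<subseteq> (\<Union>v\<in>Poly_Mapping.keys m. vars (g v))"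
      using vars_power by (intro UN_mono) auto
    also have "\<dots> \<subseteq> X"
    proof (intro UN_least assms)
      fix v assume "v \<in> Poly_Mapping.keys m"
      then show "v \<in> vars p" using that by (auto simp: vars_def)
    qed
    finally show ?thesis
      using vars_mult[of "const (Poly_Mapping.lookup p m)" "mon_val g m"] by auto
  qed
  then show ?thesis
    unfolding poly_subst_def by (intro order.trans[OF vars_sum] UN_least) blast
qed

lemma vars_restrict_vars: "vars (restrict_vars X p) \<subseteq> X"
  unfolding restrict_vars_def by (rule vars_subst_subset) auto

section \<open>Lowest coefficients of path determinants\<close>

text \<open>The rows \<open>0, \<dots>, n - 1\<close> and columns \<open>I, \<dots>, n + I - 1\<close> of \<open>B\<close> with its diagonal replaced by \<open>z\<close>;
  the entry \<open>(u, v)\<close> belongs to the edge from vertex \<open>u\<close> to vertex \<open>I + v\<close>.\<close>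

definition Hmat :: "nat \<Rightarrow> nat \<Rightarrow> (nat \<Rightarrow> nat \<Rightarrow> complex) \<Rightarrow> complex poly mat" where
  "Hmat n I B = Matrix.mat n n (\<lambda>(u, v). if u = I + v then [:0, 1:] else [:B u (I + v):])"

definition Hdet :: "nat \<Rightarrow> nat \<Rightarrow> (nat \<Rightarrow> nat \<Rightarrow> complex) \<Rightarrow> complex poly" where
  "Hdet n I B = Determinant.det (Hmat n I B)"

text \<open>A permutation \<open>p\<close> of the rows stands for the path system in which
  \<open>I + p u\<close> is the successor of \<open>u\<close>. Where this is \<open>u\<close>
  itself, the diagonal entry \<open>z\<close> is chosen: these are the vertices left out. The other
  rows, collected in \<open>pedges\<close>, start the edges.\<close>

definition pfix :: "nat \<Rightarrow> nat \<Rightarrow> (nat \<Rightarrow> nat) \<Rightarrow> nat set" where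
  "pfix n I p = {u. u < n \<and> u = I + p u}"

definition pedges :: "nat \<Rightarrow> nat \<Rightarrow> (nat \<Rightarrow> nat) \<Rightarrow> nat set" where
  "pedges n I p = {u. u < n \<and> u \<noteq> I + p u}"

lemma finite_pfix [simp]: "finite (pfix n I p)" and finite_pedges [simp]: "finite (pedges n I p)"
  by (simp_all add: pfix_def pedges_def)

lemma pfix_pedges: "{0..<n} = pfix n I p \<union> pedges n I p" "pfix n I p \<inter> pedges n I p = {}"
  by (auto simp: pfix_def pedges_def)

lemma signof_poly: "(signof p :: complex poly) = [:signof p:]"
  by (simp add: of_int_poly)

lemma Hmat_term:
  assumes "p permutes {0..<n}"
  shows "(\<Prod>u = 0..<n. Hmat n I B $$ (u, p u)) =
    monom (\<Prod>u\<in>pedges n I p. B u (I + p u)) (card (pfix n I p))"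
proof -
  have lt: "p u < n" if "u < n" for u
    using permutes_in_image[OF assms, of u] that by simp
  have "(\<Prod>u = 0..<n. Hmat n I B $$ (u, p u)) =
      (\<Prod>u\<in>pfix n I p. Hmat n I B $$ (u, p u)) * (\<Prod>u\<in>pedges n I p. Hmat n I B $$ (u, p u))"
    by (subst pfix_pedges(1)[of n I p]) (simp add: prod.union_disjoint pfix_pedges(2))
  also have "(\<Prod>u\<in>pfix n I p. Hmat n I B $$ (u, p u)) = (\<Prod>u\<in>pfix n I p. [:0, 1:])"
    by (rule prod.cong) (use lt in \<open>auto simp: pfix_def Hmat_def\<close>)
  also have "(\<Prod>u\<in>pedges n I p. Hmat n I B $$ (u, p u)) = (\<Prod>u\<in>pedges n I p. [:B u (I + p u):])"
    by (rule prod.cong) (use lt in \<open>auto simp: pedges_def Hmat_def\<close>)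
  also have "\<dots> = [:\<Prod>u\<in>pedges n I p. B u (I + p u):]"
    by (induction rule: infinite_finite_induct) (simp_all add: one_pCons)
  also have "(\<Prod>u\<in>pfix n I p. [:0, 1:]) * [:\<Prod>u\<in>pedges n I p. B u (I + p u):] =
      monom (\<Prod>u\<in>pedges n I p. B u (I + p u)) (card (pfix n I p))"
    by (simp add: monom_altdef mult.commute[of _ "[:_:]"])
  finally show ?thesis .
qed

lemma coeff_Hdet:
  "coeff (Hdet n I B) k =
    (\<Sum>p | p permutes {0..<n} \<and> card (pfix n I p) = k. signof p * (\<Prod>u\<in>pedges n I p. B u (I + p u)))"
proof -
  let ?P = "{p. p permutes {0..<n}}"
  let ?c = "\<lambda>p. signof p * (\<Prod>u\<in>pedges n I p. B u (I + p u))"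
  have fin: "finite ?P" by (simp add: finite_permutations)
  have "Hdet n I B = (\<Sum>p\<in>?P. signof p * (\<Prod>u = 0..<n. Hmat n I B $$ (u, p u)))"
    unfolding Hdet_def by (rule det_def') (simp add: Hmat_def)
  also have "\<dots> = (\<Sum>p\<in>?P. monom (?c p) (card (pfix n I p)))"
    by (rule sum.cong) (simp_all add: Hmat_term signof_poly smult_monom)
  finally have "coeff (Hdet n I B) k = (\<Sum>p\<in>?P. if card (pfix n I p) = k then ?c p else 0)"
    by (simp add: coeff_sum)
  also have "\<dots> = (\<Sum>p\<in>?P \<inter> {p. card (pfix n I p) = k}. ?c p)"
    by (simp add: sum.inter_restrict fin)
  also have "?P \<inter> {p. card (pfix n I p) = k} = {p. p permutes {0..<n} \<and> card (pfix n I p) = k}"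
    by auto
  finally show ?thesis .
qed

text \<open>The vertices \<open>0, \<dots>, n + I - 1\<close> are traversed by \<open>I\<close> disjoint paths from the first \<open>I\<close> to
  the last \<open>I\<close> vertices, and a path meets every level at most once.\<close>

definition climbs :: "nat \<Rightarrow> nat \<Rightarrow> (nat \<Rightarrow> nat) \<Rightarrow> (nat \<Rightarrow> nat) \<Rightarrow> bool" where
  "climbs n I L p \<longleftrightarrow> (\<forall>u<n. u = I + p u \<or> L u < L (I + p u))"

text \<open>The diagonal is exempt, as \<open>Hmat\<close> overwrites it by
  \<open>z\<close>.\<close>

definition level_strict :: "nat \<Rightarrow> nat \<Rightarrow> (nat \<Rightarrow> nat) \<Rightarrow> (nat \<Rightarrow> nat \<Rightarrow> complex) \<Rightarrow> bool" where
  "level_strict n I L B \<longleftrightarrow>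
    (\<forall>u v. u < n \<longrightarrow> I \<le> v \<longrightarrow> v < n + I \<longrightarrow> u \<noteq> v \<longrightarrow> B u v \<noteq> 0 \<longrightarrow> L u < L v)"

text \<open>The successor map is injective. Consider the vertices other than the first
  \<open>I\<close> that lie below level \<open>l\<close>, together with those that are used on level
  \<open>l\<close> and the ends of edges that jump over it: all of them have their predecessor below
  level \<open>l\<close>. Comparing with the number of vertices below \<open>l\<close>, only the
  first \<open>I\<close> vertices are left to account for paths that meet or cross the
  level.\<close>

lemma level_count:
  assumes p: "p permutes {0..<n}"
    and up: "climbs n I L p"
  shows "card {v. v < n + I \<and> L v = l \<and> v \<notin> pfix n I p} +
    card {u. u < n \<and> L u < l \<and> l < L (I + p u)} \<le> I"
proof -
  define U where "U = {v. v < n + I \<and> L v < l}"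
  define C where "C = {v. v < n + I \<and> L v = l \<and> v \<notin> pfix n I p}"
  define J where "J = {u. u < n \<and> L u < l \<and> l < L (I + p u)}"
  define W where "W = (U \<inter> {I..}) \<union> (C \<inter> {I..}) \<union> (\<lambda>u. I + p u) ` J"
  have fin [simp]: "finite U" "finite C" "finite J" by (simp_all add: U_def C_def J_def)
  have inj: "inj_on (\<lambda>u. I + p u) A" for A
    using permutes_inj[OF p] by (simp add: inj_on_def)
  have lt: "p u < n \<longleftrightarrow> u < n" for u
    using permutes_in_image[OF p, of u] by simp
  have "card W \<le> card U"
  proof -
    have "W \<subseteq> (\<lambda>u. I + p u) ` U"
    proof
      fix w assume w: "w \<in> W"
      then have wI: "I \<le> w" "w - I < n"
        by (auto simp: W_def U_def C_def J_def lt)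
      then obtain u where u: "p u = w - I" "u < n"
        using permutes_inverses(1)[OF p, of "w - I"] lt by metis
      then have pu: "w = I + p u" using wI by simp
      have "L u < l"
      proof (cases "w \<in> (\<lambda>u. I + p u) ` J")
        case True
        then obtain u' where "w = I + p u'" "u' \<in> J" by auto
        then have "p u = p u'" "u' \<in> J" using pu by auto
        then show ?thesis using permutes_inj[OF p] by (auto simp: J_def dest: injD)
      next
        case False
        then have "w < n + I" "L w < l \<or> L w = l \<and> w \<notin> pfix n I p"
          using w by (auto simp: W_def U_def C_def)
        moreover have "w = u \<Longrightarrow> w \<in> pfix n I p" using pu u(2) by (simp add: pfix_def)
        ultimately show ?thesis using up u(2) pu by (fastforce simp: climbs_def)
      qed
      then show "w \<in> (\<lambda>u. I + p u) ` U"
        using pu u(2) by (auto simp: U_def)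
    qed
    then have "card W \<le> card ((\<lambda>u. I + p u) ` U)" by (intro card_mono) auto
    also have "\<dots> = card U" by (rule card_image[OF inj])
    finally show ?thesis .
  qed
  moreover have "card W = card (U \<inter> {I..}) + card (C \<inter> {I..}) + card J"
  proof -
    have "card W = card ((U \<inter> {I..}) \<union> (C \<inter> {I..})) + card ((\<lambda>u. I + p u) ` J)"
      unfolding W_def by (rule card_Un_disjoint) (auto simp: U_def C_def J_def)
    also have "card ((U \<inter> {I..}) \<union> (C \<inter> {I..})) = card (U \<inter> {I..}) + card (C \<inter> {I..})"
      by (rule card_Un_disjoint) (auto simp: U_def C_def)
    finally show ?thesis by (simp add: card_image[OF inj])
  qed
  moreover have "card U = card (U \<inter> {I..}) + card (U \<inter> {..<I})"
    by (subst card_Un_disjoint[symmetric]) (auto intro: arg_cong[of _ _ card])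
  moreover have "card C = card (C \<inter> {I..}) + card (C \<inter> {..<I})"
    by (subst card_Un_disjoint[symmetric]) (auto intro: arg_cong[of _ _ card])
  moreover have "card (U \<inter> {..<I}) + card (C \<inter> {..<I}) \<le> I"
  proof -
    have "card (U \<inter> {..<I}) + card (C \<inter> {..<I}) = card ((U \<inter> {..<I}) \<union> (C \<inter> {..<I}))"
      by (rule card_Un_disjoint[symmetric]) (auto simp: U_def C_def)
    also have "\<dots> \<le> card {..<I}" by (intro card_mono) auto
    finally show ?thesis by simp
  qed
  ultimately show ?thesis
    unfolding C_def[symmetric] J_def[symmetric] by linarith
qed

definition level_card :: "(nat \<Rightarrow> nat) \<Rightarrow> nat \<Rightarrow> nat \<Rightarrow> nat" where
  "level_card L m l = card {v. v < m \<and> L v = l}"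

text \<open>Truncated subtraction lets a level with fewer than \<open>I\<close> vertices count as 0,
  so that it cannot compensate for larger ones: the sum consists of the unavoidable omissions of
  each level.\<close>

definition excess :: "(nat \<Rightarrow> nat) \<Rightarrow> nat \<Rightarrow> nat \<Rightarrow> nat" where
  "excess L m I = (\<Sum>l\<in>L ` {..<m}. level_card L m l - I)"

lemma card_levels:
  assumes "S \<subseteq> {..<m :: nat}"
  shows "card S = (\<Sum>l\<in>L ` {..<m}. card {v\<in>S. L v = (l :: nat)})"
proof -
  have "card S = card (\<Union>l\<in>L ` {..<m}. {v\<in>S. L v = l})"
    using assms by (intro arg_cong[of _ _ card]) auto
  also have "\<dots> = (\<Sum>l\<in>L ` {..<m}. card {v\<in>S. L v = l})"
  proof (rule card_UN_disjoint)
    show "\<forall>l\<in>L ` {..<m}. finite {v\<in>S. L v = l}"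
      using finite_subset[OF assms finite_lessThan] by simp
  qed auto
  finally show ?thesis .
qed

lemma pfix_level:
  assumes p: "p permutes {0..<n}"
    and up: "climbs n I L p"
  shows "level_card L (n + I) l + card {u. u < n \<and> L u < l \<and> l < L (I + p u)}
    \<le> card {v \<in> pfix n I p. L v = l} + I"
proof -
  have "{v. v < n + I \<and> L v = l} =
      {v \<in> pfix n I p. L v = l} \<union> {v. v < n + I \<and> L v = l \<and> v \<notin> pfix n I p}"
    by (auto simp: pfix_def)
  then have "level_card L (n + I) l =
      card {v \<in> pfix n I p. L v = l} + card {v. v < n + I \<and> L v = l \<and> v \<notin> pfix n I p}"
    unfolding level_card_def by (subst card_Un_disjoint[symmetric]) auto
  then show ?thesis
    using level_count[OF p up, of l] by linarith
qed

text \<open>The bound holds level by level, so a surplus on one level cannot be made up for on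
  another one. The strict form is what rules out unwanted permutations at a level of size
  \<open>I\<close>.\<close>

lemma excess_le_pfix:
  assumes p: "p permutes {0..<n}"
    and up: "climbs n I L p"
  shows "excess L (n + I) I \<le> card (pfix n I p)"
    and "\<And>l. l \<in> L ` {..<n + I} \<Longrightarrow> level_card L (n + I) l - I < card {v \<in> pfix n I p. L v = l} \<Longrightarrow>
      excess L (n + I) I < card (pfix n I p)"
proof -
  have eq: "card (pfix n I p) = (\<Sum>l\<in>L ` {..<n + I}. card {v \<in> pfix n I p. L v = l})"
    by (rule card_levels) (auto simp: pfix_def)
  have le: "level_card L (n + I) l - I \<le> card {v \<in> pfix n I p. L v = l}" for l
    using pfix_level[OF p up, of l] by linarith
  show "excess L (n + I) I \<le> card (pfix n I p)"
    unfolding excess_def eq by (rule sum_mono[OF le])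
  show "excess L (n + I) I < card (pfix n I p)"
    if "l \<in> L ` {..<n + I}" "level_card L (n + I) l - I < card {v \<in> pfix n I p. L v = l}" for l
    unfolding excess_def eq by (rule sum_strict_mono_ex1) (use le that in auto)
qed

lemma term_nonzero_up:
  assumes B: "level_strict n I L B"
    and p: "p permutes {0..<n}"
    and nz: "(\<Prod>u\<in>pedges n I p. B u (I + p u)) \<noteq> 0"
  shows "climbs n I L p"
  unfolding climbs_def
proof (intro allI impI disjCI)
  fix u assume u: "u < n" and "\<not> L u < L (I + p u)"
  show "u = I + p u"
  proof (rule ccontr)
    assume False: "u \<noteq> I + p u"
  then have "u \<in> pedges n I p" using u by (simp add: pedges_def)
  then have "B u (I + p u) \<noteq> 0" using nz finite_pedges by (meson prod_zero)
  moreover have "p u < n" using permutes_in_image[OF p, of u] u by simp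
  ultimately show False using B u False \<open>\<not> L u < L (I + p u)\<close> by (auto simp: level_strict_def)
  qed
qed

lemma coeff_Hdet_low:
  assumes B: "level_strict n I L B"
    and k: "k < excess L (n + I) I"
  shows "coeff (Hdet n I B) k = 0"
  unfolding coeff_Hdet
proof (rule sum.neutral, intro ballI)
  fix p assume "p \<in> {p. p permutes {0..<n} \<and> card (pfix n I p) = k}"
  then have p: "p permutes {0..<n}" "card (pfix n I p) = k" by auto
  show "signof p * (\<Prod>u\<in>pedges n I p. B u (I + p u)) = 0"
  proof (rule ccontr)
    assume "signof p * (\<Prod>u\<in>pedges n I p. B u (I + p u)) \<noteq> 0"
    then have "(\<Prod>u\<in>pedges n I p. B u (I + p u)) \<noteq> 0" by auto
    note up = term_nonzero_up[OF B p(1) this]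
    show False using excess_le_pfix(1)[OF p(1) up] p(2) k by simp
  qed
qed

text \<open>All \<open>I\<close> paths have to pass through a level of exactly \<open>I\<close> vertices.\<close>

lemma coeff_Hdet_factor:
  assumes B: "level_strict n I L B"
    and c: "c \<le> n" "0 < I"
    and L: "\<And>v. v < c \<Longrightarrow> L v < l" "\<And>v. c \<le> v \<Longrightarrow> v < c + I \<Longrightarrow> L v = l"
      "\<And>v. c + I \<le> v \<Longrightarrow> v < n + I \<Longrightarrow> l < L v"
    and k: "k \<le> excess L (n + I) I"
  shows "coeff (Hdet n I B) k = coeff (Hdet c I B * Hdet (n - c) I (\<lambda>u v. B (c + u) (c + v))) k"
proof -
  \<comment> \<open>Column \<open>v\<close> belongs to vertex \<open>I + v\<close>, so
    \<open>v < c\<close> means a vertex up to and including level \<open>l\<close>, while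
    \<open>u < c\<close> means a vertex strictly below it. The \<open>off\<close> entries are those
    outside the two diagonal blocks.\<close>
  define off where "off = (\<lambda>u v. (u < c) \<noteq> (v < c))"
  define M where "M = Matrix.mat n n (\<lambda>(u, v). if off u v then 0 else Hmat n I B $$ (u, v))"
  have M: "M \<in> carrier_mat n n" by (simp add: M_def)
  have "M = four_block_mat (Hmat c I B) (0\<^sub>m c (n - c)) (0\<^sub>m (n - c) c)
      (Hmat (n - c) I (\<lambda>u v. B (c + u) (c + v)))"
    by (rule eq_matI) (use c in \<open>auto simp: M_def Hmat_def off_def\<close>)
  then have det: "Determinant.det M = Hdet c I B * Hdet (n - c) I (\<lambda>u v. B (c + u) (c + v))"
    unfolding Hdet_def
    by (simp add: det_four_block_mat_upper_right_zero[where n = c and m = "n - c"] Hmat_def)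
  have cl: "level_card L (n + I) l = I" "l \<in> L ` {..<n + I}"
  proof -
    have "{v. v < n + I \<and> L v = l} = {c..<c + I}"
    proof (intro equalityI subsetI)
      fix v assume "v \<in> {v. v < n + I \<and> L v = l}"
      then show "v \<in> {c..<c + I}"
        using L(1)[of v] L(3)[of v] by (cases "v < c"; cases "v < c + I") auto
    qed (use L(2) c in auto)
    then show "level_card L (n + I) l = I" by (simp add: level_card_def)
    show "l \<in> L ` {..<n + I}"
      using L(2)[of c] c by (intro image_eqI[of _ _ c]) auto
  qed
  have eq: "coeff (signof p * (\<Prod>u = 0..<n. M $$ (u, p u))) k =
      coeff (signof p * (\<Prod>u = 0..<n. Hmat n I B $$ (u, p u))) k" if p: "p permutes {0..<n}" for p
  proof (cases "\<exists>u<n. off u (p u)")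
    case False
    then have "(\<Prod>u = 0..<n. M $$ (u, p u)) = (\<Prod>u = 0..<n. Hmat n I B $$ (u, p u))"
      using permutes_in_image[OF p] by (intro prod.cong) (auto simp: M_def)
    then show ?thesis by simp
  next
    case True
    then obtain u where u: "u < n" "off u (p u)" by auto
    have pu: "p u < n" using permutes_in_image[OF p, of u] u by simp
    have "M $$ (u, p u) = 0" using u pu by (simp add: M_def)
    then have "(\<Prod>u = 0..<n. M $$ (u, p u)) = 0" using u by (intro prod_zero) auto
    \<comment> \<open>A permutation through such an entry either leaves out a vertex of level
      \<open>l\<close> or jumps over the level, and then fewer than \<open>I\<close> paths pass
      through its \<open>I\<close> vertices. Either way a vertex of the level is left out although
      none has to be, and the power of \<open>z\<close> exceeds the excess.\<close>
    moreover have "coeff (signof p * (\<Prod>u = 0..<n. Hmat n I B $$ (u, p u))) k = 0"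
    proof (rule ccontr)
      assume nz: "coeff (signof p * (\<Prod>u = 0..<n. Hmat n I B $$ (u, p u))) k \<noteq> 0"
      then have "(\<Prod>u\<in>pedges n I p. B u (I + p u)) \<noteq> 0" and k': "card (pfix n I p) = k"
        by (auto simp: Hmat_term[OF p] signof_poly split: if_splits)
      note up = term_nonzero_up[OF B p this(1)]
      have "0 < card {v \<in> pfix n I p. L v = l}"
      proof (cases "u = I + p u")
        case True
        then have "u \<in> {v \<in> pfix n I p. L v = l}"
          using u pu L(2)[of u] by (auto simp: pfix_def off_def)
        then show ?thesis by (intro card_gt_0_iff[THEN iffD2]) auto
      next
        case False
        then have lt: "L u < L (I + p u)" using up u(1) by (auto simp: climbs_def)
        have uc: "u < c"
        proof (rule ccontr)
          assume "\<not> u < c"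
          then have "l \<le> L u" using L(2)[of u] L(3)[of u] u(1) by (cases "u < c + I") auto
          moreover have "L (I + p u) \<le> l"
            using u(2) \<open>\<not> u < c\<close> L(1)[of "I + p u"] L(2)[of "I + p u"]
            by (cases "I + p u < c") (auto simp: off_def)
          ultimately show False using lt by simp
        qed
        then have "u \<in> {u. u < n \<and> L u < l \<and> l < L (I + p u)}"
          using u pu L(1)[of u] L(3)[of "I + p u"] by (auto simp: off_def)
        then have "0 < card {u. u < n \<and> L u < l \<and> l < L (I + p u)}"
          by (intro card_gt_0_iff[THEN iffD2]) auto
        then show ?thesis using pfix_level[OF p up, of l] cl(1) by linarith
      qed
      then have "excess L (n + I) I < card (pfix n I p)"
        using excess_le_pfix(2)[OF p up, of l] cl by simp
      then show False using k k' by simp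
    qed
    ultimately show ?thesis by (simp only: mult_zero_right coeff_0)
  qed
  have "coeff (Hdet n I B) k = (\<Sum>p | p permutes {0..<n}. coeff (signof p * (\<Prod>u = 0..<n. Hmat n I B $$ (u, p u))) k)"
    unfolding Hdet_def by (subst det_def'[where n = n]) (simp_all add: Hmat_def coeff_sum)
  also have "\<dots> = (\<Sum>p | p permutes {0..<n}. coeff (signof p * (\<Prod>u = 0..<n. M $$ (u, p u))) k)"
    by (rule sum.cong) (simp_all add: eq)
  also have "\<dots> = coeff (Determinant.det M) k"
    by (subst det_def'[OF M]) (simp add: coeff_sum)
  finally show ?thesis by (simp add: det)
qed

section \<open>Path systems given by labels\<close>

definition nxt :: "(nat \<Rightarrow> nat) \<Rightarrow> nat \<Rightarrow> nat \<Rightarrow> bool" where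
  "nxt lab u w \<longleftrightarrow> u < w \<and> lab w = lab u \<and> (\<forall>x. u < x \<and> x < w \<longrightarrow> lab x \<noteq> lab u)"

lemma nxt_unique: "nxt lab u w \<Longrightarrow> nxt lab u w' \<Longrightarrow> w = w'"
  unfolding nxt_def by (metis linorder_neqE_nat)

lemma nxt_unique': "nxt lab u w \<Longrightarrow> nxt lab u' w \<Longrightarrow> u = u'"
  unfolding nxt_def by (metis linorder_neqE_nat)

lemma nxt_exists:
  assumes "u < w" "lab w = lab u" shows "\<exists>w'\<le>w. nxt lab u w'"
proof -
  define w' where "w' = (LEAST w. u < w \<and> lab w = lab u)"
  have "u < w' \<and> lab w' = lab u" unfolding w'_def by (rule LeastI[of _ w]) (use assms in auto)
  moreover have "\<not> (u < x \<and> lab x = lab u)" if "x < w'" for x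
    using that not_less_Least unfolding w'_def by blast
  moreover have "w' \<le> w" unfolding w'_def by (rule Least_le) (use assms in auto)
  ultimately show ?thesis unfolding nxt_def by blast
qed

text \<open>A labelling decomposes the vertices into paths; the paths with labels below \<open>I\<close> are used,
  all other vertices are fixed.\<close>

definition good_labels :: "nat \<Rightarrow> nat \<Rightarrow> (nat \<Rightarrow> nat) \<Rightarrow> bool" where
  "good_labels n I lab \<longleftrightarrow> bij_betw lab {..<I} {..<I} \<and> bij_betw lab {n..<n + I} {..<I}"

text \<open>For a label below \<open>I\<close> the successor is the next vertex with this label. It
  exists because the last \<open>I\<close> vertices carry every such label, and it is not among the
  first \<open>I\<close> vertices because these carry each label only once.\<close>

lemma label_perm:
  assumes "good_labels n I lab"
  obtains p where "p permutes {0..<n}" "pfix n I p = {v. v < n + I \<and> I \<le> lab v}"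
    "\<And>u. u < n \<Longrightarrow> lab u < I \<Longrightarrow> nxt lab u (I + p u)"
proof -
  have bij: "bij_betw lab {..<I} {..<I}" "bij_betw lab {n..<n + I} {..<I}"
    using assms by (auto simp: good_labels_def)
  have start: "inj_on lab {..<I}" "\<And>u. u < I \<Longrightarrow> lab u < I"
    using bij_betwE[OF bij(1)] bij_betw_imp_inj_on[OF bij(1)] by auto
  have fin: "\<And>u. n \<le> u \<Longrightarrow> u < n + I \<Longrightarrow> lab u < I"
    using bij_betwE[OF bij(2)] by auto
  have fin': "\<exists>u. n \<le> u \<and> u < n + I \<and> lab u = q" if "q < I" for q
    using bij_betw_imp_surj_on[OF bij(2)] that by (metis atLeastLessThan_iff imageE lessThan_iff)
  define \<pi> where "\<pi> = (\<lambda>u. if lab u < I then (THE w. nxt lab u w) else u)"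
  have nxt: "nxt lab u (\<pi> u)" "I \<le> \<pi> u" "\<pi> u < n + I" if u: "u < n" "lab u < I" for u
  proof -
    obtain w where w: "n \<le> w" "w < n + I" "lab w = lab u" using fin'[OF u(2)] by auto
    then obtain w' where w': "w' \<le> w" "nxt lab u w'" using nxt_exists[of u w lab] u by auto
    then have "\<pi> u = w'" using u nxt_unique unfolding \<pi>_def by auto
    then show "nxt lab u (\<pi> u)" "\<pi> u < n + I" using w w' by auto
    show "I \<le> \<pi> u"
    proof (rule ccontr)
      assume "\<not> I \<le> \<pi> u"
      then show False
        using \<open>nxt lab u (\<pi> u)\<close> start(1) unfolding nxt_def by (auto dest: inj_onD)
    qed
  qed
  have \<pi>2: "\<pi> u = u" "I \<le> \<pi> u" if "\<not> lab u < I" for u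
    using that start(2)[of u] unfolding \<pi>_def by (simp, metis not_less)
  have rng: "I \<le> \<pi> u \<and> \<pi> u < n + I" if "u < n" for u
    using nxt[of u] \<pi>2[of u] that by (cases "lab u < I") auto
  have lab\<pi>: "lab (\<pi> u) = lab u" if "u < n" for u
    using nxt[of u] \<pi>2[of u] that by (cases "lab u < I") (auto simp: nxt_def)
  define p where "p = (\<lambda>u. if u < n then \<pi> u - I else u)"
  have p\<pi>: "I + p u = \<pi> u" if "u < n" for u
    using rng[OF that] that by (simp add: p_def)
  have "inj_on p {0..<n}"
  proof (rule inj_onI)
    fix u u' assume u: "u \<in> {0..<n}" "u' \<in> {0..<n}" "p u = p u'"
    then have eq: "\<pi> u = \<pi> u'" using p\<pi>[of u] p\<pi>[of u'] by auto
    then have l: "lab u = lab u'" using lab\<pi>[of u] lab\<pi>[of u'] u by auto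
    show "u = u'"
    proof (cases "lab u < I")
      case True
      then have "nxt lab u (\<pi> u)" "nxt lab u' (\<pi> u)"
        using nxt(1)[of u] nxt(1)[of u'] eq l u by auto
      then show ?thesis by (rule nxt_unique')
    next
      case False
      then show ?thesis using \<pi>2(1)[of u] \<pi>2(1)[of u'] eq l by metis
    qed
  qed
  moreover have "p ` {0..<n} \<subseteq> {0..<n}" using rng by (force simp: p_def)
  ultimately have "bij_betw p {0..<n} {0..<n}"
    by (simp add: bij_betw_def endo_inj_surj)
  then have perm: "p permutes {0..<n}" by (intro bij_imp_permutes) (auto simp: p_def)
  have "u = I + p u \<longleftrightarrow> I \<le> lab u" if "u < n" for u
    using p\<pi>[OF that] nxt(1)[OF that] \<pi>2(1)[of u] by (cases "lab u < I") (auto simp: nxt_def)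
  moreover have "v < n" if "v < n + I" "I \<le> lab v" for v
    using fin[of v] that by (meson not_le)
  ultimately have "pfix n I p = {v. v < n + I \<and> I \<le> lab v}"
    unfolding pfix_def by (intro Collect_cong) (metis trans_less_add1)
  then show ?thesis using that perm nxt(1) p\<pi> by metis
qed

text \<open>Only one permutation survives in this coefficient, which is therefore a sign. Vertices
  with labels from \<open>I\<close> on can only move forward among themselves, hence stay put; by
  cardinality no other vertex is left out, and the remaining successors are forced.\<close>

lemma coeff_Hdet_labels:
  assumes good: "good_labels n I lab"
    and B: "\<And>u v. u < n \<Longrightarrow> I \<le> v \<Longrightarrow> v < n + I \<Longrightarrow> B u v = (if nxt lab u v then 1 else 0)"
  shows "coeff (Hdet n I B) (card {v. v < n + I \<and> I \<le> lab v}) \<noteq> 0"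
proof -
  define Y where "Y = {v. v < n + I \<and> I \<le> lab v}"
  obtain p0 where p0: "p0 permutes {0..<n}" "pfix n I p0 = Y"
      "\<And>u. u < n \<Longrightarrow> lab u < I \<Longrightarrow> nxt lab u (I + p0 u)"
    using label_perm[OF good] unfolding Y_def by blast
  have YI: "v < n" "I \<le> v" if "v \<in> Y" for v
    using that p0(2) by (auto simp: pfix_def)
  let ?c = "\<lambda>p. signof p * (\<Prod>u\<in>pedges n I p. B u (I + p u))"
  have other: "?c p = 0" if p: "p permutes {0..<n}" "card (pfix n I p) = card Y" and "p \<noteq> p0" for p
  proof (rule ccontr)
    assume nz: "?c p \<noteq> 0"
    have lt: "p u < n" if "u < n" for u using permutes_in_image[OF p(1), of u] that by simp
    have st: "u = I + p u \<or> nxt lab u (I + p u)" if "u < n" for u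
    proof (cases "u = I + p u")
      case False
      then have "u \<in> pedges n I p" using that by (simp add: pedges_def)
      then have "B u (I + p u) \<noteq> 0" using nz by (metis finite_pedges prod_zero mult_zero_right)
      then show ?thesis using B[of u "I + p u"] lt[OF that] that by (auto split: if_splits)
    qed simp
    have "I + p u \<in> Y" if "u \<in> Y" for u
      using st[of u] that YI[OF that] lt[of u] by (auto simp: Y_def nxt_def)
    then have sub: "(\<lambda>u. I + p u) ` Y \<subseteq> Y" by auto
    have finY: "finite Y" by (simp add: Y_def)
    have inj: "inj_on (\<lambda>u. I + p u) Y"
      using permutes_inj[OF p(1)] by (simp add: inj_on_def)
    have bij: "(\<lambda>u. I + p u) ` Y = Y" using endo_inj_surj[OF finY sub inj] .
    \<comment> \<open>A permutation of a finite set of numbers that decreases none of them is the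
      identity, as comparing the sums shows.\<close>
    have "(\<Sum>u\<in>Y. u) = (\<Sum>u\<in>Y. I + p u)"
      using sum.reindex[OF inj, of "\<lambda>u. u"] bij by simp
    moreover have "u \<le> I + p u" if "u \<in> Y" for u
      using st[of u] YI[OF that] by (auto simp: nxt_def)
    ultimately have fixY: "u = I + p u" if "u \<in> Y" for u
      using sum_mono_inv[of "\<lambda>u. u" Y "\<lambda>u. I + p u" u] that finY by blast
    then have "Y \<subseteq> pfix n I p" using YI by (auto simp: pfix_def)
    then have fixeq: "pfix n I p = Y" using p(2) by (metis card_subset_eq finite_pfix)
    have "p u = p0 u" for u
    proof (cases "u < n")
      case True
      show ?thesis
      proof (cases "u \<in> Y")
        case True
        then have "u = I + p u" "u = I + p0 u" using fixeq p0(2) by (auto simp: pfix_def)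
        then show ?thesis by linarith
      next
        case False
        then have "u \<noteq> I + p u" using fixeq True by (auto simp: pfix_def)
        moreover have "lab u < I" using False True by (auto simp: Y_def)
        ultimately have "nxt lab u (I + p u)" "nxt lab u (I + p0 u)"
          using st[OF True] p0(3)[OF True] by auto
        then show ?thesis using nxt_unique by fastforce
      qed
    next
      case False
      then show ?thesis using p(1) p0(1) by (simp add: permutes_def)
    qed
    then show False using \<open>p \<noteq> p0\<close> by auto
  qed
  have "coeff (Hdet n I B) (card Y) = (\<Sum>p\<in>{p0}. ?c p)"
    unfolding coeff_Hdet
  proof (rule sum.mono_neutral_right)
    show "finite {p. p permutes {0..<n} \<and> card (pfix n I p) = card Y}"
      by (rule finite_subset[OF _ finite_permutations[of "{0..<n}"]]) auto
    show "{p0} \<subseteq> {p. p permutes {0..<n} \<and> card (pfix n I p) = card Y}"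
      using p0 by auto
    show "\<forall>p\<in>{p. p permutes {0..<n} \<and> card (pfix n I p) = card Y} - {p0}. ?c p = 0"
      using other by blast
  qed
  also have "\<dots> = signof p0"
  proof -
    have "B u (I + p0 u) = 1" if "u \<in> pedges n I p0" for u
    proof -
      have "u < n" "u \<notin> Y" using that unfolding p0(2)[symmetric] by (auto simp: pedges_def pfix_def)
      then have u: "u < n" "lab u < I" by (auto simp: Y_def)
      then show ?thesis
        using B[of u "I + p0 u"] p0(3)[of u] permutes_in_image[OF p0(1), of u] by simp
    qed
    then show ?thesis by simp
  qed
  finally show ?thesis by (simp add: Y_def sign_def)
qed

section \<open>Bordered determinants and the Jordan type\<close>

text \<open>All determinants of \<open>z + A\<close> bordered by \<open>I\<close> constant rows and columns are divisible
  by \<open>z\<^sup>e\<close>; this is a basis-free way to talk about the minors of size \<open>k - I\<close> of \<open>z + A\<close>.\<close>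

definition hdiv :: "nat \<Rightarrow> complex mat \<Rightarrow> nat \<Rightarrow> nat \<Rightarrow> bool" where
  "hdiv k A I e \<longleftrightarrow> (\<forall>B. (\<forall>a<k. \<forall>b<k. B (I + a) (I + b) = A $$ (a, b)) \<longrightarrow>
     (\<forall>i<e. coeff (Hdet (k + I) I B) i = 0))"

lemma hdiv_mono: "hdiv k A I e \<Longrightarrow> e' \<le> e \<Longrightarrow> hdiv k A I e'"
  unfolding hdiv_def by (meson order_less_le_trans)

abbreviation cmat :: "complex mat \<Rightarrow> complex poly mat" where
  "cmat \<equiv> map_mat (\<lambda>c. [:c:])"

interpretation cpoly: comm_ring_hom "\<lambda>c::complex. [:c:]"
  by unfold_locales (simp_all add: one_pCons)

text \<open>The zero diagonal of \<open>A\<close> matters here: \<open>Hmat\<close> puts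
  \<open>z\<close> in place of the diagonal entries, whereas the block contains
  \<open>z + A\<close>.\<close>

lemma bordered_matrix:
  assumes A: "A \<in> carrier_mat k k" "\<And>a. a < k \<Longrightarrow> A $$ (a, a) = 0"
    and B: "\<And>a b. a < k \<Longrightarrow> b < k \<Longrightarrow> B (I + a) (I + b) = A $$ (a, b)"
  shows "Hmat (k + I) I B = four_block_mat
    (cmat (Matrix.mat I k (\<lambda>(u, v). B u (I + v)))) (cmat (Matrix.mat I I (\<lambda>(u, v). B u (I + k + v))))
    ([:0, 1:] \<cdot>\<^sub>m 1\<^sub>m k + cmat A) (cmat (Matrix.mat k I (\<lambda>(u, v). B (I + u) (I + k + v))))"
    (is "?L = ?R")
proof (rule eq_matI)
  show dims: "dim_row ?L = dim_row ?R" "dim_col ?L = dim_col ?R"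
    using A(1) by (auto simp: Hmat_def)
  fix u v assume "u < dim_row ?R" "v < dim_col ?R"
  then have uv: "u < k + I" "v < k + I" using dims by (simp_all add: Hmat_def)
  show "?L $$ (u, v) = ?R $$ (u, v)"
  proof (cases "u < I")
    case True
    then show ?thesis using uv A(1) by (auto simp: Hmat_def)
  next
    case False
    then obtain a where a: "u = I + a" "a < k"
      using uv by (metis add.commute le_Suc_ex not_less nat_add_left_cancel_less)
    show ?thesis
      using uv A(1) A(2)[of a] B[of a v] a by (auto simp: Hmat_def)
  qed
qed

text \<open>Block diagonal matrices made of \<open>P\<close>, \<open>Q\<close> and identity matrices
  turn the block \<open>z + A'\<close> into \<open>z + A\<close> and otherwise change only the
  border, over which \<open>hdiv\<close> quantifies; the determinants of \<open>P\<close> and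
  \<open>Q\<close> cancel.\<close>

lemma hdiv_similar:
  assumes A: "A \<in> carrier_mat k k" "\<And>a. a < k \<Longrightarrow> A $$ (a, a) = 0"
    and A': "A' \<in> carrier_mat k k" "\<And>a. a < k \<Longrightarrow> A' $$ (a, a) = 0"
    and sim: "similar_mat A A'" and hd: "hdiv k A I e"
  shows "hdiv k A' I e"
  unfolding hdiv_def
proof (intro allI impI)
  fix B i assume B: "\<forall>a<k. \<forall>b<k. B (I + a) (I + b) = A' $$ (a, b)" and i: "i < e"
  obtain P Q where "similar_mat_wit A A' P Q" using sim by (auto simp: similar_mat_def)
  note PQ = similar_mat_witD2[OF A(1) this]
  define V W U where "V = Matrix.mat I k (\<lambda>(u, v). B u (I + v))"
    and "W = Matrix.mat I I (\<lambda>(u, v). B u (I + k + v))"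
    and "U = Matrix.mat k I (\<lambda>(u, v). B (I + u) (I + k + v))"
  have carr [simp]: "V \<in> carrier_mat I k" "W \<in> carrier_mat I I" "U \<in> carrier_mat k I"
    by (simp_all add: V_def W_def U_def)
  define Z where "Z = [:0, 1:] \<cdot>\<^sub>m 1\<^sub>m k + cmat A'"
  have Zc: "Z \<in> carrier_mat k k" using A'(1) by (simp add: Z_def)
  have cV: "cmat V \<in> carrier_mat I k" and cW: "cmat W \<in> carrier_mat I I" and cU: "cmat U \<in> carrier_mat k I"
    and cP: "cmat P \<in> carrier_mat k k" and cQ: "cmat Q \<in> carrier_mat k k"
    and cA: "cmat A' \<in> carrier_mat k k" and z1: "[:0, 1:] \<cdot>\<^sub>m 1\<^sub>m k \<in> carrier_mat k k"
    using PQ A' carr by auto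
  have cPQ: "cmat P * cmat Q = 1\<^sub>m k"
    using PQ(1) cpoly.mat_hom_mult[OF PQ(6,7)] by (simp add: cpoly.mat_hom_one)
  have H: "Hmat (k + I) I B = four_block_mat (cmat V) (cmat W) Z (cmat U)"
    unfolding V_def W_def U_def Z_def by (rule bordered_matrix) (use A' B in auto)
  define Lf where "Lf = four_block_mat (1\<^sub>m I) (0\<^sub>m I k) (0\<^sub>m k I) (cmat P)"
  define Rt where "Rt = four_block_mat (cmat Q) (0\<^sub>m k I) (0\<^sub>m I k) (1\<^sub>m I)"
  have LH: "Lf * Hmat (k + I) I B = four_block_mat (cmat V) (cmat W) (cmat P * Z) (cmat P * cmat U)"
    unfolding H Lf_def
      mult_four_block_mat[OF one_carrier_mat zero_carrier_mat zero_carrier_mat cP cV cW Zc cU]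
    by (simp only: left_mult_one_mat[OF cV] left_mult_one_mat[OF cW] left_mult_zero_mat[OF Zc]
        left_mult_zero_mat[OF cU] left_mult_zero_mat[OF cV] left_mult_zero_mat[OF cW]
        right_add_zero_mat[OF cV] right_add_zero_mat[OF cW]
        left_add_zero_mat[OF mult_carrier_mat[OF cP Zc]] left_add_zero_mat[OF mult_carrier_mat[OF cP cU]])
  have LHR: "Lf * Hmat (k + I) I B * Rt =
      four_block_mat (cmat V * cmat Q) (cmat W) (cmat P * Z * cmat Q) (cmat P * cmat U)"
    unfolding LH Rt_def
      mult_four_block_mat[OF cV cW mult_carrier_mat[OF cP Zc] mult_carrier_mat[OF cP cU]
        cQ zero_carrier_mat zero_carrier_mat one_carrier_mat]
    by (simp only: right_mult_zero_mat[OF cW] right_mult_zero_mat[OF cV]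
        right_mult_zero_mat[OF mult_carrier_mat[OF cP cU]] right_mult_zero_mat[OF mult_carrier_mat[OF cP Zc]]
        right_mult_one_mat[OF cW] right_mult_one_mat[OF mult_carrier_mat[OF cP cU]]
        right_add_zero_mat[OF mult_carrier_mat[OF cV cQ]] left_add_zero_mat[OF cW]
        right_add_zero_mat[OF mult_carrier_mat[OF mult_carrier_mat[OF cP Zc] cQ]]
        left_add_zero_mat[OF mult_carrier_mat[OF cP cU]])
  have PZQ: "cmat P * Z * cmat Q = [:0, 1:] \<cdot>\<^sub>m 1\<^sub>m k + cmat A"
  proof -
    have "cmat P * Z = cmat P * ([:0, 1:] \<cdot>\<^sub>m 1\<^sub>m k) + cmat P * cmat A'"
      unfolding Z_def by (rule mult_add_distrib_mat[OF cP z1 cA])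
    also have "cmat P * ([:0, 1:] \<cdot>\<^sub>m 1\<^sub>m k) = [:0, 1:] \<cdot>\<^sub>m cmat P"
      unfolding mult_smult_distrib[OF cP one_carrier_mat] using cP by simp
    also have "([:0, 1:] \<cdot>\<^sub>m cmat P + cmat P * cmat A') * cmat Q =
        [:0, 1:] \<cdot>\<^sub>m cmat P * cmat Q + cmat P * cmat A' * cmat Q"
      by (rule add_mult_distrib_mat[OF smult_carrier_mat[OF cP] mult_carrier_mat[OF cP cA] cQ])
    also have "[:0, 1:] \<cdot>\<^sub>m cmat P * cmat Q = [:0, 1:] \<cdot>\<^sub>m 1\<^sub>m k"
      unfolding mult_smult_assoc_mat[OF cP cQ] cPQ ..
    also have "cmat P * cmat A' * cmat Q = cmat A"
      unfolding PQ(3) cpoly.mat_hom_mult[OF mult_carrier_mat[OF PQ(6) A'(1)] PQ(7)]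
        cpoly.mat_hom_mult[OF PQ(6) A'(1)] ..
    finally show ?thesis .
  qed
  \<comment> \<open>The transformed matrix written as an entry function, so that \<open>hdiv\<close>
    for \<open>A\<close> can be applied to it.\<close>
  define B' where "B' = (\<lambda>u v. if u < I then (if v < I + k then (V * Q) $$ (u, v - I) else W $$ (u, v - I - k))
    else (if v < I + k then A $$ (u - I, v - I) else (P * U) $$ (u - I, v - I - k)))"
  have "Hmat (k + I) I B' = Lf * Hmat (k + I) I B * Rt"
  proof -
    have "Hmat (k + I) I B' = four_block_mat
      (cmat (Matrix.mat I k (\<lambda>(u, v). B' u (I + v)))) (cmat (Matrix.mat I I (\<lambda>(u, v). B' u (I + k + v))))
      ([:0, 1:] \<cdot>\<^sub>m 1\<^sub>m k + cmat A) (cmat (Matrix.mat k I (\<lambda>(u, v). B' (I + u) (I + k + v))))"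
      by (rule bordered_matrix) (use A in \<open>auto simp: B'_def\<close>)
    also have "Matrix.mat I k (\<lambda>(u, v). B' u (I + v)) = V * Q"
      by (rule eq_matI) (auto simp: B'_def carrier_matD[OF carr(1)] carrier_matD[OF PQ(7)] simp del: index_mult_mat(1))
    also have "Matrix.mat I I (\<lambda>(u, v). B' u (I + k + v)) = W"
      by (rule eq_matI) (auto simp: B'_def carrier_matD[OF carr(2)])
    also have "Matrix.mat k I (\<lambda>(u, v). B' (I + u) (I + k + v)) = P * U"
      by (rule eq_matI) (auto simp: B'_def carrier_matD[OF carr(3)] carrier_matD[OF PQ(6)] simp del: index_mult_mat(1))
    finally show ?thesis
      unfolding LHR PZQ
      by (simp only: cpoly.mat_hom_mult[OF carr(1) PQ(7)] cpoly.mat_hom_mult[OF PQ(6) carr(3)])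
  qed
  moreover have carrs: "Lf \<in> carrier_mat (k + I) (k + I)" "Rt \<in> carrier_mat (k + I) (k + I)"
      "Hmat (k + I) I B \<in> carrier_mat (k + I) (k + I)"
    using four_block_carrier_mat[of "1\<^sub>m I" I I "cmat P" k k]
      four_block_carrier_mat[of "cmat Q" k k "1\<^sub>m I" I I] cP cQ
    by (simp_all add: Lf_def Rt_def Hmat_def add.commute)
  ultimately have "Hdet (k + I) I B' = Determinant.det Lf * Hdet (k + I) I B * Determinant.det Rt"
    unfolding Hdet_def using det_mult[OF mult_carrier_mat[OF carrs(1,3)] carrs(2)] det_mult[OF carrs(1,3)]
    by simp
  moreover have "Determinant.det Lf = Determinant.det (cmat P)"
    unfolding Lf_def using det_four_block_mat_upper_right_zero[OF one_carrier_mat refl zero_carrier_mat cP] by simp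
  moreover have "Determinant.det Rt = Determinant.det (cmat Q)"
    unfolding Rt_def using det_four_block_mat_upper_right_zero[OF cQ refl zero_carrier_mat one_carrier_mat] by simp
  moreover have "Determinant.det (cmat P) * Determinant.det (cmat Q) = 1"
    using det_mult[OF cP cQ] cPQ by simp
  ultimately have "Hdet (k + I) I B' = Hdet (k + I) I B"
    by (metis mult.assoc mult.commute mult_1)
  moreover have "coeff (Hdet (k + I) I B') i = 0"
    using hd i unfolding hdiv_def by (auto simp: B'_def)
  ultimately show "coeff (Hdet (k + I) I B) i = 0" by simp
qed

lemma shift_image: "(\<lambda>a. I + a) ` {a. a < k \<and> P a} = {v. I \<le> v \<and> v < I + k \<and> P (v - I :: nat)}"
proof (intro equalityI subsetI)
  fix v assume "v \<in> {v. I \<le> v \<and> v < I + k \<and> P (v - I)}"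
  then have "v = I + (v - I)" "v - I < k" "P (v - I)" by auto
  then show "v \<in> (\<lambda>a. I + a) ` {a. a < k \<and> P a}" by blast
qed auto

text \<open>Levels for a bordered matrix: the \<open>I\<close> border rows form a new lowest level and the \<open>I\<close> border
  columns a new highest one.\<close>

definition ext_lev :: "nat \<Rightarrow> nat \<Rightarrow> (nat \<Rightarrow> nat) \<Rightarrow> nat \<Rightarrow> nat" where
  "ext_lev I k L v = (if v < I then 0 else if v < I + k then Suc (L (v - I)) else Suc (Suc (\<Sum>a<k. L a)))"

lemma level_le_sum: "a < (k :: nat) \<Longrightarrow> L a \<le> (\<Sum>a<k. L a :: nat)"
  using member_le_sum[of a "{..<k}" L] by simp

text \<open>The border levels have at most \<open>I\<close> vertices and contribute nothing. The
  range of \<open>m\<close> admits all border columns (\<open>m = k + 2 * I\<close>) as well as none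
  of them (\<open>m = k + I\<close>); the latter occurs after the factor with the border columns has
  been split off.\<close>

lemma excess_ext_lev:
  assumes m: "k + I \<le> m" "m \<le> k + 2 * I"
  shows "excess (ext_lev I k L) m I = excess L k I"
proof -
  let ?E = "ext_lev I k L"
  define S where "S = (\<Sum>a<k. L a)"
  have S: "L a \<le> S" if "a < k" for a using level_le_sum[OF that] by (simp add: S_def)
  have c: "level_card ?E (m) l \<le> I" if "l = 0 \<or> l = Suc (Suc S)" for l
  proof -
    have "{v. v < m \<and> ?E v = l} \<subseteq> (if l = 0 then {..<I} else {I + k..<I + k + I})"
    proof
      fix v assume "v \<in> {v. v < m \<and> ?E v = l}"
      then show "v \<in> (if l = 0 then {..<I} else {I + k..<I + k + I})"
        using that S[of "v - I"] m
          by (auto simp: ext_lev_def S_def[symmetric] less_diff_conv2 not_less split: if_splits)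
    qed
    then have "level_card ?E (m) l \<le> card (if l = 0 then {..<I} else {I + k..<I + k + I})"
      unfolding level_card_def by (rule card_mono[rotated]) auto
    then show ?thesis by (auto split: if_splits)
  qed
  have mid: "level_card ?E (m) (Suc l) = level_card L k l" if "l \<in> L ` {..<k}" for l
  proof -
    have "l \<le> S" using that S by auto
    then have "{v. v < m \<and> ?E v = Suc l} = (\<lambda>a. I + a) ` {a. a < k \<and> L a = l}"
      unfolding shift_image using m by (auto simp: ext_lev_def S_def[symmetric] split: if_splits)
    then show ?thesis by (simp add: level_card_def card_image)
  qed
  have "excess ?E (m) I = (\<Sum>l\<in>Suc ` L ` {..<k}. level_card ?E (m) l - I)"
    unfolding excess_def
  proof (rule sum.mono_neutral_right)
    show "Suc ` L ` {..<k} \<subseteq> ?E ` {..<m}"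
    proof (rule image_subsetI)
      fix l assume "l \<in> L ` {..<k}"
      then obtain a where a: "l = L a" "a < k" by auto
      then show "Suc l \<in> ?E ` {..<m}"
        using m by (intro image_eqI[of _ _ "I + a"]) (auto simp: ext_lev_def)
    qed
    show "\<forall>l\<in>?E ` {..<m} - Suc ` L ` {..<k}. level_card ?E (m) l - I = 0"
    proof
      fix l assume l: "l \<in> ?E ` {..<m} - Suc ` L ` {..<k}"
      then obtain v where v: "v < m" "l = ?E v" by auto
      have "l = 0 \<or> l = Suc (Suc S)"
      proof (cases "I \<le> v \<and> v < I + k")
        case True
        then have "l = Suc (L (v - I))" "v - I < k" using v by (auto simp: ext_lev_def)
        then show ?thesis using l by auto
      qed (use v in \<open>auto simp: ext_lev_def S_def\<close>)
      then show "level_card ?E (m) l - I = 0" using c by simp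
    qed
  qed simp
  also have "\<dots> = excess L k I"
    unfolding excess_def by (subst sum.reindex) (auto simp: mid)
  finally show ?thesis .
qed

lemma level_strict_ext:
  assumes "\<And>a b. a < k \<Longrightarrow> b < k \<Longrightarrow> B (I + a) (I + b) \<noteq> 0 \<Longrightarrow> L a < L b"
  shows "level_strict (k + I) I (ext_lev I k L) B"
  unfolding level_strict_def
proof (intro allI impI)
  fix u v assume uv: "u < k + I" "I \<le> v" "v < k + I + I" "u \<noteq> v" "B u v \<noteq> 0"
  show "ext_lev I k L u < ext_lev I k L v"
  proof (cases "u < I \<or> I + k \<le> v")
    case True
    then show ?thesis
      using uv level_le_sum[of "u - I" k L] by (auto simp: ext_lev_def less_diff_conv2 not_less less_Suc_eq_le)
  next
    case False
    then have "L (u - I) < L (v - I)"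
      using assms[of "u - I" "v - I"] uv by auto
    then show ?thesis using False uv by (auto simp: ext_lev_def)
  qed
qed

lemma hdiv_levels:
  assumes "\<And>a b. a < k \<Longrightarrow> b < k \<Longrightarrow> A $$ (a, b) \<noteq> 0 \<Longrightarrow> L a < L b"
  shows "hdiv k A I (excess L k I)"
  unfolding hdiv_def
proof (intro allI impI)
  fix B i assume B: "\<forall>a<k. \<forall>b<k. B (I + a) (I + b) = A $$ (a, b)" and i: "i < excess L k I"
  have "level_strict (k + I) I (ext_lev I k L) B"
    by (rule level_strict_ext) (use B assms in auto)
  then show "coeff (Hdet (k + I) I B) i = 0"
    by (rule coeff_Hdet_low) (use i in \<open>simp add: excess_ext_lev\<close>)
qed

text \<open>The border gives each label below \<open>I\<close> its own first and last vertex: border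
  row \<open>q\<close> and border column \<open>q\<close> both get label \<open>q\<close>. The
  extended labelling is then good whatever \<open>lab\<close> is, and the vertices left out are
  those of \<open>A\<close> with label at least \<open>I\<close>.\<close>

lemma not_hdiv_labels:
  assumes A: "\<And>a b. a < k \<Longrightarrow> b < k \<Longrightarrow> A $$ (a, b) = (if nxt lab a b then 1 else 0)"
  shows "\<not> hdiv k A I (Suc (card {a. a < k \<and> I \<le> lab a}))"
proof
  assume hd: "hdiv k A I (Suc (card {a. a < k \<and> I \<le> lab a}))"
  define el where "el = (\<lambda>v. if v < I then v else if v < I + k then lab (v - I) else v - (I + k))"
  define B :: "nat \<Rightarrow> nat \<Rightarrow> complex" where "B = (\<lambda>u v. if nxt el u v then 1 else 0)"
  have good: "good_labels (k + I) I el"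
    unfolding good_labels_def
  proof
    show "bij_betw el {..<I} {..<I}"
      by (rule bij_betw_cong[THEN iffD1, of _ "\<lambda>v. v"]) (auto simp: el_def bij_betw_def)
    show "bij_betw el {k + I..<k + I + I} {..<I}"
      by (rule bij_betw_byWitness[where f' = "\<lambda>q. q + (k + I)"]) (auto simp: el_def)
  qed
  have "nxt el (I + a) (I + b) \<longleftrightarrow> nxt lab a b" if ab: "a < k" "b < k" for a b
  proof -
    have 1: "el (I + x) = lab x" if "x < k" for x using that by (simp add: el_def)
    have "(\<forall>x. I + a < x \<and> x < I + b \<longrightarrow> el x \<noteq> el (I + a)) \<longleftrightarrow> (\<forall>x. a < x \<and> x < b \<longrightarrow> lab x \<noteq> lab a)"
    proof (intro iffI allI impI)
      fix x assume *: "\<forall>x. I + a < x \<and> x < I + b \<longrightarrow> el x \<noteq> el (I + a)" "a < x \<and> x < b"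
      from *(1)[rule_format, of "I + x"] show "lab x \<noteq> lab a" using *(2) 1 ab by simp
    next
      fix x assume *: "\<forall>x. a < x \<and> x < b \<longrightarrow> lab x \<noteq> lab a" "I + a < x \<and> x < I + b"
      have "el x = lab (x - I)" using *(2) ab by (auto simp: el_def)
      moreover have "a < x - I" "x - I < b" using *(2) by auto
      ultimately show "el x \<noteq> el (I + a)" using *(1) 1 ab by auto
    qed
    then show ?thesis using 1 ab by (simp add: nxt_def)
  qed
  then have "\<forall>a<k. \<forall>b<k. B (I + a) (I + b) = A $$ (a, b)"
    using A by (simp add: B_def)
  moreover have "{v. v < k + I + I \<and> I \<le> el v} = (\<lambda>a. I + a) ` {a. a < k \<and> I \<le> lab a}"
    unfolding shift_image by (auto simp: el_def split: if_splits)
  then have "card {v. v < k + I + I \<and> I \<le> el v} = card {a. a < k \<and> I \<le> lab a}"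
    by (simp add: card_image)
  moreover have "coeff (Hdet (k + I) I B) (card {v. v < k + I + I \<and> I \<le> el v}) \<noteq> 0"
    by (rule coeff_Hdet_labels[OF good]) (simp add: B_def)
  ultimately show False using hd unfolding hdiv_def by auto
qed

lemma card_labels_ge:
  assumes "finite S" "inj_on lab S" "\<And>q q'. q \<in> lab ` S \<Longrightarrow> q' \<le> q \<Longrightarrow> q' \<in> lab ` S"
  shows "card {v \<in> S. I \<le> lab v} = card S - (I :: nat)"
proof -
  have "\<exists>n. lab ` S = {..<n :: nat}"
  proof (cases "S = {}")
    case False
    then have "lab ` S = {..<Suc (Max (lab ` S))}"
      using assms(1) by (auto simp: less_Suc_eq_le intro: assms(3)[OF Max_in])
    then show ?thesis by blast
  qed auto
  then obtain n where n: "lab ` S = {..<n}" by auto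
  then have "n = card S" using card_image[OF assms(2)] by simp
  have "card {v \<in> S. I \<le> lab v} = card (lab ` {v \<in> S. I \<le> lab v})"
    by (rule card_image[symmetric], rule inj_on_subset[OF assms(2)]) auto
  also have "lab ` {v \<in> S. I \<le> lab v} = {I..<n}"
  proof -
    have "lab ` {v \<in> S. I \<le> lab v} = lab ` S \<inter> {I..}" by auto
    then show ?thesis using n by auto
  qed
  finally show ?thesis using \<open>n = card S\<close> by simp
qed

text \<open>On each level the labels are the distinct numbers from 0 up to one less than its size,
  so those from \<open>I\<close> on are counted by the truncated difference in
  \<open>excess\<close>.\<close>

lemma excess_labels:
  assumes "\<And>l. inj_on lab {v. v < m \<and> L v = l}"
    and "\<And>v q. v < m \<Longrightarrow> q \<le> lab v \<Longrightarrow> \<exists>w<m. L w = L v \<and> lab w = q"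
  shows "excess L m I = card {v. v < m \<and> I \<le> lab v}"
proof -
  have "card {v \<in> {v. v < m \<and> L v = l}. I \<le> lab v} = level_card L m l - I" for l
    unfolding level_card_def
  proof (rule card_labels_ge)
    fix q q' assume "q \<in> lab ` {v. v < m \<and> L v = l}" "q' \<le> q"
    then obtain v where "v < m" "L v = l" "q' \<le> lab v" by auto
    then show "q' \<in> lab ` {v. v < m \<and> L v = l}" using assms(2)[of v q'] by auto
  qed (use assms(1) in auto)
  moreover have "{v \<in> {v. v < m \<and> I \<le> lab v}. L v = l} = {v \<in> {v. v < m \<and> L v = l}. I \<le> lab v}" for l
    by auto
  ultimately show ?thesis
    unfolding excess_def by (subst card_levels[of _ m L]) auto
qed

text \<open>The number of the Jordan block that contains the basis index \<open>v\<close>;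
  \<open>blkpos\<close> is the position inside this block. For a Jordan matrix the blocks serve as
  path labels and the positions as levels.\<close>

fun blk :: "nat list \<Rightarrow> nat \<Rightarrow> nat" where
  "blk [] v = 0"
| "blk (n # ns) v = (if v < n then 0 else Suc (blk ns (v - n)))"

fun blkpos :: "nat list \<Rightarrow> nat \<Rightarrow> nat" where
  "blkpos [] v = v"
| "blkpos (n # ns) v = (if v < n then v else blkpos ns (v - n))"

lemma blk_lt: "v < sum_list lam \<Longrightarrow> blk lam v < length lam \<and> blkpos lam v < lam ! blk lam v"
  by (induction lam arbitrary: v) auto

lemma blk_surj:
  "r < length lam \<Longrightarrow> l < lam ! r \<Longrightarrow> \<exists>v<sum_list lam. blk lam v = r \<and> blkpos lam v = l"
proof (induction lam arbitrary: r)
  case (Cons n ns)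
  show ?case
  proof (cases r)
    case 0
    then show ?thesis using Cons.prems by (intro exI[of _ l]) auto
  next
    case (Suc r')
    then obtain v where "v < sum_list ns" "blk ns v = r'" "blkpos ns v = l"
      using Cons.IH[of r'] Cons.prems by auto
    then show ?thesis using Suc by (intro exI[of _ "n + v"]) auto
  qed
qed simp

lemma blk_inj: "blk lam v = blk lam w \<Longrightarrow> blkpos lam v = blkpos lam w \<Longrightarrow> v < sum_list lam \<Longrightarrow>
    w < sum_list lam \<Longrightarrow> v = w"
proof (induction lam arbitrary: v w)
  case (Cons n ns)
  show ?case
  proof (cases "v < n \<or> w < n")
    case True
    then show ?thesis using Cons.prems by (auto split: if_splits)
  next
    case False
    then have "v - n = w - n" using Cons.prems Cons.IH[of "v - n" "w - n"] by auto
    then show ?thesis using False by auto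
  qed
qed simp

lemma blk_mono: "v \<le> w \<Longrightarrow> blk lam v \<le> blk lam w"
  by (induction lam arbitrary: v w) auto

lemma blkpos_Suc: "blk lam (Suc v) = blk lam v \<Longrightarrow> blkpos lam (Suc v) = Suc (blkpos lam v)"
  by (induction lam arbitrary: v) (auto simp: Suc_diff_le split: if_splits)

lemma nxt_blk: "nxt (blk lam) a b \<longleftrightarrow> b = Suc a \<and> blk lam b = blk lam a"
proof
  assume n: "nxt (blk lam) a b"
  then have "blk lam (Suc a) = blk lam a"
    using blk_mono[of a "Suc a" lam] blk_mono[of "Suc a" b lam] unfolding nxt_def by auto
  then show "b = Suc a \<and> blk lam b = blk lam a"
    using n unfolding nxt_def by (metis Suc_lessI lessI)
qed (auto simp: nxt_def)

lemma nilp_jordan_matrix_index: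
  assumes "a < sum_list lam" "b < sum_list lam"
  shows "(jordan_matrix (map (\<lambda>n. (n, 0)) lam) :: complex mat) $$ (a, b) = (if nxt (blk lam) a b then 1 else 0)"
  using assms
proof (induction lam arbitrary: a b)
  case (Cons n ns)
  have fst: "map fst (map (\<lambda>n. (n, 0 :: complex)) ns) = ns" by (simp add: o_def)
  have dim: "(jordan_matrix (map (\<lambda>n. (n, 0 :: complex)) ns)) \<in> carrier_mat (sum_list ns) (sum_list ns)"
    using jordan_matrix_carrier[of "map (\<lambda>n. (n, 0 :: complex)) ns"] by (simp add: o_def)
  have J: "jordan_matrix (map (\<lambda>n. (n, 0 :: complex)) (n # ns)) = four_block_mat (jordan_block n 0)
      (0\<^sub>m n (sum_list ns)) (0\<^sub>m (sum_list ns) n) (jordan_matrix (map (\<lambda>n. (n, 0)) ns))"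
    unfolding list.map jordan_matrix_Cons fst ..
  show ?case
  proof (cases "a < n \<or> b < n")
    case True
    then show ?thesis
      using Cons.prems carrier_matD[OF dim] unfolding J nxt_blk by (auto simp del: jordan_matrix_dim)
  next
    case False
    then have "a - n < sum_list ns" "b - n < sum_list ns" using Cons.prems by auto
    moreover have "b - n = Suc (a - n) \<longleftrightarrow> b = Suc a" using False by auto
    ultimately show ?thesis
      using False Cons.IH[of "a - n" "b - n"] Cons.prems carrier_matD[OF dim]
      unfolding J nxt_blk by (simp del: jordan_matrix_dim)
  qed
qed simp

lemma card_blk_ge: "card {v. v < sum_list lam \<and> I \<le> blk lam v} = sum_list (drop I lam)"
proof (induction lam arbitrary: I)
  case (Cons n ns)
  show ?case
  proof (cases I)
    case 0
    then show ?thesis by simp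
  next
    case (Suc I')
    have "{v. v < sum_list (n # ns) \<and> I \<le> blk (n # ns) v} = (\<lambda>v. n + v) ` {v. v < sum_list ns \<and> I' \<le> blk ns v}"
      unfolding shift_image by (auto simp: Suc split: if_splits)
    then show ?thesis using Cons.IH[of I'] Suc by (simp add: card_image)
  qed
qed simp

text \<open>In the Jordan matrix every edge raises the position in its block, and as the blocks are
  sorted by decreasing size, the block numbers on each level form an initial segment. So the lower
  bound from levels and the upper bound from labels coincide, at the total size of all blocks except
  the \<open>I\<close> largest. Similarity carries this over to \<open>A\<close>.\<close>

lemma hdiv_nilp:
  assumes A: "A \<in> nilp_orbit k lam" "\<And>a. a < k \<Longrightarrow> A $$ (a, a) = 0"
    and lam: "sorted_wrt (\<ge>) lam"
  shows "hdiv k A I e \<longleftrightarrow> e \<le> sum_list (drop I lam)"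
proof -
  define J :: "complex mat" where "J = jordan_matrix (map (\<lambda>n. (n, 0)) lam)"
  have Ac: "A \<in> carrier_mat k k" and sim: "similar_mat A J"
    using A(1) by (auto simp: nilp_orbit_def jordan_nf_def J_def)
  have Js: "J \<in> carrier_mat (sum_list lam) (sum_list lam)"
    using jordan_matrix_carrier[of "map (\<lambda>n. (n, 0 :: complex)) lam"] by (simp add: J_def o_def)
  obtain P Q where "similar_mat_wit A J P Q" using sim by (auto simp: similar_mat_def)
  from similar_mat_witD2(5)[OF Ac this] have k: "k = sum_list lam" using Js by auto
  have Jidx: "J $$ (a, b) = (if nxt (blk lam) a b then 1 else 0)" if "a < k" "b < k" for a b
    using that nilp_jordan_matrix_index unfolding J_def k by blast
  have Jc: "J \<in> carrier_mat k k" "\<And>a. a < k \<Longrightarrow> J $$ (a, a) = 0"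
    using Js k Jidx by (auto simp: nxt_def)
  have "excess (blkpos lam) k I = card {v. v < k \<and> I \<le> blk lam v}"
  proof (rule excess_labels)
    show "inj_on (blk lam) {v. v < k \<and> blkpos lam v = l}" for l
      by (rule inj_onI) (auto intro: blk_inj simp: k)
    fix v q assume v: "v < k" "q \<le> blk lam v"
    have "blk lam v < length lam" "blkpos lam v < lam ! blk lam v" using blk_lt v k by auto
    moreover have "lam ! blk lam v \<le> lam ! q"
      using lam v(2) calculation(1) by (cases "q = blk lam v") (auto simp: sorted_wrt_iff_nth_less)
    ultimately show "\<exists>w<k. blkpos lam w = blkpos lam v \<and> blk lam w = q"
      using blk_surj[of q lam "blkpos lam v"] v(2) k by auto
  qed
  then have ex: "excess (blkpos lam) k I = sum_list (drop I lam)"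
    using card_blk_ge k by simp
  have "hdiv k J I (excess (blkpos lam) k I)"
  proof (rule hdiv_levels)
    fix a b assume "a < k" "b < k" "J $$ (a, b) \<noteq> 0"
    then have "b = Suc a" "blk lam (Suc a) = blk lam a"
      using Jidx[of a b] by (auto simp: nxt_blk split: if_splits)
    then show "blkpos lam a < blkpos lam b" using blkpos_Suc by simp
  qed
  moreover have "\<not> hdiv k J I (Suc (card {v. v < k \<and> I \<le> blk lam v}))"
    by (rule not_hdiv_labels) (rule Jidx)
  then have "\<not> hdiv k J I (Suc (sum_list (drop I lam)))"
    using card_blk_ge k by simp
  moreover have "hdiv k A I e \<longleftrightarrow> hdiv k J I e"
    using hdiv_similar[OF Ac A(2) Jc sim] hdiv_similar[OF Jc Ac A(2) similar_mat_sym[OF sim]] by blast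
  ultimately show ?thesis
    unfolding ex by (meson hdiv_mono not_less_eq_eq)
qed

section \<open>The path polynomial between two chains of equal length\<close>

lemma prod_var:
  "(\<Prod>u\<in>A. var (g u)) = Poly_Mapping.single (\<Sum>u\<in>A. Poly_Mapping.single (g u) 1) 1"
  by (induction A rule: infinite_finite_induct) (simp_all add: var_def mult_single)

text \<open>The total degree is read off by giving all variables the value 2, where the monomial
  becomes a power of 2 with that exponent.\<close>

lemma keys_prod_var:
  assumes "m \<in> Poly_Mapping.keys (const c * (\<Prod>u\<in>A. var (g u)))" "finite A"
  shows "(\<Sum>v\<in>Poly_Mapping.keys m. Poly_Mapping.lookup m v) = card A"
proof -
  let ?m = "\<Sum>u\<in>A. Poly_Mapping.single (g u) (1 :: nat)"
  have "m = ?m"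
    using assms(1) unfolding prod_var const_def mult_single by (auto split: if_splits)
  moreover have "mon_val (\<lambda>_. 2 :: int) (\<Sum>u\<in>B. Poly_Mapping.single (g u) (1 :: nat)) = 2 ^ card B" if "finite B" for B
    using that by (induction B) (simp_all add: mon_val_add)
  moreover have "mon_val (\<lambda>_. 2 :: int) m = 2 ^ (\<Sum>v\<in>Poly_Mapping.keys m. Poly_Mapping.lookup m v)"
    by (simp add: mon_val_def power_sum)
  ultimately have "(2 :: int) ^ (\<Sum>v\<in>Poly_Mapping.keys m. Poly_Mapping.lookup m v) = 2 ^ card A"
    using assms(2) by metis
  then show ?thesis by simp
qed

text \<open>Vertices are counted from 0 at the first element of the lower chain: this chain is
  \<open>0, ..., I - 1\<close>, the upper one \<open>n, ..., n + I - 1\<close>, and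
  \<open>off\<close> shifts to matrix indices. \<open>L_Suc\<close> prevents empty levels in
  between, and \<open>mid_chain\<close> is what irreducibility rests on.\<close>

locale path_poly =
  fixes n I off :: nat and L :: "nat \<Rightarrow> nat"
  assumes I_pos: "0 < I" and I_le: "I \<le> n"
    and L_mono: "u \<le> v \<Longrightarrow> L u \<le> L v" and L_Suc: "L (Suc v) \<le> Suc (L v)"
    and start_chain: "v < n + I \<Longrightarrow> L v = L 0 \<longleftrightarrow> v < I"
    and end_chain: "v < n + I \<Longrightarrow> L v = L n \<longleftrightarrow> n \<le> v"
    and mid_chain: "L 0 < l \<Longrightarrow> l < L n \<Longrightarrow> level_card L (n + I) l \<noteq> I"
begin

abbreviation "m \<equiv> n + I"

definition "d = excess L m I"

definition pvar :: "nat \<Rightarrow> nat \<Rightarrow> nat \<times> nat" where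
  "pvar u w = (Suc (off + u), Suc (off + w))"

lemma pvar_inject [simp]: "pvar u w = pvar u' w' \<longleftrightarrow> u = u' \<and> w = w'"
  by (auto simp: pvar_def)

definition tight :: "(nat \<Rightarrow> nat) \<Rightarrow> bool" where
  "tight p \<longleftrightarrow> p permutes {0..<n} \<and> climbs n I L p \<and> card (pfix n I p) = d"

text \<open>The coefficient of \<open>z\<close> to the power \<open>d\<close> with independent
  variables as entries, but with the permutations that do not climb dropped at once; at matrices
  that respect the levels these contribute nothing.\<close>

definition fpoly :: mpoly where
  "fpoly = (\<Sum>p | tight p. const (signof p) * (\<Prod>u\<in>pedges n I p. var (pvar u (I + p u))))"

definition edges :: "(nat \<Rightarrow> nat) \<Rightarrow> (nat \<times> nat) set" where
  "edges p = (\<lambda>u. (u, I + p u)) ` pedges n I p"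

lemma finite_tight [simp]: "finite {p. tight p}"
  by (rule finite_subset[OF _ finite_permutations[of "{0..<n}"]]) (auto simp: tight_def)

lemma ev_fpoly: "ev \<alpha> fpoly = (\<Sum>p | tight p. signof p * (\<Prod>u\<in>pedges n I p. \<alpha> (pvar u (I + p u))))"
  unfolding fpoly_def by (simp add: ev.subst_sum ev.subst_mult ev_hom.hom_prod)

lemma ev_fpoly_Hdet:
  assumes "level_strict n I L B" "\<And>u w. u < n \<Longrightarrow> I \<le> w \<Longrightarrow> w < m \<Longrightarrow> \<alpha> (pvar u w) = B u w"
  shows "ev \<alpha> fpoly = coeff (Hdet n I B) d"
proof -
  have "coeff (Hdet n I B) d = (\<Sum>p | tight p. signof p * (\<Prod>u\<in>pedges n I p. B u (I + p u)))"
    unfolding coeff_Hdet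
  proof (rule sum.mono_neutral_right)
    show "finite {p. p permutes {0..<n} \<and> card (pfix n I p) = d}"
      by (rule finite_subset[OF _ finite_permutations[of "{0..<n}"]]) auto
    show "\<forall>p\<in>{p. p permutes {0..<n} \<and> card (pfix n I p) = d} - {p. tight p}.
        signof p * (\<Prod>u\<in>pedges n I p. B u (I + p u)) = 0"
    proof
      fix p assume "p \<in> {p. p permutes {0..<n} \<and> card (pfix n I p) = d} - {p. tight p}"
      then have p: "p permutes {0..<n}" "\<not> climbs n I L p" by (auto simp: tight_def)
      then show "signof p * (\<Prod>u\<in>pedges n I p. B u (I + p u)) = 0"
        using term_nonzero_up[OF assms(1) p(1)] by auto
    qed
  qed (auto simp: tight_def)
  also have "\<dots> = ev \<alpha> fpoly"
    unfolding ev_fpoly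
  proof (rule sum.cong[OF refl])
    fix p assume "p \<in> {p. tight p}"
    then have p: "p permutes {0..<n}" by (auto simp: tight_def)
    have "B u (I + p u) = \<alpha> (pvar u (I + p u))" if "u \<in> pedges n I p" for u
      using assms(2)[of u "I + p u"] permutes_in_image[OF p, of u] that by (auto simp: pedges_def)
    then show "signof p * (\<Prod>u\<in>pedges n I p. B u (I + p u)) = signof p * (\<Prod>u\<in>pedges n I p. \<alpha> (pvar u (I + p u)))"
      by simp
  qed
  finally show ?thesis by simp
qed

lemma card_pedges: "tight p \<Longrightarrow> card (pedges n I p) = n - d"
proof -
  assume p: "tight p"
  have "card (pfix n I p) + card (pedges n I p) = card {0..<n}"
    using pfix_pedges[of n I p] by (metis card_Un_disjoint finite_pfix finite_pedges)
  then show ?thesis using p by (simp add: tight_def)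
qed

lemma finite_edges [simp]: "finite (edges p)"
  by (simp add: edges_def)

lemma card_edges: "tight p \<Longrightarrow> card (edges p) = n - d"
  unfolding edges_def using card_pedges by (subst card_image) (auto intro: inj_onI)

lemma homogeneous_fpoly: "homogeneous (n - d) fpoly"
  unfolding homogeneous_def
proof
  fix mm assume "mm \<in> Poly_Mapping.keys fpoly"
  then have "mm \<in> (\<Union>p\<in>{p. tight p}. Poly_Mapping.keys (const (signof p) * (\<Prod>u\<in>pedges n I p. var (pvar u (I + p u)))))"
    unfolding fpoly_def
    by (rule subsetD[OF keys_sum[of "\<lambda>p. const (signof p) * (\<Prod>u\<in>pedges n I p. var (pvar u (I + p u)))"]])
  then obtain p where "tight p" "mm \<in> Poly_Mapping.keys (const (signof p) * (\<Prod>u\<in>pedges n I p. var (pvar u (I + p u))))"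
    by blast
  then show "(\<Sum>v\<in>Poly_Mapping.keys mm. Poly_Mapping.lookup mm v) = n - d"
    using keys_prod_var card_pedges by (metis finite_pedges)
qed

lemma multilinear_fpoly: "multilinear fpoly"
  unfolding multilinear_def
proof
  fix x
  have "degree (in_var x (const (signof p) * (\<Prod>u\<in>pedges n I p. var (pvar u (I + p u))))) \<le> 1" for p
  proof -
    have "degree (in_var x (const (signof p) * (\<Prod>u\<in>pedges n I p. var (pvar u (I + p u))))) \<le>
        degree (\<Prod>u\<in>pedges n I p. in_var x (var (pvar u (I + p u))))"
      unfolding in_var_hom.hom_mult in_var_hom.hom_prod in_var_const
      by (rule order.trans[OF degree_mult_le]) simp
    also have "\<dots> \<le> (\<Sum>u\<in>pedges n I p. degree (in_var x (var (pvar u (I + p u)))))"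
      using degree_prod_sum_le[of "pedges n I p" "\<lambda>u. in_var x (var (pvar u (I + p u)))"] by (simp add: o_def)
    also have "\<dots> = (\<Sum>u\<in>pedges n I p. if pvar u (I + p u) = x then 1 else 0)"
      by (rule sum.cong) (auto simp: in_var_var)
    also have "\<dots> = card {u \<in> pedges n I p. pvar u (I + p u) = x}"
      by (simp add: sum.If_cases Int_def)
    also have "\<dots> \<le> 1"
      by (intro card_le_Suc0_iff_eq[THEN iffD2, simplified One_nat_def[symmetric]]) (auto simp: pvar_def)
    finally show ?thesis .
  qed
  then show "degree (in_var x fpoly) \<le> 1"
    unfolding fpoly_def in_var_hom.hom_sum by (intro degree_sum_le) simp_all
qed

text \<open>Test points: at the indicator of an edge set only the path systems inside this set
  survive.\<close>

definition indic :: "(nat \<times> nat) set \<Rightarrow> nat \<times> nat \<Rightarrow> complex" where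
  "indic S v = (if v \<in> (\<lambda>(u, w). pvar u w) ` S then 1 else 0)"

lemma indic_pvar [simp]: "indic S (pvar u w) = (if (u, w) \<in> S then 1 else 0)"
  by (auto simp: indic_def)

lemma ev_indic: "ev (indic S) fpoly = (\<Sum>p | tight p \<and> edges p \<subseteq> S. signof p)"
proof -
  have "(\<Prod>u\<in>pedges n I p. indic S (pvar u (I + p u))) = (if edges p \<subseteq> S then 1 else 0)" for p
  proof (cases "edges p \<subseteq> S")
    case True
    then show ?thesis by (auto simp: edges_def intro!: prod.neutral)
  next
    case False
    then obtain u where "u \<in> pedges n I p" "(u, I + p u) \<notin> S" by (auto simp: edges_def)
    then show ?thesis using False by (auto intro!: prod_zero)
  qed
  then have "ev (indic S) fpoly = (\<Sum>p | tight p. if edges p \<subseteq> S then signof p else 0)"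
    unfolding ev_fpoly by (intro sum.cong) auto
  also have "\<dots> = (\<Sum>p\<in>{p. tight p} \<inter> {p. edges p \<subseteq> S}. signof p)"
    by (simp add: sum.inter_restrict)
  finally show ?thesis by (simp add: Int_def)
qed

text \<open>All tight systems have the same number \<open>n - d\<close> of edges, so an inclusion
  between edge sets is an equality, and a vertex that starts no edge is its own successor.\<close>

lemma edges_unique:
  assumes "tight p" "tight q" "edges q \<subseteq> edges p"
  shows "q = p"
proof
  fix u
  have eq: "edges q = edges p"
    using assms card_edges by (metis card_subset_eq finite_edges)
  have ed: "u \<in> pedges n I r \<longleftrightarrow> (u, I + r u) \<in> edges r" for r by (auto simp: edges_def)
  show "q u = p u"
  proof (cases "u < n")
    case True
    show ?thesis
    proof (cases "u \<in> pedges n I p")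
      case True
      then have "(u, I + p u) \<in> edges q" using eq ed by auto
      then show ?thesis by (auto simp: edges_def)
    next
      case False
      have "u \<notin> pedges n I q"
      proof
        assume "u \<in> pedges n I q"
        then have "(u, I + q u) \<in> edges p" using eq ed by auto
        then show False using False by (auto simp: edges_def)
      qed
      then show ?thesis using False True by (auto simp: pedges_def)
    qed
  qed (use assms in \<open>simp add: tight_def permutes_def\<close>)
qed

lemma ev_indic_edges: "tight p \<Longrightarrow> ev (indic (edges p)) fpoly \<noteq> 0"
proof -
  assume p: "tight p"
  then have "{q. tight q \<and> edges q \<subseteq> edges p} = {p}" using edges_unique by auto
  then show ?thesis by (simp add: ev_indic sign_def)
qed

definition all_edges :: "(nat \<times> nat) set" where
  "all_edges = (\<Union>p\<in>{p. tight p}. edges p)"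

text \<open>No variable cancels: at the indicator of a tight system the value is a sign, and it
  becomes 0 when one edge is removed, so the variable of this edge does occur.\<close>

lemma vars_fpoly: "vars fpoly = (\<lambda>(u, w). pvar u w) ` all_edges"
proof
  show "vars fpoly \<subseteq> (\<lambda>(u, w). pvar u w) ` all_edges"
  proof
    fix v assume "v \<in> vars fpoly"
    then obtain p where p: "tight p" "v \<in> vars (const (signof p) * (\<Prod>u\<in>pedges n I p. var (pvar u (I + p u))))"
      unfolding fpoly_def using vars_sum[of "\<lambda>p. const (signof p) * (\<Prod>u\<in>pedges n I p. var (pvar u (I + p u)))"] by blast
    then have "v \<in> vars (\<Prod>u\<in>pedges n I p. var (pvar u (I + p u)))"
      using vars_mult[of "const (signof p)"] unfolding vars_const by blast
    then have "v \<in> (\<Union>u\<in>pedges n I p. vars (var (pvar u (I + p u))))"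
      using vars_prod[of "\<lambda>u. var (pvar u (I + p u))" "pedges n I p"] by blast
    then obtain u where u: "u \<in> pedges n I p" "v = pvar u (I + p u)" by auto
    then have "(u, I + p u) \<in> all_edges" using p by (auto simp: all_edges_def edges_def)
    then show "v \<in> (\<lambda>(u, w). pvar u w) ` all_edges" using u by force
  qed
  show "(\<lambda>(u, w). pvar u w) ` all_edges \<subseteq> vars fpoly"
  proof
    fix v assume "v \<in> (\<lambda>(u, w). pvar u w) ` all_edges"
    then obtain u w p where uw: "v = pvar u w" "tight p" "(u, w) \<in> edges p"
      by (auto simp: all_edges_def)
    show "v \<in> vars fpoly"
    proof (rule ccontr)
      assume v: "v \<notin> vars fpoly"
      have "ev (indic (edges p)) fpoly = ev (indic (edges p - {(u, w)})) fpoly"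
        by (rule ev_cong) (use v uw in \<open>auto simp: indic_def\<close>)
      moreover have "{q. tight q \<and> edges q \<subseteq> edges p - {(u, w)}} = {}"
        using edges_unique[of p] uw by blast
      then have "ev (indic (edges p - {(u, w)})) fpoly = 0" by (simp only: ev_indic sum.empty)
      ultimately show False using ev_indic_edges uw by simp
    qed
  qed
qed

lemma tight_edge:
  assumes "tight p" "(u, w) \<in> edges p"
  shows "u < n" "I \<le> w" "w < m" "L u < L w" "w = I + p u" "u \<noteq> w"
  using assms permutes_in_image[of p "{0..<n}" u]
  by (auto simp: edges_def pedges_def tight_def climbs_def)

lemma all_edges_bound: "(u, w) \<in> all_edges \<Longrightarrow> u < n \<and> I \<le> w \<and> w < m \<and> L u < L w"
  unfolding all_edges_def using tight_edge by auto

subsection \<open>Tight path systems from labellings\<close>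

text \<open>As labels are distinct within a level, a later vertex with the same label lies on a
  strictly higher level, so the system climbs; the count of large labels makes it extremal.\<close>

lemma tight_labels:
  assumes inj: "\<And>l. inj_on lab {v. v < m \<and> L v = l}" and d: "card {v. v < m \<and> I \<le> lab v} = d"
    and good: "good_labels n I lab"
  obtains p where "tight p" "pfix n I p = {v. v < m \<and> I \<le> lab v}"
    "\<And>u w. u < n \<Longrightarrow> lab u < I \<Longrightarrow> nxt lab u w \<Longrightarrow> (u, w) \<in> edges p"
proof -
  obtain p where p: "p permutes {0..<n}" "pfix n I p = {v. v < m \<and> I \<le> lab v}"
    "\<And>u. u < n \<Longrightarrow> lab u < I \<Longrightarrow> nxt lab u (I + p u)"
    using label_perm[OF good] by blast
  have "climbs n I L p"
    unfolding climbs_def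
  proof (intro allI impI)
    fix u assume u: "u < n"
    show "u = I + p u \<or> L u < L (I + p u)"
    proof (cases "lab u < I")
      case True
      from p(3)[OF u this] have n: "u < I + p u" "lab (I + p u) = lab u" by (auto simp: nxt_def)
      have "I + p u < m" using permutes_in_image[OF p(1), of u] u by simp
      have "L u \<noteq> L (I + p u)"
      proof
        assume "L u = L (I + p u)"
        then have "u = I + p u"
          using inj_onD[OF inj[of "L u"], of u "I + p u"] n \<open>I + p u < m\<close> u by auto
        then show False using n by simp
      qed
      then show ?thesis using L_mono[of u "I + p u"] n by linarith
    next
      case False
      then have "u \<in> pfix n I p" using p(2) u by auto
      then show ?thesis by (simp add: pfix_def)
    qed
  qed
  then have t: "tight p" using p d by (simp add: tight_def)
  show ?thesis
  proof (rule that[OF t p(2)])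
    fix u w assume u: "u < n" "lab u < I" "nxt lab u w"
    then have "w = I + p u" using p(3) nxt_unique by blast
    moreover have "u \<noteq> w" using u by (auto simp: nxt_def)
    ultimately show "(u, w) \<in> edges p" using u by (auto simp: edges_def pedges_def)
  qed
qed

definition first :: "nat \<Rightarrow> nat" where "first l = (LEAST v. L v = l)"

definition pos :: "nat \<Rightarrow> nat" where "pos v = v - first (L v)"

lemma first_le: "first (L v) \<le> v"
  unfolding first_def by (rule Least_le) simp

lemma L_first [simp]: "L (first (L v)) = L v"
  unfolding first_def by (rule LeastI[of _ v]) simp

lemma level_exists: "L 0 \<le> l \<Longrightarrow> l \<le> L v \<Longrightarrow> \<exists>w\<le>v. L w = l"
proof (induction v)
  case (Suc v)
  show ?case
  proof (cases "l \<le> L v")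
    case True
    then show ?thesis using Suc by (meson le_SucI)
  next
    case False
    then have "l = L (Suc v)" using L_Suc[of v] Suc.prems by simp
    then show ?thesis by blast
  qed
qed auto

lemma L_bounds: "v < m \<Longrightarrow> L 0 \<le> L v \<and> L v \<le> L n"
proof -
  assume v: "v < m"
  have "L n = L (m - 1)"
  proof -
    have "n \<le> m - 1" "m - 1 < m" using I_pos by linarith+
    then show ?thesis using end_chain[of "m - 1"] by simp
  qed
  then show ?thesis using L_mono[of 0 v] L_mono[of v "m - 1"] v by simp
qed

lemma first_props:
  assumes "L 0 \<le> l" "l \<le> L n"
  shows "L (first l) = l" "first l < m" "\<And>v. L v = l \<Longrightarrow> first l \<le> v"
proof -
  obtain w where w: "w \<le> n" "L w = l" using level_exists assms by blast
  show "L (first l) = l" using L_first[of w] w by simp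
  show "first l < m" using first_le[of w] w I_pos by simp
  show "first l \<le> v" if "L v = l" for v using first_le[of v] that by simp
qed

lemma same_level_between: "first (L v) \<le> x \<Longrightarrow> x \<le> v \<Longrightarrow> L x = L v"
  using L_mono[of "first (L v)" x] L_mono[of x v] by simp

lemma pos_inj: "L u = L v \<Longrightarrow> pos u = pos v \<Longrightarrow> u = v"
  unfolding pos_def using first_le[of u] first_le[of v] by simp

lemma pos_down: "q \<le> pos v \<Longrightarrow> \<exists>w\<le>v. L w = L v \<and> pos w = q"
proof -
  assume q: "q \<le> pos v"
  let ?w = "first (L v) + q"
  have "?w \<le> v" using q first_le[of v] by (simp add: pos_def)
  moreover from this have "L ?w = L v" by (intro same_level_between) auto
  ultimately show ?thesis by (intro exI[of _ ?w]) (simp add: pos_def)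
qed

lemma pos_first [simp]: "pos (first (L v)) = 0"
  by (simp add: pos_def)

lemma level_card_start: "level_card L m (L 0) = I" and level_card_end: "level_card L m (L n) = I"
proof -
  have "{v. v < m \<and> L v = L 0} = {..<I}" using start_chain by auto
  then show "level_card L m (L 0) = I" by (simp add: level_card_def)
  have "{v. v < m \<and> L v = L n} = {n..<n + I}" using end_chain by auto
  then show "level_card L m (L n) = I" by (simp add: level_card_def)
qed

text \<open>Numbering each level from 0 yields an extremal system; composing with a permutation that
  preserves levels decides which vertex of a level gets which number. Transpositions inside levels
  are used below to force edges and omissions.\<close>

lemma perm_labels:
  assumes \<sigma>: "\<sigma> permutes {..<m}" "\<And>v. L (\<sigma> v) = L v"
  defines "lab \<equiv> \<lambda>v. pos (\<sigma> v)"
  shows "inj_on lab {v. v < m \<and> L v = l}" "card {v. v < m \<and> I \<le> lab v} = d" "good_labels n I lab"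
proof -
  have lt: "\<sigma> v < m \<longleftrightarrow> v < m" for v using permutes_in_image[OF \<sigma>(1), of v] by simp
  have inj: "inj_on lab {v. v < m \<and> L v = l}" for l
    unfolding lab_def using permutes_inj[OF \<sigma>(1)] \<sigma>(2)
    by (intro inj_onI) (metis (mono_tags, lifting) injD mem_Collect_eq pos_inj)
  then show "inj_on lab {v. v < m \<and> L v = l}" .
  have down: "\<exists>w<m. L w = L v \<and> lab w = q" if v: "v < m" and q: "q \<le> lab v" for v q
  proof -
    obtain w where w: "w \<le> \<sigma> v" "L w = L (\<sigma> v)" "pos w = q"
      using pos_down[of q "\<sigma> v"] q by (auto simp: lab_def)
    obtain x where x: "\<sigma> x = w" using permutes_surj[OF \<sigma>(1)] by (metis surjD)
    have "x < m" using lt[of x] lt[of v] x w v by simp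
    moreover have "L x = L v" using \<sigma>(2)[of x] \<sigma>(2)[of v] x w by simp
    moreover have "lab x = q" using x w by (simp add: lab_def)
    ultimately show ?thesis by blast
  qed
  have "excess L m I = card {v. v < m \<and> I \<le> lab v}"
    by (rule excess_labels) (use inj down in auto)
  then show "card {v. v < m \<and> I \<le> lab v} = d"
    by (simp add: d_def)
  have bij: "bij_betw lab {v. v < m \<and> L v = l} {..<I}" if "level_card L m l = I" for l
  proof -
    have "card {v \<in> {v. v < m \<and> L v = l}. I \<le> lab v} = card {v. v < m \<and> L v = l} - I"
    proof (rule card_labels_ge[OF _ inj])
      fix q q' assume "q \<in> lab ` {v. v < m \<and> L v = l}" "q' \<le> q"
      then obtain v where "v < m" "L v = l" "q' \<le> lab v" by auto
      then show "q' \<in> lab ` {v. v < m \<and> L v = l}" using down[of v q'] by auto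
    qed simp
    then have "{v \<in> {v. v < m \<and> L v = l}. I \<le> lab v} = {}"
      using that by (simp add: level_card_def)
    then have "lab ` {v. v < m \<and> L v = l} \<subseteq> {..<I}" by (auto simp: not_le)
    moreover have "card (lab ` {v. v < m \<and> L v = l}) = card {..<I}"
      using card_image[OF inj] that by (simp add: level_card_def)
    ultimately show ?thesis
      using inj by (simp add: bij_betw_def card_subset_eq)
  qed
  have "{v. v < m \<and> L v = L 0} = {..<I}" "{v. v < m \<and> L v = L n} = {n..<n + I}"
    using start_chain end_chain by auto
  then show "good_labels n I lab"
    unfolding good_labels_def using bij[OF level_card_start] bij[OF level_card_end] by simp
qed

text \<open>Swapping \<open>a\<close> and \<open>b\<close> to the front of their levels gives both
  label 0. Every vertex between them lies on one of the two levels and has another label, so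
  \<open>b\<close> is the successor of \<open>a\<close> on the path with label 0.\<close>

lemma edge_consecutive:
  assumes a: "a < m" "L a = l" and b: "b < m" "L b = Suc l"
  shows "(a, b) \<in> all_edges"
proof -
  have ba: "L 0 \<le> l" "l < L n" using L_bounds[of a] L_bounds[of b] a b by auto
  define \<sigma> where "\<sigma> = Transposition.transpose a (first l) \<circ> Transposition.transpose b (first (Suc l))"
  have f: "L (first l) = l" "first l < m" "L (first (Suc l)) = Suc l" "first (Suc l) < m"
    using first_props[of l] first_props[of "Suc l"] ba by auto
  have \<sigma>: "\<sigma> permutes {..<m}"
    unfolding \<sigma>_def by (intro permutes_compose permutes_swap_id) (use a b f in auto)
  have L\<sigma>: "L (\<sigma> v) = L v" for v
    using a b f by (auto simp: \<sigma>_def Transposition.transpose_def)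
  have ne: "a \<noteq> b" "a \<noteq> first (Suc l)" "first l \<noteq> b" "first l \<noteq> first (Suc l)" using a b f by auto
  have "\<sigma> a = first l" "\<sigma> b = first (Suc l)" using ne by (auto simp: \<sigma>_def Transposition.transpose_def)
  then have lab0: "pos (\<sigma> a) = 0" "pos (\<sigma> b) = 0"
    using pos_first[of a] pos_first[of b] a b by auto
  note lab = perm_labels[OF \<sigma> L\<sigma>]
  have "a < b" using L_mono[of b a] a b by (metis Suc_n_not_le_n not_le)
  have n: "nxt (\<lambda>v. pos (\<sigma> v)) a b"
    unfolding nxt_def
  proof (intro conjI allI impI)
    fix x assume x: "a < x \<and> x < b"
    show "pos (\<sigma> x) \<noteq> pos (\<sigma> a)"
    proof
      assume eq: "pos (\<sigma> x) = pos (\<sigma> a)"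
      have "l \<le> L x" "L x \<le> Suc l" using L_mono[of a x] L_mono[of x b] x a b by auto
      then consider "L x = L a" | "L x = L b" using a b by linarith
      then show False
      proof cases
        case 1
        then show False using inj_onD[OF lab(1)[of "L a"], of x a] eq x a b by auto
      next
        case 2
        then show False using inj_onD[OF lab(1)[of "L b"], of x b] eq lab0 x a b by auto
      qed
    qed
  qed (use \<open>a < b\<close> lab0 in auto)
  have "a < n" using end_chain[of a] a ba by (metis less_irrefl not_le)
  then show ?thesis
    using tight_labels[OF lab] n lab0 I_pos unfolding all_edges_def by (metis UN_I mem_Collect_eq)
qed

text \<open>Raising all labels of the small middle level by one frees label 0 there, so the path
  with label 0 jumps over it. As the level has fewer than \<open>I\<close> vertices, the raised
  labels stay below \<open>I\<close>, and the number of vertices left out does not change.\<close>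

lemma edge_skip:
  assumes l: "L 0 \<le> l" "Suc (Suc l) \<le> L n" and small: "level_card L m (Suc l) < I"
  shows "(first l, first (Suc (Suc l))) \<in> all_edges"
proof -
  define lab where "lab = (\<lambda>v. if L v = Suc l then Suc (pos v) else pos v)"
  have id: "id permutes {..<m}" "\<And>v. L (id v) = L v" by (auto simp: permutes_id)
  note pl = perm_labels[OF id, simplified]
  have inj: "inj_on lab {v. v < m \<and> L v = k}" for k
    by (rule inj_onI) (auto simp: lab_def intro: pos_inj split: if_splits)
  have "pos v < level_card L m (Suc l)" if v: "v < m" "L v = Suc l" for v
  proof -
    have "{first (L v)..v} \<subseteq> {v. v < m \<and> L v = Suc l}"
      using same_level_between[of v] v by auto
    then have "card {first (L v)..v} \<le> level_card L m (Suc l)"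
      unfolding level_card_def by (intro card_mono) auto
    then show ?thesis using first_le[of v] by (simp add: pos_def)
  qed
  then have "Suc (pos v) < I" if "v < m" "L v = Suc l" for v
    using that small by (meson Suc_leI le_less_trans)
  then have "{v. v < m \<and> I \<le> lab v} = {v. v < m \<and> I \<le> pos v}"
    by (auto simp: lab_def) (metis Suc_lessD not_le)+
  then have d: "card {v. v < m \<and> I \<le> lab v} = d" using pl(2) by simp
  have good: "good_labels n I lab"
  proof -
    have "bij_betw lab {..<I} {..<I} \<longleftrightarrow> bij_betw pos {..<I} {..<I}"
    proof (rule bij_betw_cong)
      fix a assume "a \<in> {..<I}"
      then have "L a = L 0" using start_chain[of a] by simp
      then show "lab a = pos a" using l by (simp add: lab_def)
    qed
    moreover have "bij_betw lab {n..<n + I} {..<I} \<longleftrightarrow> bij_betw pos {n..<n + I} {..<I}"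
    proof (rule bij_betw_cong)
      fix a assume "a \<in> {n..<m}"
      then have "L a = L n" using end_chain[of a] by simp
      then show "lab a = pos a" using l by (simp add: lab_def)
    qed
    ultimately show ?thesis using pl(3) by (simp add: good_labels_def)
  qed
  let ?a = "first l" and ?b = "first (Suc (Suc l))"
  have f: "L ?a = l" "?a < m" "L ?b = Suc (Suc l)" "?b < m"
    using first_props[of l] first_props[of "Suc (Suc l)"] l by auto
  have lab0: "lab ?a = 0" "lab ?b = 0"
    using f pos_first[of ?a] pos_first[of ?b] by (auto simp: lab_def)
  have "?a < ?b" using L_mono[of ?b ?a] f by (metis le_Suc_eq n_not_Suc_n Suc_n_not_le_n Suc_leD not_le)
  have n: "nxt lab ?a ?b"
    unfolding nxt_def
  proof (intro conjI allI impI)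
    fix x assume x: "?a < x \<and> x < ?b"
    show "lab x \<noteq> lab ?a"
    proof
      assume eq: "lab x = lab ?a"
      then have "L x \<noteq> Suc l" using lab0 by (auto simp: lab_def)
      moreover have "l \<le> L x" "L x \<le> Suc (Suc l)" using L_mono[of ?a x] L_mono[of x ?b] x f by auto
      ultimately consider "L x = L ?a" | "L x = L ?b" using f by linarith
      then show False
      proof cases
        case 1
        then show False using inj_onD[OF inj[of "L ?a"], of x ?a] eq x f by auto
      next
        case 2
        then show False using inj_onD[OF inj[of "L ?b"], of x ?b] eq lab0 x f by auto
      qed
    qed
  qed (use \<open>?a < ?b\<close> lab0 in auto)
  have "?a < n" using end_chain[of ?a] f l by (metis Suc_leD not_less_eq_eq not_le)
  then show ?thesis
    using tight_labels[OF inj d good] n lab0 I_pos unfolding all_edges_def by (metis UN_I mem_Collect_eq)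
qed

lemma cover_first:
  assumes l: "L 0 \<le> l" "l \<le> L n"
  shows "\<exists>p. tight p \<and> first l \<notin> pfix n I p"
proof -
  have id: "id permutes {..<m}" "\<And>v. L (id v) = L v" by (auto simp: permutes_id)
  note pl = perm_labels[OF id, simplified]
  have "pos (first l) = 0" using pos_first[of "first l"] first_props[OF l] by simp
  then show ?thesis
    using tight_labels[OF pl] I_pos by (metis (mono_tags, lifting) mem_Collect_eq not_le)
qed

text \<open>A level with more than \<open>I\<close> vertices contains a vertex with label at least
  \<open>I\<close>; swapping it with the first vertex makes the latter the one left out.\<close>

lemma avoid_first:
  assumes l: "L 0 \<le> l" "l \<le> L n" and big: "I < level_card L m l"
  shows "\<exists>p. tight p \<and> first l \<in> pfix n I p"
proof -
  have f: "L (first l) = l" "first l < m" using first_props[OF l] by auto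
  have "\<exists>v<m. L v = l \<and> I \<le> pos v"
  proof (rule ccontr)
    assume no: "\<not> (\<exists>v<m. L v = l \<and> I \<le> pos v)"
    have "level_card L m l = card (pos ` {v. v < m \<and> L v = l})"
      unfolding level_card_def by (rule card_image[symmetric], rule inj_onI) (auto intro: pos_inj)
    also have "\<dots> \<le> card {..<I}" using no by (intro card_mono) (auto simp: not_le)
    finally show False using big by simp
  qed
  then obtain v where v: "v < m" "L v = l" "I \<le> pos v" by auto
  define \<sigma> where "\<sigma> = Transposition.transpose v (first l)"
  have \<sigma>: "\<sigma> permutes {..<m}"
    unfolding \<sigma>_def by (intro permutes_swap_id) (use v f in auto)
  have L\<sigma>: "L (\<sigma> w) = L w" for w
    using v f by (auto simp: \<sigma>_def Transposition.transpose_def)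
  have "I \<le> pos (\<sigma> (first l))" using v by (simp add: \<sigma>_def)
  then show ?thesis
    using tight_labels[OF perm_labels[OF \<sigma> L\<sigma>]] f by (metis (mono_tags, lifting) mem_Collect_eq)
qed

subsection \<open>Irreducibility\<close>

lemma L0_less: "L 0 < L n"
proof -
  have "L n \<noteq> L 0" using start_chain[of n] I_le I_pos by simp
  then show ?thesis using L_mono[of 0 n] by simp
qed

lemma row_first_edge: "(0, first (Suc (L 0))) \<in> all_edges"
  using edge_consecutive[of 0 "L 0" "first (Suc (L 0))"] first_props[of "Suc (L 0)"] L0_less I_pos by simp

lemma column_last_edge: "\<exists>u. (u, m - 1) \<in> all_edges"
proof -
  have "n \<le> m - 1" "m - 1 < m" using I_pos by linarith+
  then have "L (m - 1) = L n" using end_chain[of "m - 1"] by simp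
  then have "(first (L n - 1), m - 1) \<in> all_edges"
    using edge_consecutive[of "first (L n - 1)" "L n - 1" "m - 1"] first_props[of "L n - 1"] L0_less I_pos by simp
  then show ?thesis by blast
qed

lemma edges_row: "tight p \<Longrightarrow> (u, w) \<in> edges p \<Longrightarrow> (u, w') \<in> edges p \<Longrightarrow> w = w'"
  by (auto simp: edges_def)

lemma edges_column: "tight p \<Longrightarrow> (u, w) \<in> edges p \<Longrightarrow> (u', w) \<in> edges p \<Longrightarrow> u = u'"
  using permutes_inj[of p "{0..<n}"] by (auto simp: edges_def tight_def inj_def)

definition side :: "mpoly \<Rightarrow> nat \<Rightarrow> nat \<Rightarrow> bool" where
  "side g u w \<longleftrightarrow> pvar u w \<in> vars g"

text \<open>The edge between the first vertices of two consecutive levels serves as a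
  representative; the sides of all edges that start on level \<open>l\<close> will agree with
  it.\<close>

definition gside :: "mpoly \<Rightarrow> nat \<Rightarrow> bool" where
  "gside g l \<longleftrightarrow> side g (first l) (first (Suc l))"

context
  fixes g h assumes gh: "fpoly = g * h"
begin

lemma fpoly_nz: "g * h \<noteq> 0" "g \<noteq> 0" "h \<noteq> 0"
proof -
  have "vars (g * h) \<noteq> {}" using row_first_edge vars_fpoly gh by auto
  then show "g * h \<noteq> 0" by auto
  then show "g \<noteq> 0" "h \<noteq> 0" by auto
qed

lemma vars_disjoint: "vars g \<inter> vars h = {}" and vars_Un: "vars fpoly = vars g \<union> vars h"
  using multilinear_mult(3)[of g h] multilinear_fpoly gh fpoly_nz vars_mult_eq[of g h] by auto

lemma other_side: "(u, w) \<in> all_edges \<Longrightarrow> side h u w \<longleftrightarrow> \<not> side g u w"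
  using vars_disjoint vars_Un vars_fpoly unfolding side_def by auto

text \<open>As the factors have no variable in common, evaluating the product at mixed arguments shows
  that the part of one path system in \<open>g\<close> can be combined with the part of another one in \<open>h\<close>.\<close>

lemma mix:
  assumes p: "tight p" and q: "tight q"
  shows "\<exists>r. tight r \<and> edges r =
    {(u, w) \<in> edges p. side g u w} \<union> {(u, w) \<in> edges q. \<not> side g u w}"
proof -
  define M where "M = (\<lambda>p q. {(u, w) \<in> edges p. side g u w} \<union> {(u, w) \<in> edges q. \<not> side g u w})"
  have ev_mix: "ev (indic (M p q)) g = ev (indic (edges p)) g" "ev (indic (M p q)) h = ev (indic (edges q)) h" for p q
  proof -
    have "\<exists>u w. v = pvar u w" if "v \<in> vars fpoly" for v
      using that unfolding vars_fpoly by auto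
    then have v: "\<exists>u w. v = pvar u w" if "v \<in> vars g \<union> vars h" for v
      using that vars_Un by blast
    show "ev (indic (M p q)) g = ev (indic (edges p)) g"
    proof (rule ev_cong)
      fix v assume "v \<in> vars g"
      moreover from this obtain u w where "v = pvar u w" using v by blast
      ultimately show "indic (M p q) v = indic (edges p) v" by (auto simp: M_def side_def)
    qed
    show "ev (indic (M p q)) h = ev (indic (edges q)) h"
    proof (rule ev_cong)
      fix v assume "v \<in> vars h"
      moreover from this obtain u w where "v = pvar u w" using v by blast
      ultimately show "indic (M p q) v = indic (edges q) v"
        using vars_disjoint by (auto simp: M_def side_def)
    qed
  qed
  \<comment> \<open>At the mixed point each factor takes the nonzero value that it has at
    \<open>p\<close> or at \<open>q\<close>, so some tight system survives inside the mixed
    set.\<close>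
  have nz: "\<exists>r. tight r \<and> edges r \<subseteq> M p q" if "tight p" "tight q" for p q
  proof -
    have "ev (indic (edges p)) g * ev (indic (edges p)) h \<noteq> 0" "ev (indic (edges q)) g * ev (indic (edges q)) h \<noteq> 0"
      using ev_indic_edges that gh by (auto simp: ev.subst_mult)
    then have "ev (indic (M p q)) fpoly \<noteq> 0"
      by (simp add: gh ev.subst_mult ev_mix)
    then show ?thesis unfolding ev_indic by (metis (mono_tags, lifting) mem_Collect_eq sum.not_neutral_contains_not_neutral)
  qed
  have fin: "finite (M p q)" for p q by (auto simp: M_def intro: finite_subset[of _ "edges _"])
  obtain r r' where r: "tight r" "edges r \<subseteq> M p q" and r': "tight r'" "edges r' \<subseteq> M q p"
    using nz[OF p q] nz[OF q p] by blast
  \<comment> \<open>Counting forces equality: each of the two mixed sets contains a tight system and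
    thus has at least \<open>n - d\<close> edges, while their sizes add up to at most
    \<open>2 * (n - d)\<close>.\<close>
  have le: "n - d \<le> card (M p q)" "n - d \<le> card (M q p)"
    using card_mono[OF fin r(2)] card_mono[OF fin r'(2)] card_edges r r' by auto
  have split: "card {(u, w) \<in> edges p. side g u w} + card {(u, w) \<in> edges p. \<not> side g u w} = n - d" if "tight p" for p
  proof -
    have "edges p = {(u, w) \<in> edges p. side g u w} \<union> {(u, w) \<in> edges p. \<not> side g u w}" by auto
    moreover have "card ({(u, w) \<in> edges p. side g u w} \<union> {(u, w) \<in> edges p. \<not> side g u w}) =
        card {(u, w) \<in> edges p. side g u w} + card {(u, w) \<in> edges p. \<not> side g u w}"
      by (rule card_Un_disjoint) (auto intro: finite_subset[of _ "edges p"])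
    ultimately show ?thesis using card_edges[OF that] by metis
  qed
  have "card (M p q) \<le> card {(u, w) \<in> edges p. side g u w} + card {(u, w) \<in> edges q. \<not> side g u w}"
    "card (M q p) \<le> card {(u, w) \<in> edges q. side g u w} + card {(u, w) \<in> edges p. \<not> side g u w}"
    unfolding M_def by (rule card_Un_le)+
  then have "card (M p q) = n - d" using le split[OF p] split[OF q] by linarith
  then have "edges r = M p q" using card_subset_eq[OF fin r(2)] card_edges[OF r(1)] by simp
  then show ?thesis using r(1) by (auto simp: M_def)
qed

text \<open>Mixing a system through one edge with a system through the other one would put two edges
  with the same start into one tight system. For columns the common end gives the same
  contradiction.\<close>

lemma row_side:
  assumes "(u, w) \<in> all_edges" "(u, w') \<in> all_edges" shows "side g u w = side g u w'"
proof -
  have "\<not> (side g u w \<and> \<not> side g u w')" if e: "(u, w) \<in> all_edges" "(u, w') \<in> all_edges" for w w'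
  proof
    assume s: "side g u w \<and> \<not> side g u w'"
    obtain p q where "tight p" "(u, w) \<in> edges p" "tight q" "(u, w') \<in> edges q"
      using e by (auto simp: all_edges_def)
    moreover obtain r where r: "tight r" "edges r =
      {(u, w) \<in> edges p. side g u w} \<union> {(u, w) \<in> edges q. \<not> side g u w}"
      using mix calculation by blast
    ultimately have "(u, w) \<in> edges r" "(u, w') \<in> edges r" using s by auto
    then show False using edges_row[OF r(1)] s by blast
  qed
  then show ?thesis using assms by blast
qed

lemma column_side:
  assumes "(u, w) \<in> all_edges" "(u', w) \<in> all_edges" shows "side g u w = side g u' w"
proof -
  have "\<not> (side g u w \<and> \<not> side g u' w)" if e: "(u, w) \<in> all_edges" "(u', w) \<in> all_edges" for u u'
  proof
    assume s: "side g u w \<and> \<not> side g u' w"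
    obtain p q where "tight p" "(u, w) \<in> edges p" "tight q" "(u', w) \<in> edges q"
      using e by (auto simp: all_edges_def)
    moreover obtain r where r: "tight r" "edges r =
      {(u, w) \<in> edges p. side g u w} \<union> {(u, w) \<in> edges q. \<not> side g u w}"
      using mix calculation by blast
    ultimately have "(u, w) \<in> edges r" "(u', w) \<in> edges r" using s by auto
    then show False using edges_column[OF r(1)] s by blast
  qed
  then show ?thesis using assms by blast
qed

text \<open>The edge from \<open>u\<close> to the first vertex of the next level mediates: it shares
  its row with the given edge and its column with the representative.\<close>

lemma row_gside:
  assumes "(u, w) \<in> all_edges" shows "side g u w = gside g (L u)"
proof -
  have uw: "u < n" "w < m" "L u < L w" using all_edges_bound[OF assms] by auto
  have l: "L 0 \<le> L u" "Suc (L u) \<le> L n"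
    using L_bounds[of u] L_bounds[of w] uw by auto
  have f: "L (first (Suc (L u))) = Suc (L u)" "first (Suc (L u)) < m" "first (L u) < m"
    using first_props[of "Suc (L u)"] first_props[of "L u"] l by auto
  have e: "(u, first (Suc (L u))) \<in> all_edges" "(first (L u), first (Suc (L u))) \<in> all_edges"
    using edge_consecutive[of u "L u"] edge_consecutive[of "first (L u)" "L u"] f uw by auto
  show ?thesis
    unfolding gside_def using row_side[OF assms e(1)] column_side[OF e] by simp
qed

lemma gside_into:
  assumes l: "L 0 \<le> l" "Suc l \<le> L n" and e: "(u, first (Suc l)) \<in> all_edges"
  shows "side g u (first (Suc l)) = gside g l"
proof -
  have f: "L (first (Suc l)) = Suc l" "first (Suc l) < m" "first l < m" "L (first l) = l"
    using first_props[of "Suc l"] first_props[of l] l by auto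
  have "(first l, first (Suc l)) \<in> all_edges"
    using edge_consecutive[of "first l" l] f by auto
  from column_side[OF e this] show ?thesis by (simp add: gside_def)
qed

text \<open>Here it enters that no intermediate chain has length \<open>I\<close>. If level
  \<open>l + 1\<close> is smaller, an edge that skips it shares its row with the representative at
  \<open>l\<close> and its column with the one at \<open>l + 1\<close>. If it is larger, a system
  through its first vertex is mixed with one that leaves this vertex out: the mixture would enter
  the vertex without leaving it.\<close>

lemma gside_Suc_imp:
  assumes l: "L 0 \<le> l" "Suc (Suc l) \<le> L n" and g1: "gside g l" shows "gside g (Suc l)"
proof (rule ccontr)
  assume g2: "\<not> gside g (Suc l)"
  let ?b = "first (Suc l)"
  have fb: "L ?b = Suc l" "?b < m" and f2: "L (first (Suc (Suc l))) = Suc (Suc l)"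
    using first_props[of "Suc l"] first_props[of "Suc (Suc l)"] l by auto
  have bI: "I \<le> ?b" using start_chain[of ?b] fb l by (metis Suc_n_not_le_n not_le)
  have bn: "?b < n" using end_chain[of ?b] fb l by (metis Suc_n_not_le_n not_le)
  show False
  proof (cases "level_card L m (Suc l) < I")
    case True
    have e: "(first l, first (Suc (Suc l))) \<in> all_edges" using edge_skip[OF l True] .
    have "L (first l) = l" using first_props[of l] l by simp
    then show False
      using row_gside[OF e] gside_into[OF _ l(2) e] g1 g2 l by simp
  next
    case False
    then have big: "I < level_card L m (Suc l)" using mid_chain[of "Suc l"] l by simp
    obtain p where p: "tight p" "?b \<notin> pfix n I p" using cover_first[of "Suc l"] l by auto
    obtain q where q: "tight q" "?b \<in> pfix n I q" using avoid_first[OF _ _ big] l by auto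
    obtain r where r: "tight r" "edges r =
      {(u, w) \<in> edges p. side g u w} \<union> {(u, w) \<in> edges q. \<not> side g u w}"
      using mix[OF p(1) q(1)] by blast
    have "\<exists>u. (u, ?b) \<in> edges p"
    proof -
      have perm: "p permutes {0..<n}" using p by (simp add: tight_def)
      have "?b - I < n" using fb bI I_pos by linarith
      then obtain u where u: "p u = ?b - I" "u < n"
        using permutes_inverses(1)[OF perm] permutes_in_image[OF perm] by (metis atLeastLessThan_iff le0)
      then have "?b = I + p u" using bI by simp
      moreover have "u \<noteq> ?b"
      proof
        assume "u = ?b"
        then have "?b \<in> pfix n I p" using calculation bn by (simp add: pfix_def)
        then show False using p(2) by simp
      qed
      ultimately show ?thesis using u by (auto simp: edges_def pedges_def intro!: exI[of _ u])
    qed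
    then obtain u where u: "(u, ?b) \<in> edges p" by blast
    then have "(u, ?b) \<in> all_edges" using p by (auto simp: all_edges_def)
    then have "side g u ?b" using gside_into[of l u] l g1 by simp
    then have ur: "(u, ?b) \<in> edges r" using r u by auto
    have "(?b, w) \<notin> edges r" for w
    proof
      assume "(?b, w) \<in> edges r"
      moreover have "(?b, w) \<notin> edges q"
        using q by (auto simp: edges_def pedges_def pfix_def)
      ultimately have "(?b, w) \<in> edges p" "side g ?b w" using r by auto
      then have "(?b, w) \<in> all_edges" using p by (auto simp: all_edges_def)
      then show False using row_gside[of ?b w] fb g2 \<open>side g ?b w\<close> by simp
    qed
    then have "?b \<notin> pedges n I r" by (auto simp: edges_def)
    then have "?b = I + r ?b" using bn by (simp add: pedges_def)
    moreover have "?b = I + r u" "u \<noteq> ?b" using tight_edge[OF r(1) ur] by auto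
    ultimately have "r ?b = r u" by linarith
    then show False
      using \<open>u \<noteq> ?b\<close> r(1) by (auto simp: tight_def dest: permutes_inj injD)
  qed
qed

end

text \<open>The implication from level \<open>l\<close> to level \<open>l + 1\<close> holds for both
  factors by symmetry, so all levels are on one side, and with them all edges.\<close>

lemma fpoly_irreducible:
  assumes gh: "fpoly = g * h" shows "vars g = {} \<or> vars h = {}"
proof -
  have hg: "fpoly = h * g" using gh by (simp add: mult.commute)
  have flip: "gside h l \<longleftrightarrow> \<not> gside g l" if l: "L 0 \<le> l" "Suc l \<le> L n" for l
  proof -
    have "L (first (Suc l)) = Suc l" "first (Suc l) < m" "first l < m" "L (first l) = l"
      using first_props[of "Suc l"] first_props[of l] l by auto
    then have "(first l, first (Suc l)) \<in> all_edges"
      using edge_consecutive[of "first l" l] by auto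
    then show ?thesis
      using other_side[OF gh] by (simp add: gside_def)
  qed
  have "gside g (L 0 + k) = gside g (L 0)" if "Suc (L 0 + k) \<le> L n" for k
    using that
  proof (induction k)
    case (Suc k)
    then show ?case
      using gside_Suc_imp[OF gh, of "L 0 + k"] gside_Suc_imp[OF hg, of "L 0 + k"]
        flip[of "L 0 + k"] flip[of "Suc (L 0 + k)"] by auto
  qed simp
  then have const: "gside g l = gside g (L 0)" if "L 0 \<le> l" "Suc l \<le> L n" for l
    using that by (metis le_add_diff_inverse)
  have side: "side g u w = gside g (L 0)" if e: "(u, w) \<in> all_edges" for u w
  proof -
    have "u < n" "w < m" "L u < L w" using all_edges_bound[OF e] by auto
    then have "L 0 \<le> L u" "Suc (L u) \<le> L n" using L_bounds[of u] L_bounds[of w] by auto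
    then have "gside g (L u) = gside g (L 0)" by (rule const)
    then show ?thesis using row_gside[OF gh e] by simp
  qed
  have "x \<in> vars fpoly \<Longrightarrow> x \<in> vars g \<longleftrightarrow> gside g (L 0)" for x
    unfolding vars_fpoly using side by (auto simp: side_def)
  then show ?thesis
    using vars_disjoint[OF gh] vars_Un[OF gh] by blast
qed

lemma prime_fpoly: "prime_elem fpoly"
proof (rule multilinear_irreducible_prime[OF multilinear_fpoly])
  show "vars fpoly \<noteq> {}" using row_first_edge vars_fpoly by auto
qed (rule fpoly_irreducible)

text \<open>Two rows that start edges are exhibited. For \<open>I\<close> at least 2 these are rows
  0 and 1, since vertices left out are at least \<open>I\<close>; for \<open>I = 1\<close> they are
  row 0 and the first vertex of the next level, which has label 0 and lies before the upper
  chain.\<close>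

lemma degree_fpoly:
  assumes "I \<noteq> 1 \<or> Suc (L 0) \<noteq> L n"
  shows "n - d \<ge> 2"
proof -
  have id: "id permutes {..<m}" "\<And>v. L (id v) = L v" by (auto simp: permutes_id)
  note pl = perm_labels[OF id, simplified]
  obtain p where p: "tight p" "pfix n I p = {v. v < m \<and> I \<le> pos v}"
    using tight_labels[OF pl] by metis
  have "\<exists>S. S \<subseteq> pedges n I p \<and> card S = 2"
  proof (cases "I = 1")
    case False
    have "{0, 1} \<subseteq> pedges n I p"
      using False I_pos I_le by (auto simp: pedges_def)
    then show ?thesis by (metis One_nat_def card_2_iff zero_neq_one)
  next
    case True
    let ?b = "first (Suc (L 0))"
    have l: "Suc (L 0) < L n" using assms True L0_less by simp
    have b: "L ?b = Suc (L 0)" "?b < m" using first_props[of "Suc (L 0)"] l by auto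
    have "?b \<notin> pfix n I p" using p(2) pos_first[of ?b] b I_pos by simp
    moreover have "?b < n" using end_chain[of ?b] b l by (metis less_irrefl not_le)
    ultimately have "?b \<in> pedges n I p" by (simp add: pedges_def pfix_def)
    moreover have "0 \<in> pedges n I p" using I_pos I_le by (auto simp: pedges_def)
    moreover have "?b \<noteq> 0" using b(1) by (metis n_not_Suc_n)
    ultimately show ?thesis by (intro exI[of _ "{0, ?b}"]) auto
  qed
  then obtain S where "S \<subseteq> pedges n I p" "card S = 2" by blast
  then have "2 \<le> card (pedges n I p)" using card_mono[of "pedges n I p" S] by simp
  then show ?thesis using card_pedges[OF p(1)] by simp
qed

end

section \<open>Zariski topology and hypersurfaces\<close>

definition box :: "nat \<Rightarrow> (nat \<times> nat) set" where
  "box N = {1..N} \<times> {1..N}"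

lemma topspace_zariski [simp]: "topspace (zariski N) = carrier_mat N N"
proof -
  have "\<exists>p. vars p \<subseteq> {1..N} \<times> {1..N} \<and> {A \<in> carrier_mat N N. eval_mpoly p A \<noteq> 0} = carrier_mat N N"
    by (rule exI[of _ 1]) (simp add: eval_mpoly_ev)
  then show ?thesis
    unfolding zariski_def topology_generated_by_topspace by blast
qed

lemma openin_zariski_basic:
  "vars p \<subseteq> box N \<Longrightarrow> openin (zariski N) {A \<in> carrier_mat N N. eval_mpoly p A \<noteq> 0}"
  unfolding zariski_def box_def by (rule topology_generated_by_Basis) blast

text \<open>Multiplying polynomials shows that finite intersections of principal open sets are
  principal, so the generating family is already a basis.\<close>

lemma zariski_nbhd:
  assumes "openin (zariski N) U" "A \<in> U"
  shows "\<exists>p. vars p \<subseteq> box N \<and> eval_mpoly p A \<noteq> 0 \<and>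
    (\<forall>B\<in>carrier_mat N N. eval_mpoly p B \<noteq> 0 \<longrightarrow> B \<in> U)"
proof -
  have "generate_topology_on {{A \<in> carrier_mat N N. eval_mpoly p A \<noteq> 0} | p. vars p \<subseteq> {1..N} \<times> {1..N}} U"
    using assms(1) unfolding zariski_def by (rule openin_topology_generated_by)
  then show ?thesis
    using assms(2)
  proof (induction arbitrary: A)
    case (Int a b)
    then obtain p q where p: "vars p \<subseteq> box N" "eval_mpoly p A \<noteq> 0"
        "\<forall>B\<in>carrier_mat N N. eval_mpoly p B \<noteq> 0 \<longrightarrow> B \<in> a"
      and q: "vars q \<subseteq> box N" "eval_mpoly q A \<noteq> 0" "\<forall>B\<in>carrier_mat N N. eval_mpoly q B \<noteq> 0 \<longrightarrow> B \<in> b"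
      using Int.IH(1)[of A] Int.IH(2)[of A] by blast
    have "vars (p * q) \<subseteq> box N" using vars_mult[of p q] p(1) q(1) by blast
    then show ?case
      using p q by (intro exI[of _ "p * q"]) (auto simp: eval_mpoly_ev ev.subst_mult)
  next
    case (UN K)
    then obtain k where "k \<in> K" "A \<in> k" by blast
    then show ?case using UN.IH[of k A] by blast
  next
    case (Basis s)
    then show ?case unfolding box_def by blast
  qed simp
qed

lemma closedin_zariski_zeros:
  assumes "\<And>p. p \<in> P \<Longrightarrow> vars p \<subseteq> box N"
  shows "closedin (zariski N) {A \<in> carrier_mat N N. \<forall>p\<in>P. eval_mpoly p A = 0}"
proof -
  have "carrier_mat N N - {A \<in> carrier_mat N N. \<forall>p\<in>P. eval_mpoly p A = 0} =
      (\<Union>p\<in>P. {A \<in> carrier_mat N N. eval_mpoly p A \<noteq> 0})" by auto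
  moreover have "openin (zariski N) (\<Union>p\<in>P. {A \<in> carrier_mat N N. eval_mpoly p A \<noteq> 0})"
    using openin_zariski_basic assms by (intro openin_Union) auto
  ultimately show ?thesis by (auto simp: closedin_def)
qed

lemma vanish_closure:
  assumes "\<And>A. A \<in> V \<Longrightarrow> eval_mpoly p A = 0" "vars p \<subseteq> box N" "V \<subseteq> carrier_mat N N"
    and "A \<in> zariski N closure_of V"
  shows "eval_mpoly p A = 0"
proof -
  have "closedin (zariski N) {A \<in> carrier_mat N N. \<forall>p\<in>{p}. eval_mpoly p A = 0}"
    by (rule closedin_zariski_zeros) (use assms in auto)
  moreover have "V \<subseteq> {A \<in> carrier_mat N N. \<forall>p\<in>{p}. eval_mpoly p A = 0}" using assms by auto
  ultimately show ?thesis using closure_of_minimal assms(4) by blast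
qed

lemma irreducible_zariskiI:
  assumes Z: "Z \<subseteq> carrier_mat N N" "Z \<noteq> {}"
    and pq: "\<And>p q. vars p \<subseteq> box N \<Longrightarrow> vars q \<subseteq> box N \<Longrightarrow> (\<And>A. A \<in> Z \<Longrightarrow> eval_mpoly (p * q) A = 0) \<Longrightarrow>
      (\<forall>A\<in>Z. eval_mpoly p A = 0) \<or> (\<forall>A\<in>Z. eval_mpoly q A = 0)"
  shows "irreducible_in (zariski N) Z"
  unfolding irreducible_in_def
proof (intro conjI allI impI)
  fix C D assume CD: "closedin (zariski N) C \<and> closedin (zariski N) D \<and> Z \<subseteq> C \<union> D"
  show "Z \<subseteq> C \<or> Z \<subseteq> D"
  proof (rule ccontr)
    assume "\<not> (Z \<subseteq> C \<or> Z \<subseteq> D)"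
    then obtain A B where A: "A \<in> Z" "A \<notin> C" and B: "B \<in> Z" "B \<notin> D" by auto
    have op: "openin (zariski N) (carrier_mat N N - C)" "openin (zariski N) (carrier_mat N N - D)"
      using CD by (auto simp: closedin_def)
    obtain p where p: "vars p \<subseteq> box N" "eval_mpoly p A \<noteq> 0"
        "\<forall>B\<in>carrier_mat N N. eval_mpoly p B \<noteq> 0 \<longrightarrow> B \<in> carrier_mat N N - C"
      using zariski_nbhd[OF op(1), of A] A Z by blast
    obtain q where q: "vars q \<subseteq> box N" "eval_mpoly q B \<noteq> 0"
        "\<forall>B\<in>carrier_mat N N. eval_mpoly q B \<noteq> 0 \<longrightarrow> B \<in> carrier_mat N N - D"
      using zariski_nbhd[OF op(2), of B] B Z by blast
    have "eval_mpoly (p * q) X = 0" if "X \<in> Z" for X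
    proof -
      have "X \<in> carrier_mat N N" "X \<in> C \<or> X \<in> D" using that Z CD by auto
      then have "eval_mpoly p X = 0 \<or> eval_mpoly q X = 0" using p(3) q(3) by blast
      then show ?thesis by (auto simp: eval_mpoly_ev ev.subst_mult)
    qed
    from pq[OF p(1) q(1) this] show False using A B p q by blast
  qed
qed (use Z in auto)

text \<open>This allows several generic conditions to be imposed at one and the same point of an
  irreducible set.\<close>

lemma irreducible_in_open_Int:
  assumes "irreducible_in X V" "openin X U1" "openin X U2" "U1 \<inter> V \<noteq> {}" "U2 \<inter> V \<noteq> {}"
  shows "U1 \<inter> U2 \<inter> V \<noteq> {}"
proof
  assume e: "U1 \<inter> U2 \<inter> V = {}"
  have "closedin X (topspace X - U1)" "closedin X (topspace X - U2)"
    using assms by (auto intro: closedin_diff)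
  moreover have "V \<subseteq> (topspace X - U1) \<union> (topspace X - U2)"
    using e assms(1) by (auto simp: irreducible_in_def)
  ultimately have "V \<subseteq> topspace X - U1 \<or> V \<subseteq> topspace X - U2"
    using assms(1) unfolding irreducible_in_def by blast
  then show False using assms(4,5) by blast
qed

lemma irreducible_in_closure:
  assumes "irreducible_in X V" shows "irreducible_in X (X closure_of V)"
  unfolding irreducible_in_def
proof (intro conjI allI impI)
  have V: "V \<subseteq> topspace X" "V \<noteq> {}" using assms by (auto simp: irreducible_in_def)
  have sub: "V \<subseteq> X closure_of V" using closure_of_subset V by blast
  show "X closure_of V \<subseteq> topspace X" by (rule closure_of_subset_topspace)
  show "X closure_of V \<noteq> {}" using sub V by auto
  fix C D assume CD: "closedin X C \<and> closedin X D \<and> X closure_of V \<subseteq> C \<union> D"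
  then have "V \<subseteq> C \<or> V \<subseteq> D"
    using assms sub unfolding irreducible_in_def by blast
  then show "X closure_of V \<subseteq> C \<or> X closure_of V \<subseteq> D"
    using CD closure_of_minimal by blast
qed

text \<open>Otherwise \<open>Y\<close>, \<open>Z\<close>, \<open>M\<close> would be a chain of
  length 2 in the supremum that defines the codimension.\<close>

lemma codim_one_unique:
  assumes "codim X Y M = 1" "closedin X Y" "irreducible_in X Y" "closedin X Z" "irreducible_in X Z"
    and "closedin X M" "irreducible_in X M" "Y \<subseteq> Z" "Z \<subset> M"
  shows "Y = Z"
proof (rule ccontr)
  assume "Y \<noteq> Z"
  define W where "W = (\<lambda>k::nat. if k = 0 then Y else if k = 1 then Z else M)"
  have "W 0 = Y \<and> W 2 \<subseteq> M \<and> (\<forall>k\<le>2. closedin X (W k) \<and> irreducible_in X (W k)) \<and> (\<forall>k<2. W k \<subset> W (Suc k))"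
    using assms \<open>Y \<noteq> Z\<close> by (auto simp: W_def less_2_cases_iff)
  then have "enat 2 \<le> codim X Y M"
    unfolding codim_def by (intro Sup_upper) blast
  then show False using assms(1) by (simp add: one_enat_def)
qed

definition mat_of :: "nat \<Rightarrow> (nat \<times> nat \<Rightarrow> complex) \<Rightarrow> complex mat" where
  "mat_of N \<alpha> = Matrix.mat N N (\<lambda>(r, c). \<alpha> (Suc r, Suc c))"

lemma coord_mat_of: "v \<in> box N \<Longrightarrow> coord (mat_of N \<alpha>) v = \<alpha> v"
  by (cases v) (auto simp: coord_def mat_of_def box_def)

lemma eval_mat_of: "vars p \<subseteq> box N \<Longrightarrow> eval_mpoly p (mat_of N \<alpha>) = ev \<alpha> p"
  unfolding eval_mpoly_ev by (rule ev_cong) (use coord_mat_of in blast)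

text \<open>The positions at which matrices of the nilradical \<open>m_space N \<tau>\<close> may be
  nonzero.\<close>

definition free_pos :: "nat \<Rightarrow> nat set \<Rightarrow> (nat \<times> nat) set" where
  "free_pos N \<tau> = pos_of_root ` (pos_roots N - pos_roots_of N \<tau>)"

lemma free_pos_iff: "(a, b) \<in> free_pos N \<tau> \<longleftrightarrow> 1 \<le> a \<and> a < b \<and> b \<le> N \<and> \<not> {a..<b} \<subseteq> \<tau>"
proof -
  have "(a, b) \<in> free_pos N \<tau> \<longleftrightarrow> (\<exists>c. b = Suc c \<and> (a, c) \<in> pos_roots N - pos_roots_of N \<tau>)"
    by (force simp: free_pos_def pos_of_root_def)
  also have "\<dots> \<longleftrightarrow> 1 \<le> a \<and> a < b \<and> b \<le> N \<and> \<not> {a..<b} \<subseteq> \<tau>"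
    by (cases b) (auto simp: pos_roots_def pos_roots_of_def atLeastLessThanSuc_atLeastAtMost)
  finally show ?thesis .
qed

lemma all_pos_iff: "(a, b) \<in> pos_of_root ` pos_roots N \<longleftrightarrow> 1 \<le> a \<and> a < b \<and> b \<le> N"
  by (cases b) (force simp: pos_of_root_def pos_roots_def)+

lemma free_pos_subset: "free_pos N \<tau> \<subseteq> pos_of_root ` pos_roots N"
  by (auto simp: free_pos_def)

lemma free_pos_box: "free_pos N \<tau> \<subseteq> box N"
  by (auto simp: free_pos_iff box_def)

lemma all_pos_box: "pos_of_root ` pos_roots N \<subseteq> box N"
proof
  fix v assume "v \<in> pos_of_root ` pos_roots N"
  then show "v \<in> box N" by (cases v) (auto simp only: all_pos_iff box_def mem_Sigma_iff atLeastAtMost_iff)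
qed

lemma m_space_iff:
  "A \<in> m_space N \<tau> \<longleftrightarrow> A \<in> carrier_mat N N \<and> (\<forall>v\<in>box N - free_pos N \<tau>. coord A v = 0)"
proof -
  have root: "(\<forall>\<beta>\<in>pos_roots_of N \<tau>. coord A (pos_of_root \<beta>) = 0) \<longleftrightarrow>
      (\<forall>a b. 1 \<le> a \<and> a < b \<and> b \<le> N \<and> {a..<b} \<subseteq> \<tau> \<longrightarrow> coord A (a, b) = 0)" (is "?l \<longleftrightarrow> ?r")
  proof
    assume l: ?l
    show ?r
    proof (intro allI impI)
      fix a b assume ab: "1 \<le> a \<and> a < b \<and> b \<le> N \<and> {a..<b} \<subseteq> \<tau>"
      then have "(a, b - 1) \<in> pos_roots_of N \<tau>"
        by (cases b) (auto simp: pos_roots_of_def pos_roots_def atLeastLessThanSuc_atLeastAtMost)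
      then show "coord A (a, b) = 0" using l ab by (force simp: pos_of_root_def)
    qed
  next
    assume ?r
    then show ?l by (auto simp: pos_roots_of_def pos_roots_def pos_of_root_def atLeastLessThanSuc_atLeastAtMost)
  qed
  have up: "(\<forall>r<N. \<forall>c<N. c \<le> r \<longrightarrow> A $$ (r, c) = 0) \<longleftrightarrow>
      (\<forall>a b. 1 \<le> b \<and> b \<le> a \<and> a \<le> N \<longrightarrow> coord A (a, b) = 0)" (is "?l \<longleftrightarrow> ?r")
  proof
    assume ?l then show ?r by (auto simp: coord_def)
  next
    assume r: ?r
    show ?l using r[rule_format, of "Suc _" "Suc _"] by (auto simp: coord_def)
  qed
  show ?thesis
    unfolding m_space_def strict_upper_def root up mem_Collect_eq
    by (auto simp: box_def free_pos_iff) (metis One_nat_def not_less)+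
qed

lemma mat_of_m_space: "mat_of N (\<lambda>v. if v \<in> free_pos N \<tau> then \<alpha> v else 0) \<in> m_space N \<tau>"
  by (auto simp: m_space_iff coord_mat_of) (simp add: mat_of_def)

lemma eval_restrict_m_space:
  assumes "A \<in> m_space N \<tau>" "vars p \<subseteq> box N"
  shows "eval_mpoly (restrict_vars (free_pos N \<tau>) p) A = eval_mpoly p A"
  unfolding eval_mpoly_ev ev_restrict_vars
  by (rule ev_cong) (use assms in \<open>auto simp: m_space_iff\<close>)

definition hypersurface :: "nat \<Rightarrow> nat set \<Rightarrow> mpoly \<Rightarrow> complex mat set" where
  "hypersurface N \<tau> f = {A \<in> m_space N \<tau>. eval_mpoly f A = 0}"

lemma vanish_m_space:
  assumes "vars p \<subseteq> box N"
  shows "(\<forall>A\<in>m_space N \<tau>. eval_mpoly p A = 0) \<longleftrightarrow> restrict_vars (free_pos N \<tau>) p = 0"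
proof
  assume v: "\<forall>A\<in>m_space N \<tau>. eval_mpoly p A = 0"
  show "restrict_vars (free_pos N \<tau>) p = 0"
  proof (rule ev_all_zero)
    fix \<alpha>
    show "ev \<alpha> (restrict_vars (free_pos N \<tau>) p) = 0"
      unfolding ev_restrict_vars using v mat_of_m_space eval_mat_of[OF assms] by metis
  qed
next
  assume "restrict_vars (free_pos N \<tau>) p = 0"
  then show "\<forall>A\<in>m_space N \<tau>. eval_mpoly p A = 0"
    using eval_restrict_m_space[OF _ assms] by (metis ev.subst_zero eval_mpoly_ev)
qed

text \<open>A zero of \<open>f\<close> may be changed to 0 outside the free positions, which gives a
  matrix on the hypersurface; so the restricted polynomial vanishes on all zeros of \<open>f\<close>
  and \<open>prime_multilinear_vanishing\<close> applies.\<close>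

lemma vanish_hypersurface:
  assumes f: "multilinear f" "prime_elem f" "vars f \<subseteq> free_pos N \<tau>" and p: "vars p \<subseteq> box N"
  shows "(\<forall>A\<in>hypersurface N \<tau> f. eval_mpoly p A = 0) \<longleftrightarrow> f dvd restrict_vars (free_pos N \<tau>) p"
proof
  assume v: "\<forall>A\<in>hypersurface N \<tau> f. eval_mpoly p A = 0"
  show "f dvd restrict_vars (free_pos N \<tau>) p"
  proof (rule prime_multilinear_vanishing[OF f(1,2)])
    fix \<alpha> assume a: "ev \<alpha> f = 0"
    let ?\<beta> = "\<lambda>v. if v \<in> free_pos N \<tau> then \<alpha> v else 0"
    have "ev ?\<beta> f = ev \<alpha> f" by (rule ev_cong) (use f(3) in auto)
    then have "mat_of N ?\<beta> \<in> hypersurface N \<tau> f"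
      using a f(3) free_pos_box[of N \<tau>] mat_of_m_space by (simp add: hypersurface_def eval_mat_of)
    then show "ev \<alpha> (restrict_vars (free_pos N \<tau>) p) = 0"
      unfolding ev_restrict_vars using v eval_mat_of[OF p] by metis
  qed
next
  assume "f dvd restrict_vars (free_pos N \<tau>) p"
  then obtain q where q: "restrict_vars (free_pos N \<tau>) p = f * q" unfolding dvd_def by blast
  show "\<forall>A\<in>hypersurface N \<tau> f. eval_mpoly p A = 0"
  proof
    fix A assume "A \<in> hypersurface N \<tau> f"
    then have A: "A \<in> m_space N \<tau>" "eval_mpoly f A = 0" by (auto simp: hypersurface_def)
    show "eval_mpoly p A = 0"
      using eval_restrict_m_space[OF A(1) p] A(2) unfolding q by (simp add: eval_mpoly_ev ev.subst_mult)
  qed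
qed

lemma vars_mult_box: "vars p \<subseteq> B \<Longrightarrow> vars q \<subseteq> B \<Longrightarrow> vars (p * q) \<subseteq> B"
  using vars_mult[of p q] by blast

lemma irreducible_m_space: "irreducible_in (zariski N) (m_space N \<tau>)"
proof (rule irreducible_zariskiI)
  show "m_space N \<tau> \<subseteq> carrier_mat N N" by (auto simp: m_space_iff)
  show "m_space N \<tau> \<noteq> {}" using mat_of_m_space by blast
  fix p q assume pq: "vars p \<subseteq> box N" "vars q \<subseteq> box N" "\<And>A. A \<in> m_space N \<tau> \<Longrightarrow> eval_mpoly (p * q) A = 0"
  have "restrict_vars (free_pos N \<tau>) (p * q) = 0"
    using vanish_m_space[of "p * q" N \<tau>] vars_mult_box pq by blast
  then show "(\<forall>A\<in>m_space N \<tau>. eval_mpoly p A = 0) \<or> (\<forall>A\<in>m_space N \<tau>. eval_mpoly q A = 0)"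
    unfolding vanish_m_space[OF pq(1)] vanish_m_space[OF pq(2)] by (simp add: restrict_vars.hom_mult)
qed

lemma closedin_m_space: "closedin (zariski N) (m_space N \<tau>)"
proof -
  have "closedin (zariski N) {A \<in> carrier_mat N N. \<forall>p\<in>var ` (box N - free_pos N \<tau>). eval_mpoly p A = 0}"
    by (rule closedin_zariski_zeros) auto
  then show ?thesis
    by (rule back_subst[of "closedin (zariski N)"]) (auto simp: m_space_iff eval_mpoly_ev)
qed

lemma hypersurface_props:
  assumes f: "multilinear f" "prime_elem f" "vars f \<subseteq> free_pos N \<tau>"
  shows "irreducible_in (zariski N) (hypersurface N \<tau> f)" "closedin (zariski N) (hypersurface N \<tau> f)"
    "hypersurface N \<tau> f \<subset> m_space N \<tau>"
proof -
  have fb: "vars f \<subseteq> box N" using f(3) free_pos_box by blast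
  show "irreducible_in (zariski N) (hypersurface N \<tau> f)"
  proof (rule irreducible_zariskiI)
    show "hypersurface N \<tau> f \<subseteq> carrier_mat N N" by (auto simp: hypersurface_def m_space_iff)
    show "hypersurface N \<tau> f \<noteq> {}"
    proof
      assume "hypersurface N \<tau> f = {}"
      then have "f dvd restrict_vars (free_pos N \<tau>) 1"
        using vanish_hypersurface[OF f, of 1] by simp
      then show False using f(2) by (simp add: prime_elem_def)
    qed
    fix p q assume pq: "vars p \<subseteq> box N" "vars q \<subseteq> box N"
      "\<And>A. A \<in> hypersurface N \<tau> f \<Longrightarrow> eval_mpoly (p * q) A = 0"
    have "f dvd restrict_vars (free_pos N \<tau>) (p * q)"
      using vanish_hypersurface[OF f, of "p * q"] vars_mult_box pq by blast
    then show "(\<forall>A\<in>hypersurface N \<tau> f. eval_mpoly p A = 0) \<or> (\<forall>A\<in>hypersurface N \<tau> f. eval_mpoly q A = 0)"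
      unfolding vanish_hypersurface[OF f pq(1)] vanish_hypersurface[OF f pq(2)]
      using f(2) by (simp add: restrict_vars.hom_mult prime_elem_dvd_mult_iff)
  qed
  have "closedin (zariski N) {A \<in> carrier_mat N N. \<forall>p\<in>{f}. eval_mpoly p A = 0}"
    by (rule closedin_zariski_zeros) (use fb in auto)
  moreover have "hypersurface N \<tau> f = m_space N \<tau> \<inter> {A \<in> carrier_mat N N. \<forall>p\<in>{f}. eval_mpoly p A = 0}"
    by (auto simp: hypersurface_def m_space_iff)
  ultimately show "closedin (zariski N) (hypersurface N \<tau> f)"
    using closedin_m_space by (simp add: closedin_Int)
  have "hypersurface N \<tau> f \<noteq> m_space N \<tau>"
  proof
    assume "hypersurface N \<tau> f = m_space N \<tau>"
    then have "restrict_vars (free_pos N \<tau>) f = 0"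
      using vanish_m_space[OF fb, of \<tau>] unfolding hypersurface_def by blast
    then show False using f(2,3) by (simp add: restrict_vars_id prime_elem_def)
  qed
  then show "hypersurface N \<tau> f \<subset> m_space N \<tau>" by (auto simp: hypersurface_def)
qed

section \<open>The non-linear generator and the coordinate ring\<close>

lemma S_ring_simps [simp]:
  "p \<in> carrier (S_ring N) \<longleftrightarrow> vars p \<subseteq> pos_of_root ` pos_roots N"
  "monoid.mult (S_ring N) = (*)" "monoid.one (S_ring N) = 1" "ring.zero (S_ring N) = 0" "ring.add (S_ring N) = (+)"
  by (simp_all add: S_ring_def)

lemma vars_add_box: "vars p \<subseteq> B \<Longrightarrow> vars q \<subseteq> B \<Longrightarrow> vars (p + q) \<subseteq> B"
  using vars_add[of p q] by blast

lemma cring_S_ring: "cring (S_ring N)"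
proof (rule cringI)
  show "abelian_group (S_ring N)"
  proof (rule abelian_groupI)
    fix x assume "x \<in> carrier (S_ring N)"
    then show "\<exists>y\<in>carrier (S_ring N). y \<oplus>\<^bsub>S_ring N\<^esub> x = \<zero>\<^bsub>S_ring N\<^esub>"
      by (intro bexI[of _ "- x"]) simp_all
  qed (simp_all add: vars_add_box add_ac)
  show "comm_monoid (S_ring N)"
    by (rule comm_monoidI) (simp_all add: vars_mult_box mult_ac)
qed (simp add: distrib_right)

lemma S_idealI:
  assumes "J \<subseteq> carrier (S_ring N)" "0 \<in> J" "\<And>a b. a \<in> J \<Longrightarrow> b \<in> J \<Longrightarrow> a + b \<in> J"
    and mult: "\<And>a x. a \<in> J \<Longrightarrow> vars x \<subseteq> pos_of_root ` pos_roots N \<Longrightarrow> x * a \<in> J"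
  shows "ideal J (S_ring N)"
proof -
  interpret cring "S_ring N" by (rule cring_S_ring)
  show ?thesis
  proof (rule idealI)
    show "subgroup J (add_monoid (S_ring N))"
    proof (rule group.subgroupI)
      show "Group.group (add_monoid (S_ring N))" by (rule a_group)
      fix a assume a: "a \<in> J"
      then have "vars a \<subseteq> pos_of_root ` pos_roots N" using assms(1) by (metis S_ring_simps(1) subsetD)
      then have "\<ominus>\<^bsub>S_ring N\<^esub> a = - a"
        by (intro minus_equality) simp_all
      moreover have "(- 1) * a \<in> J" by (rule mult[OF a]) simp
      ultimately show "inv\<^bsub>add_monoid (S_ring N)\<^esub> a \<in> J" by (simp add: a_inv_def)
    qed (use assms in auto)
    fix a x assume "a \<in> J" "x \<in> carrier (S_ring N)"
    then show "x \<otimes>\<^bsub>S_ring N\<^esub> a \<in> J" "a \<otimes>\<^bsub>S_ring N\<^esub> x \<in> J"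
      using mult[of a x] by (simp_all add: mult.commute)
  qed (rule ring_axioms)
qed

lemma S_ideal_closed:
  assumes "ideal J (S_ring N)"
  shows "0 \<in> J" "a \<in> J \<Longrightarrow> b \<in> J \<Longrightarrow> a + b \<in> J"
    "a \<in> J \<Longrightarrow> vars x \<subseteq> pos_of_root ` pos_roots N \<Longrightarrow> x * a \<in> J"
proof -
  interpret ideal J "S_ring N" by fact
  show "0 \<in> J" using additive_subgroup.zero_closed[OF additive_subgroup_axioms] by simp
  show "a \<in> J \<Longrightarrow> b \<in> J \<Longrightarrow> a + b \<in> J" using additive_subgroup.a_closed[OF additive_subgroup_axioms] by simp
  show "a \<in> J \<Longrightarrow> vars x \<subseteq> pos_of_root ` pos_roots N \<Longrightarrow> x * a \<in> J" using I_l_closed[of a x] by simp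
qed

definition tau_vars :: "nat \<Rightarrow> nat set \<Rightarrow> mpoly set" where
  "tau_vars N \<tau> = (\<lambda>\<beta>. var (pos_of_root \<beta>)) ` pos_roots_of N \<tau>"

lemma tau_vars_eq: "tau_vars N \<tau> = var ` (pos_of_root ` pos_roots N - free_pos N \<tau>)"
proof -
  have "pos_of_root ` pos_roots N - free_pos N \<tau> = pos_of_root ` pos_roots_of N \<tau>"
    unfolding free_pos_def by (auto simp: pos_roots_of_def pos_of_root_def)
  then show ?thesis by (simp add: tau_vars_def image_image)
qed

text \<open>Monomial by monomial: one that contains a variable outside the free positions lies in
  the ideal and restricts to 0, any other one is unchanged by the restriction.\<close>

lemma minus_restrict_in_ideal:
  assumes J: "ideal J (S_ring N)" "tau_vars N \<tau> \<subseteq> J" and p: "vars p \<subseteq> pos_of_root ` pos_roots N"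
  shows "p - restrict_vars (free_pos N \<tau>) p \<in> J"
proof -
  let ?Y = "pos_of_root ` pos_roots N" and ?r = "restrict_vars (free_pos N \<tau>)"
  have mon: "mon_val var m - ?r (mon_val var m) \<in> J" if m: "m \<in> Poly_Mapping.keys p" for m
  proof (cases "Poly_Mapping.keys m \<subseteq> free_pos N \<tau>")
    case True
    have "vars (mon_val var m) \<subseteq> free_pos N \<tau>"
      unfolding mon_val_var using True by (simp add: vars_def)
    then show ?thesis using S_ideal_closed(1)[OF J(1)] by (simp add: restrict_vars_id)
  next
    case False
    then obtain v where v: "v \<in> Poly_Mapping.keys m" "v \<notin> free_pos N \<tau>" by auto
    have vY: "v \<in> ?Y" using v m p by (auto simp: vars_def)
    have "var v dvd var v ^ Poly_Mapping.lookup m v" using v by (simp add: in_keys_iff)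
    also have "\<dots> dvd mon_val var m" unfolding mon_val_def by (rule dvd_prodI) (use v in auto)
    finally obtain q where q: "mon_val var m = var v * q" unfolding dvd_def by blast
    have "mon_val var m \<noteq> 0" by (metis mon_val_var lookup_single_eq lookup_zero zero_neq_one)
    then have "q \<noteq> 0" using q by auto
    have "vars q \<subseteq> vars (mon_val var m)" using vars_mult_eq[OF var_neq_zero \<open>q \<noteq> 0\<close>, of v] q by (metis Un_upper2)
    also have "\<dots> \<subseteq> ?Y" unfolding mon_val_var using m p by (auto simp: vars_def)
    finally have qY: "vars q \<subseteq> ?Y" .
    have "var v \<in> J" using J(2) vY v(2) by (auto simp: tau_vars_eq)
    then have "q * var v \<in> J" by (rule S_ideal_closed(3)[OF J(1) _ qY])
    moreover have "?r (mon_val var m) = 0"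
      unfolding q by (simp add: restrict_vars.hom_mult restrict_vars_var v(2))
    ultimately show ?thesis by (simp add: q mult.commute)
  qed
  have "p - ?r p = (\<Sum>m\<in>Poly_Mapping.keys p. const (Poly_Mapping.lookup p m) * (mon_val var m - ?r (mon_val var m)))"
  proof -
    have e: "p = (\<Sum>m\<in>Poly_Mapping.keys p. const (Poly_Mapping.lookup p m) * mon_val var m)"
      using mpoly_expand[of p] by (simp add: poly_subst_def)
    have "?r p = (\<Sum>m\<in>Poly_Mapping.keys p. const (Poly_Mapping.lookup p m) * ?r (mon_val var m))"
      using arg_cong[OF e, of ?r] by (simp only: restrict_vars.hom_sum restrict_vars.hom_mult restrict_vars_const)
    then show ?thesis
      using e by (simp only: right_diff_distrib sum_subtractf)
  qed
  also have "\<dots> \<in> J"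
  proof -
    have "(\<Sum>m\<in>M. const (Poly_Mapping.lookup p m) * (mon_val var m - ?r (mon_val var m))) \<in> J"
      if "M \<subseteq> Poly_Mapping.keys p" "finite M" for M
      using that(2,1)
    proof (induction M)
      case empty
      then show ?case using S_ideal_closed(1)[OF J(1)] by simp
    next
      case (insert m M)
      then show ?case
        using S_ideal_closed(2)[OF J(1)] S_ideal_closed(3)[OF J(1) mon] by simp
    qed
    then show ?thesis by simp
  qed
  finally show ?thesis .
qed

lemma ideal_dvd_restrict: "ideal {p \<in> carrier (S_ring N). f dvd restrict_vars X p} (S_ring N)"
  by (rule S_idealI) (auto simp: restrict_vars.hom_add restrict_vars.hom_mult vars_add_box vars_mult_box)

text \<open>Modulo the linear generators a polynomial equals its restriction to the free positions,
  so membership becomes divisibility by \<open>f\<close> there.\<close>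

lemma Idl_hypersurface:
  assumes f: "vars f \<subseteq> free_pos N \<tau>"
  shows "Idl\<^bsub>S_ring N\<^esub> (insert f (tau_vars N \<tau>)) =
    {p \<in> carrier (S_ring N). f dvd restrict_vars (free_pos N \<tau>) p}" (is "?L = ?R")
proof
  interpret cring "S_ring N" by (rule cring_S_ring)
  have "tau_vars N \<tau> \<subseteq> ?R"
    by (auto simp: tau_vars_eq restrict_vars_var)
  moreover have "f \<in> ?R" using f free_pos_subset[of N \<tau>] by (simp add: restrict_vars_id)
  ultimately show "?L \<subseteq> ?R" by (intro genideal_minimal ideal_dvd_restrict) auto
  show "?R \<subseteq> ?L"
  proof
    fix p assume "p \<in> ?R"
    then have p: "vars p \<subseteq> pos_of_root ` pos_roots N" and dvd: "f dvd restrict_vars (free_pos N \<tau>) p" by auto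
    obtain q where q: "restrict_vars (free_pos N \<tau>) p = f * q" using dvd unfolding dvd_def by blast
    have "restrict_vars (free_pos N \<tau>) p = restrict_vars (free_pos N \<tau>) (f * q)"
      using restrict_vars_id[OF vars_restrict_vars, of "free_pos N \<tau>" p] q by simp
    then have q': "restrict_vars (free_pos N \<tau>) p = f * restrict_vars (free_pos N \<tau>) q"
      using f by (simp add: restrict_vars.hom_mult restrict_vars_id)
    have "p \<in> J" if J: "ideal J (S_ring N)" "insert f (tau_vars N \<tau>) \<subseteq> J" for J
    proof -
      have "p - restrict_vars (free_pos N \<tau>) p \<in> J"
        by (rule minus_restrict_in_ideal[OF J(1) _ p]) (use J(2) in auto)
      moreover have "restrict_vars (free_pos N \<tau>) q * f \<in> J"
        using S_ideal_closed(3)[OF J(1), of f] J(2) order.trans[OF vars_restrict_vars free_pos_subset] by simp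
      ultimately have "(p - restrict_vars (free_pos N \<tau>) p) + restrict_vars (free_pos N \<tau>) q * f \<in> J"
        by (rule S_ideal_closed(2)[OF J(1)])
      then show ?thesis using q' by (simp add: mult.commute)
    qed
    then show "p \<in> ?L" unfolding genideal_def by blast
  qed
qed

text \<open>Primality is known in the ring of all polynomials. It descends to
  \<open>S_ring N\<close>, because a nonzero product contains all variables of its factors and so
  cofactors stay in the subring.\<close>

lemma ring_irreducible_S_ring:
  assumes f: "prime_elem f" "vars f \<subseteq> pos_of_root ` pos_roots N"
  shows "ring_irreducible\<^bsub>S_ring N\<^esub> f"
  unfolding ring_irreducible_def Divisibility.irreducible_def
proof (intro conjI ballI impI)
  show "f \<noteq> \<zero>\<^bsub>S_ring N\<^esub>" using f by (simp add: prime_elem_def)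
  show "f \<notin> Units (S_ring N)"
  proof
    assume "f \<in> Units (S_ring N)"
    then obtain g where "f * g = 1" by (auto simp: Units_def)
    then have "f dvd 1" by (metis dvd_triv_left)
    then show False using f by (simp add: prime_elem_def)
  qed
  fix b assume b: "b \<in> carrier (S_ring N)" "properfactor (S_ring N) b f"
  then obtain c where c: "f = b * c" "vars c \<subseteq> pos_of_root ` pos_roots N"
    and nd: "\<And>e. vars e \<subseteq> pos_of_root ` pos_roots N \<Longrightarrow> b \<noteq> f * e"
    by (auto simp: properfactor_def factor_def)
  have nz: "f \<noteq> 0" "b \<noteq> 0" "c \<noteq> 0" using f c by (auto simp: prime_elem_def)
  have "f dvd b * c" using c by simp
  then consider "f dvd b" | "f dvd c" using f(1) by (auto simp: prime_elem_dvd_mult_iff)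
  then show "b \<in> Units (S_ring N)"
  proof cases
    case 1
    then obtain e where e: "b = f * e" unfolding dvd_def by blast
    then have "e \<noteq> 0" using nz by auto
    then have "vars e \<subseteq> vars b" using vars_mult_eq[OF nz(1), of e] e by auto
    then show ?thesis using nd[of e] e b(1) by auto
  next
    case 2
    then obtain e where e: "c = f * e" unfolding dvd_def by blast
    then have "f * (b * e) = f * 1" using c(1) by (simp add: mult_ac)
    then have be: "b * e = 1" using nz by simp
    have "e \<noteq> 0" using e nz by auto
    then have "vars e \<subseteq> vars c" using vars_mult_eq[OF nz(1), of e] e by auto
    then show ?thesis
      using be b(1) c(2) by (auto simp: Units_def mult.commute intro!: bexI[of _ e])
  qed
qed

text \<open>For the second part: equal ideals make \<open>f\<close> and \<open>g\<close> divide each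
  other, since both are unchanged by restriction; hence they have the same variables, and the sigma
  set depends on nothing else.\<close>

lemma nonlinear_generator_hypersurface:
  assumes f: "multilinear f" "prime_elem f" "vars f \<subseteq> free_pos N (tau N V)"
    and cl: "zariski N closure_of V = hypersurface N (tau N V) f"
  shows "homogeneous d f \<Longrightarrow> 2 \<le> d \<Longrightarrow> nonlinear_generator N V f"
    and "nonlinear_generator N V g \<Longrightarrow> vars g = vars f"
proof -
  let ?X = "free_pos N (tau N V)"
  have van: "vanishing_ideal N (zariski N closure_of V) = Idl\<^bsub>S_ring N\<^esub> (insert f (tau_vars N (tau N V)))"
    unfolding vanishing_ideal_def cl Idl_hypersurface[OF f(3)]
    using vanish_hypersurface[OF f] all_pos_box by (intro Collect_cong conj_cong refl) (auto, blast+)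
  have fX: "vars f \<subseteq> pos_of_root ` pos_roots N" using f(3) free_pos_subset by blast
  show "nonlinear_generator N V f" if "homogeneous d f" "2 \<le> d"
    unfolding nonlinear_generator_def using that f(3) van ring_irreducible_S_ring[OF f(2) fX]
    by (auto simp: free_pos_def tau_vars_def)
  assume g: "nonlinear_generator N V g"
  then have gX: "vars g \<subseteq> ?X" and gv: "vanishing_ideal N (zariski N closure_of V) = Idl\<^bsub>S_ring N\<^esub> (insert g (tau_vars N (tau N V)))"
    by (auto simp: nonlinear_generator_def free_pos_def tau_vars_def)
  have eq: "{p \<in> carrier (S_ring N). f dvd restrict_vars ?X p} = {p \<in> carrier (S_ring N). g dvd restrict_vars ?X p}"
    using van gv Idl_hypersurface[OF f(3)] Idl_hypersurface[OF gX] by simp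
  have "g \<in> {p \<in> carrier (S_ring N). g dvd restrict_vars ?X p}" "f \<in> {p \<in> carrier (S_ring N). f dvd restrict_vars ?X p}"
    using gX f(3) fX free_pos_subset[of N "tau N V"] by (auto simp: restrict_vars_id)
  then have "f dvd restrict_vars ?X g" "g dvd restrict_vars ?X f" using eq by blast+
  then have d: "f dvd g" "g dvd f" using gX f(3) by (simp_all add: restrict_vars_id)
  have sub: "vars a \<subseteq> vars b" if "a dvd b" "b \<noteq> 0" for a b
  proof -
    obtain c where c: "b = a * c" using \<open>a dvd b\<close> unfolding dvd_def by blast
    then have "a \<noteq> 0" "c \<noteq> 0" using that by auto
    then show ?thesis using vars_mult_eq[of a c] c by auto
  qed
  have "f \<noteq> 0" using f(2) by (simp add: prime_elem_def)
  moreover from this have "g \<noteq> 0" using d(2) by auto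
  ultimately show "vars g = vars f" using sub d by blast
qed

section \<open>The smallest connected set of simple roots\<close>

definition unit_mat :: "nat \<Rightarrow> nat \<Rightarrow> nat \<Rightarrow> complex mat" where
  "unit_mat N a b = Matrix.mat N N (\<lambda>(r, c). if r = a \<and> c = b then 1 else 0)"

lemma unit_mat_carrier [simp]: "unit_mat N a b \<in> carrier_mat N N"
  by (simp add: unit_mat_def)

lemma unit_mat_mult:
  assumes "b < N"
  shows "unit_mat N a b * unit_mat N c d = (if b = c then unit_mat N a d else 0\<^sub>m N N)"
proof (rule eq_matI)
  fix r s assume "r < dim_row (if b = c then unit_mat N a d else 0\<^sub>m N N)" "s < dim_col (if b = c then unit_mat N a d else 0\<^sub>m N N)"
  then have rs: "r < N" "s < N" by (auto simp: unit_mat_def split: if_splits)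
  then have "(unit_mat N a b * unit_mat N c d) $$ (r, s) =
      (\<Sum>k = 0..<N. (if r = a \<and> k = b then 1 else 0) * (if k = c \<and> s = d then 1 else 0))"
    by (simp add: unit_mat_def scalar_prod_def)
  also have "\<dots> = (\<Sum>k = 0..<N. if k = b then (if r = a \<and> b = c \<and> s = d then 1 else 0) else 0)"
    by (rule sum.cong) auto
  also have "\<dots> = (if r = a \<and> b = c \<and> s = d then 1 else 0)"
    using assms by simp
  finally show "(unit_mat N a b * unit_mat N c d) $$ (r, s) = (if b = c then unit_mat N a d else 0\<^sub>m N N) $$ (r, s)"
    using rs by (auto simp: unit_mat_def)
qed (simp_all add: unit_mat_def)

lemma root_vec_unit_mat: "1 \<le> u \<Longrightarrow> root_vec N (u, v) = unit_mat N (u - 1) v"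
  by (rule eq_matI) (auto simp: root_vec_def unit_mat_def pos_of_root_def)

lemma n_sub_support:
  assumes "A \<in> n_sub N {a..b}" "1 \<le> a"
  shows "A \<in> carrier_mat N N \<and> (\<forall>r<N. \<forall>c<N. A $$ (r, c) \<noteq> 0 \<longrightarrow> a \<le> Suc r \<and> r < c \<and> c \<le> b)"
  using assms(1)
proof induction
  case (gen k)
  then show ?case using assms(2) by (auto simp: root_vec_def pos_of_root_def)
next
  case (add A B)
  show ?case
  proof (intro conjI allI impI)
    show "A + B \<in> carrier_mat N N" using add.IH by auto
    fix r c assume rc: "r < N" "c < N" "(A + B) $$ (r, c) \<noteq> 0"
    have AB: "A \<in> carrier_mat N N" "B \<in> carrier_mat N N" using add.IH by blast+
    have "A $$ (r, c) \<noteq> 0 \<or> B $$ (r, c) \<noteq> 0" using AB rc by auto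
    then have "a \<le> Suc r \<and> r < c \<and> c \<le> b" using add.IH rc by blast
    then show "a \<le> Suc r" "r < c" "c \<le> b" by auto
  qed
next
  case (bracket A B)
  then have AB: "A \<in> carrier_mat N N" "B \<in> carrier_mat N N" by blast+
  have prod: "a \<le> Suc r \<and> r < c \<and> c \<le> b"
    if "X \<in> carrier_mat N N" "Y \<in> carrier_mat N N" "r < N" "c < N" and nz: "(X * Y) $$ (r, c) \<noteq> (0 :: complex)" and
      sX: "\<forall>r<N. \<forall>c<N. X $$ (r, c) \<noteq> 0 \<longrightarrow> a \<le> Suc r \<and> r < c \<and> c \<le> b"
      and sY: "\<forall>r<N. \<forall>c<N. Y $$ (r, c) \<noteq> 0 \<longrightarrow> a \<le> Suc r \<and> r < c \<and> c \<le> b" for X Y r c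
  proof -
    have "(X * Y) $$ (r, c) = (\<Sum>k = 0..<N. X $$ (r, k) * Y $$ (k, c))"
      using that(1-4) by (simp add: scalar_prod_def)
    then obtain k where "k < N" "X $$ (r, k) * Y $$ (k, c) \<noteq> 0"
      using nz by (metis (no_types, lifting) atLeastLessThan_iff sum.not_neutral_contains_not_neutral)
    then have "a \<le> Suc r \<and> r < k" "k < c \<and> c \<le> b"
      using sX[rule_format, of r k] sY[rule_format, of k c] \<open>r < N\<close> \<open>c < N\<close> by auto
    then show ?thesis by simp
  qed
  show ?case
  proof (intro conjI allI impI)
    show "A * B - B * A \<in> carrier_mat N N" using AB by auto
    fix r c assume rc: "r < N" "c < N" "(A * B - B * A) $$ (r, c) \<noteq> 0"
    then have "(A * B) $$ (r, c) \<noteq> 0 \<or> (B * A) $$ (r, c) \<noteq> 0" using AB by auto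
    then have "a \<le> Suc r \<and> r < c \<and> c \<le> b" using prod[of A B r c] prod[of B A r c] bracket rc by blast
    then show "a \<le> Suc r" "r < c" "c \<le> b" by auto
  qed
qed auto

text \<open>Induction on the height of the root: the bracket of the root vectors for
  \<open>(u, k)\<close> and the simple root \<open>k + 1\<close> is the root vector for
  \<open>(u, k + 1)\<close>.\<close>

lemma root_vec_n_sub:
  assumes "1 \<le> a" "b < N" "a \<le> u" "u \<le> v" "v \<le> b"
  shows "root_vec N (u, v) \<in> n_sub N {a..b}"
  using assms(4,5)
proof (induction v rule: dec_induct)
  case base
  then show ?case using assms by (intro n_sub.gen) auto
next
  case (step k)
  have 1: "root_vec N (u, k) \<in> n_sub N {a..b}" using step by simp
  have 2: "root_vec N (Suc k, Suc k) \<in> n_sub N {a..b}" using step assms by (intro n_sub.gen) auto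
  have ne: "Suc k \<noteq> u - 1" using step by simp
  have "root_vec N (u, k) * root_vec N (Suc k, Suc k) - root_vec N (Suc k, Suc k) * root_vec N (u, k) =
      root_vec N (u, Suc k)"
    using ne step assms by (simp add: root_vec_unit_mat unit_mat_mult) (rule eq_matI, auto simp: unit_mat_def)
  then show ?case using n_sub.bracket[OF 1 2] by simp
qed

definition pos_triangle :: "nat \<Rightarrow> nat \<Rightarrow> (nat \<times> nat) set" where
  "pos_triangle a b = {(u, w). a \<le> u \<and> u < w \<and> w \<le> b}"

lemma finite_pos_roots [simp]: "finite (pos_roots N)"
  by (rule finite_subset[of _ "{..N} \<times> {..N}"]) (auto simp: pos_roots_def)

text \<open>For an interval the subalgebra contains the root vector of every position in the
  triangle and is supported there, so membership of a polynomial becomes a condition on its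
  variables alone.\<close>

lemma sym_alg_iff:
  assumes "1 \<le> a" "a \<le> b" "b < N"
  shows "p \<in> sym_alg N (n_sub N {a..b}) \<longleftrightarrow> vars p \<subseteq> pos_triangle a (Suc b)"
proof
  assume "p \<in> sym_alg N (n_sub N {a..b})"
  then show "vars p \<subseteq> pos_triangle a (Suc b)"
  proof induction
    case (linear A)
    note sup = n_sub_support[OF linear assms(1)]
    have "vars (const (coord A (pos_of_root \<beta>)) * var (pos_of_root \<beta>)) \<subseteq> pos_triangle a (Suc b)"
      if "\<beta> \<in> pos_roots N" for \<beta>
    proof (cases "coord A (pos_of_root \<beta>) = 0")
      case False
      obtain u v where uv: "\<beta> = (u, v)" by (metis surj_pair)
      then have "A $$ (u - 1, v) \<noteq> 0" "1 \<le> u" "u \<le> v" "v < N"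
        using False that by (auto simp: coord_def pos_of_root_def pos_roots_def)
      then have "a \<le> u \<and> v \<le> b" using sup[THEN conjunct2, rule_format, of "u - 1" v] by simp
      then have "vars (var (pos_of_root \<beta>)) \<subseteq> pos_triangle a (Suc b)"
        using uv \<open>u \<le> v\<close> by (simp add: pos_triangle_def pos_of_root_def)
      then show ?thesis using vars_mult[of "const (coord A (pos_of_root \<beta>))" "var (pos_of_root \<beta>)"] by auto
    qed simp
    then show ?case unfolding linear_elem_def by (intro order.trans[OF vars_sum] UN_least) blast
  next
    case (add p q)
    then show ?case using vars_add_box by blast
  next
    case (mult p q)
    then show ?case using vars_mult_box by blast
  qed simp
next
  assume p: "vars p \<subseteq> pos_triangle a (Suc b)"
  let ?S = "sym_alg N (n_sub N {a..b})"
  have var: "var v \<in> ?S" if v: "v \<in> pos_triangle a (Suc b)" for v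
  proof -
    obtain u w where uw: "v = (u, Suc w)" "a \<le> u" "u \<le> w" "w \<le> b"
      using v by (cases v, cases "snd v") (auto simp: pos_triangle_def)
    have "linear_elem N (root_vec N (u, w)) \<in> ?S"
      using assms uw by (intro sym_alg.linear root_vec_n_sub) auto
    also have "linear_elem N (root_vec N (u, w)) = (\<Sum>\<beta>\<in>pos_roots N. if \<beta> = (u, w) then var v else 0)"
      unfolding linear_elem_def
    proof (rule sum.cong[OF refl])
      fix \<beta> assume \<beta>: "\<beta> \<in> pos_roots N"
      have "coord (root_vec N (u, w)) (pos_of_root \<beta>) = (if \<beta> = (u, w) then 1 else 0)"
        using \<beta> uw assms by (cases \<beta>) (auto simp: coord_def root_vec_def pos_of_root_def pos_roots_def)
      then show "const (coord (root_vec N (u, w)) (pos_of_root \<beta>)) * var (pos_of_root \<beta>) = (if \<beta> = (u, w) then var v else 0)"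
        using uw by (simp add: pos_of_root_def const.hom_one)
    qed
    also have "\<dots> = var v"
    proof -
      have "(u, w) \<in> pos_roots N" using uw assms by (simp add: pos_roots_def)
      then show ?thesis by simp
    qed
    finally show ?thesis .
  qed
  have one: "1 \<in> ?S" using sym_alg.const[of 1] by (simp add: const.hom_one)
  have zero: "0 \<in> ?S" using sym_alg.const[of 0] by simp
  have pow: "var v ^ k \<in> ?S" if "v \<in> pos_triangle a (Suc b)" for v k
    by (induction k) (auto simp: one var that intro: sym_alg.mult)
  have prod: "(\<Prod>v\<in>M. var v ^ f v) \<in> ?S" if "M \<subseteq> pos_triangle a (Suc b)" for M and f :: "nat \<times> nat \<Rightarrow> nat"
    using that by (induction M rule: infinite_finite_induct) (auto simp: one intro: sym_alg.mult pow)
  have sum: "(\<Sum>m\<in>M. const (Poly_Mapping.lookup p m) * mon_val var m) \<in> ?S" if "M \<subseteq> Poly_Mapping.keys p" for M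
    using that
  proof (induction M rule: infinite_finite_induct)
    case (insert m M)
    then have "Poly_Mapping.keys m \<subseteq> pos_triangle a (Suc b)" using p by (auto simp: vars_def)
    then have "mon_val var m \<in> ?S" unfolding mon_val_def by (rule prod)
    then show ?case using insert by (auto intro: sym_alg.intros)
  qed (simp_all add: zero)
  show "p \<in> ?S" using sum[OF order.refl] mpoly_expand[of p] unfolding poly_subst_def by simp
qed

lemma is_sigma_set_interval:
  assumes v: "vars f \<subseteq> pos_triangle i j" "(i, w) \<in> vars f" "(u, j) \<in> vars f" and ij: "1 \<le> i" "j \<le> N"
  shows "is_sigma_set N f \<sigma> \<longleftrightarrow> \<sigma> = {i..j - 1}"
proof -
  have lt: "i < j" using v by (auto simp: pos_triangle_def)
  have ok: "connected_roots N {i..j - 1}" "f \<in> sym_alg N (n_sub N {i..j - 1})"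
  proof -
    show "connected_roots N {i..j - 1}"
      unfolding connected_roots_def by (rule exI[of _ i], rule exI[of _ "j - 1"]) (use lt ij in auto)
    show "f \<in> sym_alg N (n_sub N {i..j - 1})"
      using lt ij v(1) by (subst sym_alg_iff) auto
  qed
  have min: "{i..j - 1} \<subseteq> \<sigma>'" if c: "connected_roots N \<sigma>'" "f \<in> sym_alg N (n_sub N \<sigma>')" for \<sigma>'
  proof -
    obtain a b where ab: "1 \<le> a" "a \<le> b" "b < N" "\<sigma>' = {a..b}"
      using c(1) by (auto simp: connected_roots_def)
    then have "vars f \<subseteq> pos_triangle a (Suc b)" using c(2) by (simp add: sym_alg_iff)
    then have "(i, w) \<in> pos_triangle a (Suc b)" "(u, j) \<in> pos_triangle a (Suc b)" using v by auto
    then show ?thesis using ab by (auto simp: pos_triangle_def)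
  qed
  show ?thesis
    using ok min unfolding is_sigma_set_def by (metis subset_antisym)
qed

section \<open>Tableaux\<close>

text \<open>Counts the entries at most \<open>k\<close> in the rows from \<open>I\<close> on, with
  rows numbered from 0. In the Jordan type given by these entries it is the total size of all but
  the \<open>I\<close> largest blocks.\<close>

definition below :: "nat list list \<Rightarrow> nat \<Rightarrow> nat \<Rightarrow> nat" where
  "below T I k = sum_list (map (\<lambda>row. length (filter (\<lambda>x. x \<le> k) row)) (drop I T))"

text \<open>In a decreasing list the zeros stand at the end, so removing them does not shift the
  other entries.\<close>

lemma filter_nonzero_sorted:
  fixes xs :: "nat list"
  assumes "sorted_wrt (\<ge>) xs"
  shows "sorted_wrt (\<ge>) (filter (\<lambda>n. n \<noteq> 0) xs)"
    "sum_list (drop I (filter (\<lambda>n. n \<noteq> 0) xs)) = sum_list (drop I xs)"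
proof -
  show "sorted_wrt (\<ge>) (filter (\<lambda>n. n \<noteq> 0) xs)"
    using assms by (rule sorted_wrt_filter)
  show "sum_list (drop I (filter (\<lambda>n. n \<noteq> 0) xs)) = sum_list (drop I xs)"
    using assms
  proof (induction xs arbitrary: I)
    case (Cons x xs)
    show ?case
    proof (cases "x = 0")
      case True
      then have z: "\<forall>y\<in>set (x # xs). y = 0" using Cons.prems by auto
      then have "filter (\<lambda>n. n \<noteq> 0) (x # xs) = []" by (simp add: filter_empty_conv)
      moreover have "sum_list (drop I (x # xs)) = 0"
        using z by (meson in_set_dropD sum_list_eq_0_iff)
      ultimately show ?thesis by (simp del: filter.simps)
    next
      case False
      then show ?thesis using Cons.IH[of 0] Cons.IH[of "I - 1"] Cons.prems by (cases I) auto
    qed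
  qed simp
qed

lemma standard_counts_sorted:
  assumes "standard_tableau N T"
  shows "sorted_wrt (\<ge>) (map (\<lambda>row. length (filter (\<lambda>x. x \<le> k) row)) T)"
proof -
  let ?c = "\<lambda>row. length (filter (\<lambda>x. x \<le> k) row)"
  have len: "length (T ! Suc a) \<le> length (T ! a)" if "Suc a < length T" for a
    using assms that unfolding standard_tableau_def partition_of_def
    by (auto simp: sorted_wrt_iff_nth_less)
  have step: "?c (T ! Suc a) \<le> ?c (T ! a)" if a: "Suc a < length T" for a
    unfolding length_filter_conv_card
  proof (rule card_mono)
    show "{i. i < length (T ! Suc a) \<and> T ! Suc a ! i \<le> k} \<subseteq> {i. i < length (T ! a) \<and> T ! a ! i \<le> k}"
    proof
      fix b assume "b \<in> {i. i < length (T ! Suc a) \<and> T ! Suc a ! i \<le> k}"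
      then have b: "b < length (T ! Suc a)" "T ! Suc a ! b \<le> k" by auto
      then have "T ! a ! b < T ! Suc a ! b" using assms a unfolding standard_tableau_def by blast
      then show "b \<in> {i. i < length (T ! a) \<and> T ! a ! i \<le> k}" using b len[OF a] by auto
    qed
  qed simp
  have "?c (T ! b) \<le> ?c (T ! a)" if "a \<le> b" "b < length T" for a b
    using that by (induction b rule: dec_induct) (auto intro: order.trans[OF step])
  then show ?thesis by (auto simp: sorted_wrt_iff_nth_less)
qed

lemma shape_upto_below:
  assumes "standard_tableau N T"
  shows "sorted_wrt (\<ge>) (shape_upto k T)" "sum_list (drop I (shape_upto k T)) = below T I k"
  unfolding shape_upto_def below_def
  using filter_nonzero_sorted[OF standard_counts_sorted[OF assms]] by (simp_all add: drop_map)

lemma below_Suc: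
  assumes T: "standard_tableau N T" and j: "1 \<le> j"
  shows "below T I j = below T I (j - 1) + length (filter (\<lambda>row. j \<in> set row) (drop I T))"
proof -
  have row: "length (filter (\<lambda>x. x \<le> j) r) = length (filter (\<lambda>x. x \<le> j - 1) r) + (if j \<in> set r then 1 else 0)"
    if "distinct r" for r
    using that
  proof (induction r)
    case (Cons a r)
    have "a \<noteq> j \<Longrightarrow> a \<le> j \<longleftrightarrow> a \<le> j - 1" using j by linarith
    then show ?case using Cons j by (cases "a = j") auto
  qed simp
  have "distinct r" if "r \<in> set T" for r
    using T that unfolding standard_tableau_def by (meson distinct_concat_iff)
  then have "\<forall>r\<in>set (drop I T). distinct r" by (meson in_set_dropD)
  moreover have "sum_list (map (\<lambda>row. length (filter (\<lambda>x. x \<le> j) row)) R) =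
      sum_list (map (\<lambda>row. length (filter (\<lambda>x. x \<le> j - 1) row)) R) + length (filter (\<lambda>row. j \<in> set row) R)"
    if "\<forall>r\<in>set R. distinct r" for R
    using that by (induction R) (auto simp: row simp del: One_nat_def)
  ultimately show ?thesis
    unfolding below_def by blast
qed

text \<open>The entry \<open>j\<close> is counted in the rows from \<open>I - 1\<close> on but not
  in the rows from \<open>I\<close> on, with rows numbered from 0; this leaves row
  \<open>I - 1\<close>.\<close>

lemma tableau_row:
  assumes T: "standard_tableau N T" and j: "1 \<le> j" and I: "1 \<le> I"
    and eq: "below T I j = below T I (j - 1)" and ne: "below T (I - 1) j \<noteq> below T (I - 1) (j - 1)"
  shows "I - 1 < length T" "j \<in> set (T ! (I - 1))"
proof -
  have no: "\<forall>row\<in>set (drop I T). j \<notin> set row"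
    using below_Suc[OF T j, of I] eq by (simp add: filter_empty_conv)
  have "filter (\<lambda>row. j \<in> set row) (drop (I - 1) T) \<noteq> []"
    using below_Suc[OF T j, of "I - 1"] ne by auto
  then obtain row where row: "row \<in> set (drop (I - 1) T)" "j \<in> set row"
    by (auto simp: filter_empty_conv)
  then show lt: "I - 1 < length T" by (metis drop_all empty_iff empty_set not_le)
  have "drop (I - 1) T = T ! (I - 1) # drop I T"
    using Cons_nth_drop_Suc[OF lt] I by simp
  then show "j \<in> set (T ! (I - 1))" using row no by auto
qed

lemma length_filter_insort: "length (filter P (insort x xs)) = length (filter P xs) + (if P x then 1 else 0)"
proof -
  have *: "length (filter P ys) = size (filter_mset P (mset ys))" for ys
    by (metis mset_filter size_mset)
  show ?thesis unfolding * by simp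
qed

text \<open>Only \<open>j\<close> changes its row, from \<open>I - 1\<close> to \<open>I\<close>, so
  the rows from \<open>I\<close> on gain exactly this entry. The case of a newly opened row is
  \<open>I = length T\<close>.\<close>

lemma below_drop_box:
  assumes T: "standard_tableau N T" and I: "1 \<le> I" "I - 1 < length T" and j: "j \<in> set (T ! (I - 1))"
  shows "below (drop_box j T) I k = below T I k + (if j \<le> k then 1 else 0)"
proof -
  have dist: "distinct (concat T)" using T by (simp add: standard_tableau_def)
  have disj: "set (T ! a) \<inter> set (T ! b) = {}" if "distinct (concat T)" "a < b" "b < length T" for a b and T :: "nat list list"
    using that
  proof (induction T arbitrary: a b)
    case (Cons t T)
    show ?case
    proof (cases a)
      case 0
      then obtain b' where b: "b = Suc b'" "b' < length T" using Cons.prems by (cases b) auto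
      then have "set (T ! b') \<subseteq> set (concat T)" using nth_mem by fastforce
      then show ?thesis using Cons.prems(1) 0 b by auto
    next
      case (Suc a')
      then show ?thesis using Cons.IH[of a' "b - 1"] Cons.prems by (cases b) auto
    qed
  qed simp
  have uniq: "a = I - 1" if "a < length T" "j \<in> set (T ! a)" for a
    using disj[OF dist, of a "I - 1"] disj[OF dist, of "I - 1" a] that j I by (metis disjoint_iff linorder_neqE_nat)
  have the: "(THE a. a < length T \<and> j \<in> set (T ! a)) = I - 1"
    by (rule the_equality) (use uniq I j in blast)+
  have no: "j \<notin> set (T ! a)" if "a < length T" "a \<noteq> I - 1" for a using uniq that by blast
  have rem: "map (remove1 j) (drop I T) = drop I T"
  proof (rule nth_equalityI)
    fix a assume "a < length (map (remove1 j) (drop I T))"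
    then show "map (remove1 j) (drop I T) ! a = drop I T ! a"
      using no[of "I + a"] I by (simp add: remove1_idem)
  qed simp
  show ?thesis
  proof (cases "I < length T")
    case True
    have "drop_box j T = (map (remove1 j) T)[I := insort j (map (remove1 j) T ! I)]"
      using the True I by (simp add: drop_box_def Let_def)
    then have "drop I (drop_box j T) = (drop I (map (remove1 j) T))[0 := insort j (map (remove1 j) T ! I)]"
      by (simp add: drop_update_swap)
    also have "drop I (map (remove1 j) T) = drop I T" using rem by (simp add: drop_map)
    also have "map (remove1 j) T ! I = T ! I" using True no[of I] I by (simp add: remove1_idem)
    also have "drop I T = T ! I # drop (Suc I) T" using True by (simp add: Cons_nth_drop_Suc)
    finally have "drop I (drop_box j T) = insort j (T ! I) # drop (Suc I) T" by simp
    moreover have "drop I T = T ! I # drop (Suc I) T" using True by (simp add: Cons_nth_drop_Suc)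
    ultimately show ?thesis
      unfolding below_def by (simp only: list.map sum_list.Cons length_filter_insort)
  next
    case False
    then have l: "I = length T" using I by simp
    have "drop_box j T = map (remove1 j) T @ [[j]]"
      using the False I by (simp add: drop_box_def Let_def)
    then show ?thesis using l by (simp add: below_def)
  qed
qed

lemma first_row_length:
  assumes T: "standard_tableau N T" and N: "1 \<le> N"
  shows "length (T ! 0) = N - below T 1 N"
proof -
  have le: "x \<le> N" if "row \<in> set T" "x \<in> set row" for row x
    using T that unfolding standard_tableau_def by fastforce
  have full: "length (filter (\<lambda>x. x \<le> N) row) = length row" if "row \<in> set T" for row
    using le[OF that] by (simp add: filter_id_conv)
  have "sum_list (map length T) = N" using T by (simp add: standard_tableau_def partition_of_def)
  moreover have "T \<noteq> []" using calculation N by auto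
  then obtain r R where TR: "T = r # R" by (cases T) auto
  moreover have "map (\<lambda>row. length (filter (\<lambda>x. x \<le> N) row)) R = map length R"
    using full TR by (intro map_cong) auto
  then have "below T 1 N = sum_list (map length R)"
    unfolding below_def TR by (simp only: drop_Suc_Cons drop0 One_nat_def)
  ultimately show ?thesis by simp
qed

section \<open>Chains\<close>

text \<open>The chain of \<open>u + 1\<close>, counted from 0; as for matrix indices, vertices are counted from 0.\<close>

definition lev :: "nat set \<Rightarrow> nat \<Rightarrow> nat" where
  "lev \<tau> u = card ({1..u} - \<tau>)"

lemma lev_Suc: "lev \<tau> (Suc u) = lev \<tau> u + (if Suc u \<in> \<tau> then 0 else 1)"
proof -
  have "{1..Suc u} - \<tau> = (if Suc u \<in> \<tau> then {1..u} - \<tau> else insert (Suc u) ({1..u} - \<tau>))"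
    by (auto simp: le_Suc_eq)
  then show ?thesis by (simp add: lev_def)
qed

lemma lev_0 [simp]: "lev \<tau> 0 = 0"
  by (simp add: lev_def)

lemma lev_mono: "u \<le> v \<Longrightarrow> lev \<tau> u \<le> lev \<tau> v"
  unfolding lev_def by (intro card_mono) auto

text \<open>The bridge between levels and roots; the shift in \<open>{Suc u..<Suc v}\<close> comes
  from counting vertices from 0 but simple roots from 1.\<close>

lemma lev_less_iff: "u < v \<Longrightarrow> lev \<tau> u < lev \<tau> v \<longleftrightarrow> \<not> {Suc u..<Suc v} \<subseteq> \<tau>"
proof -
  assume uv: "u < v"
  have "{1..v} - \<tau> = ({1..u} - \<tau>) \<union> ({Suc u..<Suc v} - \<tau>)" using uv by auto
  then have "lev \<tau> v = lev \<tau> u + card ({Suc u..<Suc v} - \<tau>)"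
    unfolding lev_def by (subst card_Un_disjoint[symmetric]) auto
  then show ?thesis by (simp add: card_gt_0_iff) 
qed

lemma lev_surj: "l \<le> lev \<tau> u \<Longrightarrow> \<exists>v\<le>u. lev \<tau> v = l"
proof (induction u)
  case (Suc u)
  show ?case
  proof (cases "l \<le> lev \<tau> u")
    case True
    then show ?thesis using Suc.IH by (meson le_SucI)
  next
    case False
    then have "l = lev \<tau> (Suc u)" using Suc.prems lev_Suc[of \<tau> u] by (auto split: if_splits)
    then show ?thesis by blast
  qed
qed simp

definition lev_set :: "nat \<Rightarrow> nat set \<Rightarrow> nat \<Rightarrow> nat set" where
  "lev_set N \<tau> l = {v \<in> {1..N}. lev \<tau> (v - 1) = l}"

lemma transpose_preserves_lev:
  assumes "k \<in> \<tau>" "1 \<le> k" "v \<ge> 1"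
  shows "lev \<tau> (Transposition.transpose k (Suc k) v - 1) = lev \<tau> (v - 1)"
proof -
  have "lev \<tau> k = lev \<tau> (k - 1)" using lev_Suc[of \<tau> "k - 1"] assms by simp
  then show ?thesis using assms by (auto simp: Transposition.transpose_def)
qed

text \<open>A generator moves numbers only within a level, because the step from \<open>k\<close> to
  \<open>k + 1\<close> with \<open>k\<close> in \<open>\<tau>\<close> does not raise it. Conversely,
  consecutive numbers of one level are exchanged by a generator, so the group connects any two of
  them.\<close>

lemma chain_orbit:
  assumes \<tau>: "\<tau> \<subseteq> {1..<N}" and x: "x \<in> {1..N}"
  shows "orbit (chain_group N \<tau>) (\<lambda>g. g) x = lev_set N \<tau> (lev \<tau> (x - 1))"
proof -
  let ?H = "(\<lambda>k. Transposition.transpose k (Suc k)) ` \<tau>"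
  let ?G = "generate (sym_group N) ?H"
  have carr: "h permutes {1..N}" if "h \<in> ?H" for h
    using that \<tau> by (auto intro!: permutes_swap_id)
  have inv: "inv\<^bsub>sym_group N\<^esub> h = h" if "h \<in> ?H" for h
    using carr[OF that] that by (subst sym_group_inv_equality) (auto simp: sym_group_carrier)
  have fwd: "\<forall>v\<in>{1..N}. g v \<in> {1..N} \<and> lev \<tau> (g v - 1) = lev \<tau> (v - 1)" if "g \<in> ?G" for g
    using that
  proof induction
    case one
    then show ?case by (simp add: sym_group_def)
  next
    case (incl h)
    then show ?case
      using carr[OF incl] \<tau> transpose_preserves_lev permutes_in_image[OF carr[OF incl]] by fastforce
  next
    case (inv h)
    then show ?case
      using carr[OF inv] \<tau> transpose_preserves_lev permutes_in_image[OF carr[OF inv]]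
      by (simp add: \<open>\<And>h. h \<in> ?H \<Longrightarrow> inv\<^bsub>sym_group N\<^esub> h = h\<close>) fastforce
  next
    case (eng g h)
    then show ?case by (simp add: sym_group_def)
  qed
  have up: "\<exists>g\<in>?G. g v = w" if "v \<le> w" "1 \<le> v" "w \<le> N" "lev \<tau> (w - 1) = lev \<tau> (v - 1)" for v w
    using that
  proof (induction w rule: dec_induct)
    case base
    have "id \<in> ?G" using generate.one[of "sym_group N" ?H] by (simp add: sym_group_def)
    then show ?case by (intro bexI[of _ id]) auto
  next
    case (step w)
    have l: "lev \<tau> (w - 1) = lev \<tau> w" "lev \<tau> (w - 1) = lev \<tau> (v - 1)"
      using lev_mono[of "v - 1" "w - 1" \<tau>] lev_mono[of "w - 1" w \<tau>] step by auto
    then obtain g where g: "g \<in> ?G" "g v = w" using step by auto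
    have "w \<in> \<tau>" using lev_Suc[of \<tau> "w - 1"] l step by (auto split: if_splits)
    then have "Transposition.transpose w (Suc w) \<in> ?G" by (intro generate.incl) auto
    then have "Transposition.transpose w (Suc w) \<otimes>\<^bsub>sym_group N\<^esub> g \<in> ?G" using g by (intro generate.eng)
    then show ?case using g by (intro bexI[of _ "Transposition.transpose w (Suc w) \<circ> g"]) (auto simp: sym_group_def)
  qed
  have down: "\<exists>g\<in>?G. g w = v" if "v \<le> w" "1 \<le> v" "w \<le> N" "lev \<tau> (w - 1) = lev \<tau> (v - 1)" for v w
    using that
  proof (induction w rule: dec_induct)
    case base
    have "id \<in> ?G" using generate.one[of "sym_group N" ?H] by (simp add: sym_group_def)
    then show ?case by (intro bexI[of _ id]) auto
  next
    case (step w)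
    have l: "lev \<tau> (w - 1) = lev \<tau> w" "lev \<tau> (w - 1) = lev \<tau> (v - 1)"
      using lev_mono[of "v - 1" "w - 1" \<tau>] lev_mono[of "w - 1" w \<tau>] step by auto
    then obtain g where g: "g \<in> ?G" "g w = v" using step by auto
    have "w \<in> \<tau>" using lev_Suc[of \<tau> "w - 1"] l step by (auto split: if_splits)
    then have "Transposition.transpose w (Suc w) \<in> ?G" by (intro generate.incl) auto
    then have "g \<otimes>\<^bsub>sym_group N\<^esub> Transposition.transpose w (Suc w) \<in> ?G" using g by (intro generate.eng)
    then show ?case using g by (intro bexI[of _ "g \<circ> Transposition.transpose w (Suc w)"]) (auto simp: sym_group_def)
  qed
  have "orbit (chain_group N \<tau>) (\<lambda>g. g) x = {g x | g. g \<in> ?G}"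
    by (simp add: orbit_def chain_group_def)
  also have "\<dots> = lev_set N \<tau> (lev \<tau> (x - 1))"
  proof
    show "{g x | g. g \<in> ?G} \<subseteq> lev_set N \<tau> (lev \<tau> (x - 1))"
      using fwd x by (auto simp: lev_set_def)
    show "lev_set N \<tau> (lev \<tau> (x - 1)) \<subseteq> {g x | g. g \<in> ?G}"
    proof
      fix y assume y: "y \<in> lev_set N \<tau> (lev \<tau> (x - 1))"
      have "\<exists>g\<in>?G. g x = y"
        using up[of x y] down[of y x] x y by (cases "x \<le> y") (auto simp: lev_set_def)
      then show "y \<in> {g x | g. g \<in> ?G}" by blast
    qed
  qed
  finally show ?thesis .
qed

lemma (in linorder) sorted_key_list_of_set_eqI:
  assumes "inj_on f (set xs)" "sorted (map f xs)" "distinct xs"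
  shows "sorted_key_list_of_set f (set xs) = xs"
proof -
  interpret folding_insort_key "(\<le>)" "(<)" "set xs" f
    by unfold_locales (rule assms(1))
  show ?thesis by (rule idem_if_sorted_distinct) (use assms in auto)
qed

text \<open>Since \<open>lev\<close> is increasing, sorting the orbits by their minima lists them by
  level. Levels are numbered from 0, chains from 1.\<close>

lemma chain_lev_set:
  assumes \<tau>: "\<tau> \<subseteq> {1..<N}" and N: "1 \<le> N" and q: "1 \<le> q" "q \<le> Suc (lev \<tau> (N - 1))"
  shows "chain N \<tau> q = lev_set N \<tau> (q - 1)"
proof -
  let ?Q = "Suc (lev \<tau> (N - 1))"
  let ?xs = "map (lev_set N \<tau>) [0..<?Q]"
  have ne: "\<exists>v. v \<in> lev_set N \<tau> l" if l: "l < ?Q" for l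
  proof -
    obtain v where "v \<le> N - 1" "lev \<tau> v = l" using lev_surj[of l \<tau> "N - 1"] l by auto
    then show ?thesis using N by (intro exI[of _ "Suc v"]) (auto simp: lev_set_def)
  qed
  have fin: "finite (lev_set N \<tau> l)" for l by (simp add: lev_set_def)
  have orb: "Group_Action.orbits (chain_group N \<tau>) {1..N} (\<lambda>g. g) = set ?xs"
  proof -
    have "Group_Action.orbits (chain_group N \<tau>) {1..N} (\<lambda>g. g) = (\<lambda>x. lev_set N \<tau> (lev \<tau> (x - 1))) ` {1..N}"
      unfolding orbits_def Setcompr_eq_image by (rule image_cong[OF refl chain_orbit[OF \<tau>]])
    also have "\<dots> = set ?xs"
    proof
      show "(\<lambda>x. lev_set N \<tau> (lev \<tau> (x - 1))) ` {1..N} \<subseteq> set ?xs"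
      proof (rule image_subsetI)
        fix x assume "x \<in> {1..N}"
        then have "lev \<tau> (x - 1) < ?Q" using lev_mono[of "x - 1" "N - 1" \<tau>] by (simp add: diff_le_mono)
        then show "lev_set N \<tau> (lev \<tau> (x - 1)) \<in> set ?xs" by (simp del: upt_Suc)
      qed
      show "set ?xs \<subseteq> (\<lambda>x. lev_set N \<tau> (lev \<tau> (x - 1))) ` {1..N}"
      proof
        fix S assume "S \<in> set ?xs"
        then obtain l where l: "l < ?Q" "S = lev_set N \<tau> l" by (auto simp del: upt_Suc)
        then obtain v where "v \<in> lev_set N \<tau> l" using ne by blast
        then show "S \<in> (\<lambda>x. lev_set N \<tau> (lev \<tau> (x - 1))) ` {1..N}"
          using l by (auto simp: lev_set_def intro!: image_eqI[of _ _ v])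
      qed
    qed
    finally show ?thesis .
  qed
  have Min: "Min (lev_set N \<tau> l) < Min (lev_set N \<tau> l')" if "l < l'" "l' < ?Q" for l l'
  proof -
    have "Min (lev_set N \<tau> l) \<in> lev_set N \<tau> l" "Min (lev_set N \<tau> l') \<in> lev_set N \<tau> l'"
      using Min_in[OF fin] ne[of l] ne[of l'] that by auto
    then have "lev \<tau> (Min (lev_set N \<tau> l) - 1) = l" "lev \<tau> (Min (lev_set N \<tau> l') - 1) = l'"
      by (auto simp: lev_set_def)
    then show ?thesis
      using lev_mono[of "Min (lev_set N \<tau> l') - 1" "Min (lev_set N \<tau> l) - 1" \<tau>] that(1)
      by (metis diff_le_mono leD leI)
  qed
  have sw: "sorted_wrt (<) (map Min ?xs)"
    unfolding sorted_wrt_iff_nth_less using Min by (auto simp del: upt_Suc)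
  have inj: "inj_on Min (set ?xs)"
    using sw by (metis distinct_map strict_sorted_iff)
  have "sorted_key_list_of_set Min (set ?xs) = ?xs"
  proof (rule sorted_key_list_of_set_eqI[OF inj])
    show "sorted (map Min ?xs)" "distinct ?xs" using sw by (simp_all only: strict_sorted_iff distinct_map)
  qed
  then have "chain N \<tau> q = ?xs ! (q - 1)"
    unfolding chain_def orb by simp
  also have "\<dots> = lev_set N \<tau> (q - 1)" using q by (simp del: upt_Suc)
  finally show ?thesis .
qed

section \<open>Generic Jordan types on the nilradical\<close>

abbreviation corner :: "nat \<Rightarrow> complex mat \<Rightarrow> complex mat" where
  "corner k A \<equiv> Matrix.mat k k (\<lambda>(r, c). A $$ (r, c))"

text \<open>A root in the span of \<open>\<tau>\<close> joins two vertices of one level, every other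
  positive root joins a vertex to a higher level. In this form path counting applies to the
  nilradical.\<close>

lemma m_space_lev:
  assumes "A \<in> carrier_mat N N"
  shows "A \<in> m_space N \<tau> \<longleftrightarrow> (\<forall>r<N. \<forall>c<N. A $$ (r, c) \<noteq> 0 \<longrightarrow> lev \<tau> r < lev \<tau> c)"
proof -
  have free: "(Suc r, Suc c) \<in> free_pos N \<tau> \<longleftrightarrow> lev \<tau> r < lev \<tau> c" if "r < N" "c < N" for r c
  proof (cases "r < c")
    case True
    then show ?thesis using that lev_less_iff[OF True, of \<tau>] by (auto simp: free_pos_iff)
  next
    case False
    then show ?thesis using lev_mono[of c r \<tau>] by (auto simp: free_pos_iff)
  qed
  have "A \<in> m_space N \<tau> \<longleftrightarrow> (\<forall>r<N. \<forall>c<N. (Suc r, Suc c) \<notin> free_pos N \<tau> \<longrightarrow> A $$ (r, c) = 0)"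
  proof
    assume A: "A \<in> m_space N \<tau>"
    show "\<forall>r<N. \<forall>c<N. (Suc r, Suc c) \<notin> free_pos N \<tau> \<longrightarrow> A $$ (r, c) = 0"
    proof (intro allI impI)
      fix r c assume rc: "r < N" "c < N" "(Suc r, Suc c) \<notin> free_pos N \<tau>"
      then have "coord A (Suc r, Suc c) = 0"
        using A[unfolded m_space_iff] by (auto simp: box_def)
      then show "A $$ (r, c) = 0" by (simp add: coord_def)
    qed
  next
    assume z: "\<forall>r<N. \<forall>c<N. (Suc r, Suc c) \<notin> free_pos N \<tau> \<longrightarrow> A $$ (r, c) = 0"
    show "A \<in> m_space N \<tau>"
      unfolding m_space_iff
    proof (intro conjI ballI assms)
      fix v assume v: "v \<in> box N - free_pos N \<tau>"
      obtain a b where ab: "v = (a, b)" by fastforce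
      then have "a - 1 < N" "b - 1 < N" "Suc (a - 1) = a" "Suc (b - 1) = b" using v by (auto simp: box_def)
      then show "coord A v = 0" using z[rule_format, of "a - 1" "b - 1"] v ab by (simp add: coord_def)
    qed
  qed
  then show ?thesis using free by blast
qed

text \<open>The number of a vertex within its level, counted from 0. Counting predecessors instead
  of subtracting the first vertex allows an arbitrary \<open>L\<close>; these labels realise
  \<open>excess\<close> for every initial segment of the vertices at once.\<close>

definition gpos :: "(nat \<Rightarrow> nat) \<Rightarrow> nat \<Rightarrow> nat" where
  "gpos L v = card {w. w < v \<and> L w = L v}"

lemma gpos_less: "u < v \<Longrightarrow> L u = L v \<Longrightarrow> gpos L u < gpos L v"
  unfolding gpos_def by (rule psubset_card_mono) auto

lemma gpos_inj: "L u = L v \<Longrightarrow> gpos L u = gpos L v \<Longrightarrow> u = v"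
  using gpos_less[of u v L] gpos_less[of v u L] by (metis linorder_neqE_nat less_irrefl)

lemma gpos_down:
  assumes "q \<le> gpos L v" shows "\<exists>w\<le>v. L w = L v \<and> gpos L w = q"
proof -
  define S where "S = {w. w \<le> v \<and> L w = L v}"
  have "S = insert v {w. w < v \<and> L w = L v}" by (auto simp: S_def)
  then have card: "card S = Suc (gpos L v)" by (simp add: gpos_def)
  have inj: "inj_on (gpos L) S" by (rule inj_onI) (auto simp: S_def intro: gpos_inj[of L])
  have "gpos L ` S \<subseteq> {..gpos L v}"
  proof (rule image_subsetI)
    fix w assume "w \<in> S"
    then show "gpos L w \<in> {..gpos L v}"
      using gpos_less[of w v L] by (cases "w = v") (auto simp: S_def)
  qed
  then have "gpos L ` S = {..gpos L v}"
    using card card_image[OF inj] by (intro card_subset_eq) auto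
  then have "q \<in> gpos L ` S" using assms by simp
  then show ?thesis by (auto simp: S_def)
qed

lemma excess_gpos: "excess L k I = card {v. v < k \<and> I \<le> gpos L v}"
proof (rule excess_labels)
  show "inj_on (gpos L) {v. v < k \<and> L v = l}" for l
    by (rule inj_onI) (auto intro: gpos_inj[of L])
  show "\<exists>w<k. L w = L v \<and> gpos L w = q" if vk: "v < k" and q: "q \<le> gpos L v" for v q
  proof -
    obtain w where "w \<le> v" "L w = L v" "gpos L w = q" using gpos_down[OF q] by blast
    then show ?thesis using vk by (intro exI[of _ w]) simp
  qed
qed

text \<open>Each vertex is joined to the next one that has the same number within its level. Every
  corner of this single matrix attains the smallest divisibility possible in the nilradical, for all
  \<open>I\<close>.\<close>

definition path_witness :: "nat \<Rightarrow> (nat \<Rightarrow> nat) \<Rightarrow> complex mat" where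
  "path_witness N L = Matrix.mat N N (\<lambda>(r, c). if nxt (gpos L) r c then 1 else 0)"

lemma path_witness_m_space: "path_witness N (lev \<tau>) \<in> m_space N \<tau>"
proof -
  have "lev \<tau> r < lev \<tau> c" if "nxt (gpos (lev \<tau>)) r c" for r c
  proof -
    have "r < c" "gpos (lev \<tau>) c = gpos (lev \<tau>) r" using that by (auto simp: nxt_def)
    then show ?thesis using lev_mono[of r c \<tau>] gpos_inj[of "lev \<tau>" r c] by fastforce
  qed
  then show ?thesis by (subst m_space_lev) (auto simp: path_witness_def)
qed

lemma path_witness_not_hdiv:
  "k \<le> N \<Longrightarrow> \<not> hdiv k (corner k (path_witness N L)) I (Suc (excess L k I))"
  unfolding excess_gpos by (rule not_hdiv_labels) (auto simp: path_witness_def)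

text \<open>With the border kept constant, the coefficient depends polynomially on the matrix
  entries, so that its nonvanishing is a Zariski open condition.\<close>

lemma coeff_Hdet_mpoly:
  assumes "k \<le> N"
  shows "\<exists>p. vars p \<subseteq> box N \<and> (\<forall>A. eval_mpoly p A = coeff (Hdet n I (\<lambda>u w.
    if I \<le> u \<and> u < I + k \<and> I \<le> w \<and> w < I + k then A $$ (u - I, w - I) else B u w)) i)"
proof -
  define q where "q = (\<lambda>u w. if I \<le> u \<and> u < I + k \<and> I \<le> w \<and> w < I + k
    then var (Suc (u - I), Suc (w - I)) else const (B u w))"
  define p where "p = (\<Sum>\<pi> | \<pi> permutes {0..<n} \<and> card (pfix n I \<pi>) = i.
    const (signof \<pi>) * (\<Prod>u\<in>pedges n I \<pi>. q u (I + \<pi> u)))"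
  have qb: "vars (q u w) \<subseteq> box N" for u w
    using assms by (auto simp: q_def box_def)
  have term_box: "vars (const (signof \<pi>) * (\<Prod>u\<in>pedges n I \<pi>. q u (I + \<pi> u))) \<subseteq> box N" for \<pi>
  proof (rule vars_mult_box)
    show "vars (\<Prod>u\<in>pedges n I \<pi>. q u (I + \<pi> u)) \<subseteq> box N"
      by (intro order.trans[OF vars_prod] UN_least qb)
  qed (simp only: vars_const empty_subsetI)
  have "vars p \<subseteq> box N"
    unfolding p_def by (intro order.trans[OF vars_sum] UN_least term_box)
  moreover have "ev (coord A) (q u w) =
      (if I \<le> u \<and> u < I + k \<and> I \<le> w \<and> w < I + k then A $$ (u - I, w - I) else B u w)" for A u w
    by (auto simp: q_def coord_def)
  ultimately show ?thesis
    by (intro exI[of _ p]) (simp add: p_def coeff_Hdet eval_mpoly_ev ev.subst_sum ev.subst_mult ev_hom.hom_prod)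
qed

lemma tableau_of_hdiv:
  assumes T: "tableau_of N V T" and V: "V \<subseteq> strict_upper N" and k: "k \<le> N"
  obtains U where "openin (zariski N) U" "U \<inter> V \<noteq> {}"
    "\<And>A I e. A \<in> U \<inter> V \<Longrightarrow> hdiv k (corner k A) I e \<longleftrightarrow> e \<le> below T I k"
proof -
  have st: "standard_tableau N T" using T by (simp add: tableau_of_def)
  obtain U where U: "openin (zariski N) U" "U \<inter> V \<noteq> {}"
    "\<And>A. A \<in> U \<inter> V \<Longrightarrow> corner k A \<in> nilp_orbit k (shape_upto k T)"
    using T k unfolding tableau_of_def by blast
  show ?thesis
  proof (rule that[OF U(1,2)])
    fix A I e assume A: "A \<in> U \<inter> V"
    have "corner k A $$ (a, a) = 0" if "a < k" for a
      using that A V k by (auto simp: strict_upper_def)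
    from hdiv_nilp[OF U(3)[OF A] this shape_upto_below(1)[OF st]]
    show "hdiv k (corner k A) I e \<longleftrightarrow> e \<le> below T I k"
      using shape_upto_below(2)[OF st] by simp
  qed
qed

text \<open>Elements of \<open>VR\<close> lie in the nilradical, so levels give the bound from
  below. For the other bound, a coefficient that is nonzero at the path witness cannot vanish on all
  of \<open>VR\<close>, whose closure contains the witness; by irreducibility this open condition
  meets the generic one.\<close>

lemma below_richardson:
  assumes irr: "irreducible_in (zariski N) VR" and VR: "VR \<subseteq> strict_upper N"
    and cl: "zariski N closure_of VR = m_space N \<tau>" and T: "tableau_of N VR T" and k: "k \<le> N"
  shows "below T I k = excess (lev \<tau>) k I"
proof -
  have VRc: "VR \<subseteq> carrier_mat N N" using VR by (auto simp: strict_upper_def)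
  have sub: "VR \<subseteq> m_space N \<tau>" using closure_of_subset[of VR "zariski N"] VRc cl by simp
  obtain U where U: "openin (zariski N) U" "U \<inter> VR \<noteq> {}"
    "\<And>A I e. A \<in> U \<inter> VR \<Longrightarrow> hdiv k (corner k A) I e \<longleftrightarrow> e \<le> below T I k"
    using tableau_of_hdiv[OF T VR k] by blast
  have ge: "excess (lev \<tau>) k I \<le> below T I k"
  proof -
    obtain A where A: "A \<in> U \<inter> VR" using U(2) by blast
    then have "A \<in> m_space N \<tau>" "A \<in> carrier_mat N N" using sub VRc by auto
    then have "hdiv k (corner k A) I (excess (lev \<tau>) k I)"
      using k by (intro hdiv_levels) (auto simp: m_space_lev)
    then show ?thesis using U(3)[OF A] by simp
  qed
  let ?W = "path_witness N (lev \<tau>)"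
  obtain B i where B: "\<forall>a<k. \<forall>b<k. B (I + a) (I + b) = corner k ?W $$ (a, b)"
    and i: "i < Suc (excess (lev \<tau>) k I)" "coeff (Hdet (k + I) I B) i \<noteq> 0"
    using path_witness_not_hdiv[OF k, of "lev \<tau>" I] unfolding hdiv_def by blast
  let ?B = "\<lambda>A u w. if I \<le> u \<and> u < I + k \<and> I \<le> w \<and> w < I + k then A $$ (u - I, w - I) else B u w"
  obtain p where p: "vars p \<subseteq> box N" "\<And>A. eval_mpoly p A = coeff (Hdet (k + I) I (?B A)) i"
    using coeff_Hdet_mpoly[OF k, of "k + I" I B i] by blast
  have "?B ?W = B"
  proof (intro ext)
    fix u w
    show "?B ?W u w = B u w"
      using B[rule_format, of "u - I" "w - I"] by auto
  qed
  then have pW: "eval_mpoly p ?W \<noteq> 0" using p(2) i(2) by simp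
  have "\<exists>A\<in>VR. eval_mpoly p A \<noteq> 0"
    using vanish_closure[OF _ p(1) VRc, of ?W] pW cl path_witness_m_space by blast
  then have "{A \<in> carrier_mat N N. eval_mpoly p A \<noteq> 0} \<inter> VR \<noteq> {}" using VRc by blast
  from irreducible_in_open_Int[OF irr U(1) openin_zariski_basic[OF p(1)] U(2) this]
  obtain A where A: "A \<in> U \<inter> VR" "eval_mpoly p A \<noteq> 0" by blast
  have "\<not> hdiv k (corner k A) I (Suc (excess (lev \<tau>) k I))"
    unfolding hdiv_def
  proof
    assume h: "\<forall>B. (\<forall>a<k. \<forall>b<k. B (I + a) (I + b) = corner k A $$ (a, b)) \<longrightarrow>
      (\<forall>i<Suc (excess (lev \<tau>) k I). coeff (Hdet (k + I) I B) i = 0)"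
    have "\<forall>a<k. \<forall>b<k. ?B A (I + a) (I + b) = corner k A $$ (a, b)" by auto
    then show False using h i(1) A(2) p(2) by auto
  qed
  then show ?thesis using U(3)[OF A(1)] ge by (simp add: not_le)
qed

section \<open>Vanishing of the path polynomial\<close>

lemma excess_sum:
  assumes "\<And>v. v < m \<Longrightarrow> L v \<le> M"
  shows "excess L m I = (\<Sum>l\<le>M. level_card L m l - I)"
  unfolding excess_def
proof (rule sum.mono_neutral_left)
  show "\<forall>l\<in>{..M} - L ` {..<m}. level_card L m l - I = 0"
  proof
    fix l assume "l \<in> {..M} - L ` {..<m}"
    then have "{v. v < m \<and> L v = l} = {}" by auto
    then show "level_card L m l - I = 0" by (simp only: level_card_def card.empty diff_0_eq_0)
  qed
qed (use assms in auto)

lemma Hdet_cong: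
  assumes "\<And>u v. u < n \<Longrightarrow> I \<le> v \<Longrightarrow> v < n + I \<Longrightarrow> B u v = B' u v"
  shows "Hdet n I B = Hdet n I B'"
proof -
  have "Hmat n I B = Hmat n I B'"
    by (rule eq_matI) (use assms in \<open>auto simp: Hmat_def\<close>)
  then show ?thesis by (simp add: Hdet_def)
qed

text \<open>The two chains in absolute vertex numbers: the lower one is
  \<open>i0, ..., i0 + I - 1\<close>, the upper one \<open>i0 + n, ..., i0 + n + I - 1\<close>. The
  vertices before \<open>i0\<close> are included because Jordan types are given for upper-left
  corners.\<close>

locale two_chains =
  fixes L :: "nat \<Rightarrow> nat" and i0 n I :: nat
  assumes mono: "u \<le> v \<Longrightarrow> L u \<le> L v" and I_pos: "0 < I" and I_le: "I \<le> n"
    and start: "v < i0 + n + I \<Longrightarrow> L v = L i0 \<longleftrightarrow> i0 \<le> v \<and> v < i0 + I"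
    and end_: "v < i0 + n + I \<Longrightarrow> L v = L (i0 + n) \<longleftrightarrow> i0 + n \<le> v"
begin

lemma below_start: "v < i0 \<Longrightarrow> L v < L i0"
  using mono[of v i0] start[of v] by (simp add: order_less_le)

lemma above_start: "i0 + I \<le> v \<Longrightarrow> v < i0 + n + I \<Longrightarrow> L i0 < L v"
  using mono[of i0 v] start[of v] by (simp add: order_less_le)

lemma below_end:
  assumes "v < i0 + n" shows "L v < L (i0 + n)"
proof -
  have "L v \<noteq> L (i0 + n)" using end_[of v] assms by simp
  then show ?thesis using mono[of v "i0 + n"] assms by (simp add: order_less_le)
qed

text \<open>The lower chain is counted in both parts, which is harmless: with exactly
  \<open>I\<close> vertices it has no excess. Every other level lies entirely in one of the
  parts.\<close>

lemma excess_split: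
  "excess L (i0 + n + I) I = excess L (i0 + I) I + excess (\<lambda>v. L (i0 + v)) (n + I) I"
proof -
  define M where "M = L (i0 + n + I)"
  have e: "excess L (i0 + n + I) I = (\<Sum>l\<le>M. level_card L (i0 + n + I) l - I)"
    "excess L (i0 + I) I = (\<Sum>l\<le>M. level_card L (i0 + I) l - I)"
    "excess (\<lambda>v. L (i0 + v)) (n + I) I = (\<Sum>l\<le>M. level_card (\<lambda>v. L (i0 + v)) (n + I) l - I)"
    unfolding M_def by (rule excess_sum, rule mono, use I_le in simp)+
  have "level_card L (i0 + n + I) l - I =
      (level_card L (i0 + I) l - I) + (level_card (\<lambda>v. L (i0 + v)) (n + I) l - I)" for l
  proof -
    consider "l < L i0" | "l = L i0" | "L i0 < l" by linarith
    then show ?thesis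
    proof cases
      case 1
      have small: "v < i0" if "L v = l" for v using mono[of i0 v] that 1 by (metis leD leI)
      have "{v. v < i0 + n + I \<and> L v = l} = {v. v < i0 + I \<and> L v = l}" using small by force
      moreover have "{v. v < n + I \<and> L (i0 + v) = l} = {}" using small by force
      ultimately show ?thesis by (simp only: level_card_def card.empty diff_0_eq_0 add_0_right)
    next
      case 2
      have "{v. v < i0 + n + I \<and> L v = l} = {i0..<i0 + I}" "{v. v < i0 + I \<and> L v = l} = {i0..<i0 + I}"
        using start I_le 2 by auto
      moreover have "{v. v < n + I \<and> L (i0 + v) = l} = {..<I}"
        using start[of "i0 + _"] I_le 2 by auto
      ultimately show ?thesis by (simp add: level_card_def)
    next
      case 3
      have big: "i0 + I \<le> v" if "L v = l" "v < i0 + n + I" for v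
        using start[of v] below_start[of v] that 3 by (metis leI less_asym nat_neq_iff)
      have "{v. v < i0 + I \<and> L v = l} = {}" using big I_le by force
      moreover have "{v. v < i0 + n + I \<and> L v = l} = (\<lambda>a. i0 + a) ` {a. a < n + I \<and> L (i0 + a) = l}"
        unfolding shift_image using big by force
      ultimately show ?thesis
        by (simp only: level_card_def card.empty diff_0_eq_0 add_0_left) (simp add: card_image)
    qed
  qed
  then show ?thesis by (simp add: e sum.distrib)
qed

text \<open>Choose a border for which the small corner has a nonzero coefficient up to its excess;
  factoring at the lower chain shows that the part \<open>P\<close> before this chain has lowest
  degree \<open>k\<close> at most this excess. With the same border rows the large corner has at
  \<open>k + d\<close> the coefficient of \<open>P * G\<close>. This is 0, as the large corner is
  divisible by one power more than its excess; since \<open>G\<close> starts no earlier than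
  \<open>d\<close>, it is also the product of the coefficients of \<open>P\<close> at
  \<open>k\<close> and of \<open>G\<close> at \<open>d\<close>.\<close>

lemma coeff_vanish:
  assumes strict: "\<And>a b. a < i0 + n + I \<Longrightarrow> b < i0 + n + I \<Longrightarrow> A $$ (a, b) \<noteq> 0 \<Longrightarrow> L a < L b"
    and nd: "\<not> hdiv (i0 + I) (corner (i0 + I) A) I (Suc (excess L (i0 + I) I))"
    and dv: "hdiv (i0 + n + I) (corner (i0 + n + I) A) I (Suc (excess L (i0 + n + I) I))"
  shows "coeff (Hdet n I (\<lambda>u w. A $$ (i0 + u, i0 + w))) (excess (\<lambda>v. L (i0 + v)) (n + I) I) = 0"
proof -
  define j' j where "j' = i0 + I" and "j = i0 + n + I"
  have jj: "j' \<le> j" using I_le by (simp add: j'_def j_def)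
  define e' d where "e' = excess L j' I" and "d = excess (\<lambda>v. L (i0 + v)) (n + I) I"
  define G where "G = Hdet n I (\<lambda>u w. A $$ (i0 + u, i0 + w))"
  obtain B i where B: "\<And>a b. a < j' \<Longrightarrow> b < j' \<Longrightarrow> B (I + a) (I + b) = A $$ (a, b)"
    and i: "i \<le> e'" "coeff (Hdet (j' + I) I B) i \<noteq> 0"
    using nd unfolding hdiv_def j'_def[symmetric] e'_def[symmetric] by (auto simp: less_Suc_eq_le)
  have lvl: "level_strict (k + I) I (ext_lev I k L) X"
    if "\<And>a b. a < k \<Longrightarrow> b < k \<Longrightarrow> X (I + a) (I + b) = A $$ (a, b)" "k \<le> j" for k X
    by (rule level_strict_ext) (use that strict in \<open>auto simp: j_def\<close>)
  define P where "P = Hdet j' I B"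
  have "coeff (Hdet (j' + I) I B) i = coeff (P * Hdet (j' + I - j') I (\<lambda>u v. B (j' + u) (j' + v))) i"
    unfolding P_def
  proof (rule coeff_Hdet_factor[OF lvl])
    show "ext_lev I j' L v < Suc (L i0)" if "v < j'" for v
      using that below_start[of "v - I"] I_pos by (auto simp: ext_lev_def j'_def)
    show "ext_lev I j' L v = Suc (L i0)" if "j' \<le> v" "v < j' + I" for v
      using that start[of "v - I"] I_le by (auto simp: ext_lev_def j'_def)
    show "Suc (L i0) < ext_lev I j' L v" if "j' + I \<le> v" "v < j' + I + I" for v
      using that level_le_sum[of i0 j' L] I_pos by (auto simp: ext_lev_def j'_def)
    show "i \<le> excess (ext_lev I j' L) (j' + I + I) I"
      using i(1) by (simp add: excess_ext_lev e'_def)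
  qed (use B jj I_pos in auto)
  then have "coeff (P * Hdet (j' + I - j') I (\<lambda>u v. B (j' + u) (j' + v))) i \<noteq> 0" using i(2) by simp
  then obtain k0 where "k0 \<le> i" "coeff P k0 \<noteq> 0"
    unfolding coeff_mult by (metis (no_types, lifting) atMost_iff mult_zero_left sum.neutral)
  define k where "k = (LEAST k. coeff P k \<noteq> 0)"
  have k: "coeff P k \<noteq> 0" "k \<le> e'" "\<And>a. a < k \<Longrightarrow> coeff P a = 0"
  proof -
    show "coeff P k \<noteq> 0" unfolding k_def by (rule LeastI[of _ k0]) fact
    have "k \<le> k0" unfolding k_def by (rule Least_le) fact
    then show "k \<le> e'" using \<open>k0 \<le> i\<close> i(1) by simp
    show "coeff P a = 0" if "a < k" for a using that not_less_Least unfolding k_def by blast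
  qed
  \<comment> \<open>The border rows are taken over from \<open>B\<close>; the border columns are an
    identity block on the rows of the upper chain, which makes the factor behind this chain equal to
    1.\<close>
  define B2 where "B2 = (\<lambda>u w. if u < I then (if w < I + j' then B u w else 0)
    else if u < I + j \<and> I \<le> w \<and> w < I + j then A $$ (u - I, w - I)
    else if I + j \<le> w \<and> u - I = i0 + n + (w - (I + j)) then 1 else 0)"
  have B2: "B2 (I + a) (I + b) = A $$ (a, b)" if "a < j" "b < j" for a b
    using that by (simp add: B2_def)
  have zero: "coeff (P * G) (k + d) = 0"
  proof -
    have kd: "k + d \<le> excess L j I"
      using k(2) excess_split by (simp add: j_def j'_def e'_def d_def)
    have "coeff (Hdet (j + I) I B2) (k + d) = 0"
      using dv kd B2 unfolding hdiv_def j_def[symmetric] by (auto simp: less_Suc_eq_le)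
    \<comment> \<open>Splitting at the upper chain removes the border columns; splitting at the
      lower chain then separates \<open>P\<close> from \<open>G\<close>.\<close>
    moreover have "coeff (Hdet (j + I) I B2) (k + d) =
        coeff (Hdet j I B2 * Hdet (j + I - j) I (\<lambda>u v. B2 (j + u) (j + v))) (k + d)"
    proof (rule coeff_Hdet_factor[OF lvl])
      show "ext_lev I j L v < Suc (L (i0 + n))" if "v < j" for v
        using that below_end[of "v - I"] I_pos by (auto simp: ext_lev_def j_def)
      show "ext_lev I j L v = Suc (L (i0 + n))" if "j \<le> v" "v < j + I" for v
        using that end_[of "v - I"] by (auto simp: ext_lev_def j_def)
      show "Suc (L (i0 + n)) < ext_lev I j L v" if "j + I \<le> v" "v < j + I + I" for v
        using that level_le_sum[of "i0 + n" j L] I_pos by (auto simp: ext_lev_def j_def)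
      show "k + d \<le> excess (ext_lev I j L) (j + I + I) I"
        using kd by (simp add: excess_ext_lev)
    qed (use B2 I_pos in auto)
    moreover have "Hdet (j + I - j) I (\<lambda>u v. B2 (j + u) (j + v)) = 1"
    proof -
      have "Hmat I I (\<lambda>u v. B2 (j + u) (j + v)) = 1\<^sub>m I"
      proof (rule eq_matI)
        fix u v assume "u < dim_row (1\<^sub>m I :: complex poly mat)" "v < dim_col (1\<^sub>m I :: complex poly mat)"
        then have uv: "u < I" "v < I" by simp_all
        then have "B2 (j + u) (j + (I + v)) = (if u = v then 1 else 0)"
          by (simp add: B2_def j_def)
        then show "Hmat I I (\<lambda>u v. B2 (j + u) (j + v)) $$ (u, v) = 1\<^sub>m I $$ (u, v)"
          using uv by (simp add: Hmat_def)
      qed (simp_all add: Hmat_def)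
      then show ?thesis by (simp add: Hdet_def)
    qed
    ultimately have "coeff (Hdet j I B2) (k + d) = 0" by simp
    moreover have "coeff (Hdet j I B2) (k + d) =
        coeff (Hdet j' I B2 * Hdet (j - j') I (\<lambda>u v. B2 (j' + u) (j' + v))) (k + d)"
    proof (rule coeff_Hdet_factor)
      show "level_strict j I (ext_lev I j L) B2"
        using lvl[of j B2] B2 by (auto simp: level_strict_def)
      show "ext_lev I j L v < Suc (L i0)" if "v < j'" for v
        using that below_start[of "v - I"] I_pos jj by (auto simp: ext_lev_def j'_def)
      show "ext_lev I j L v = Suc (L i0)" if "j' \<le> v" "v < j' + I" for v
        using that start[of "v - I"] jj by (auto simp: ext_lev_def j'_def j_def)
      show "Suc (L i0) < ext_lev I j L v" if "j' + I \<le> v" "v < j + I" for v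
        using that above_start[of "v - I"] by (auto simp: ext_lev_def j'_def j_def)
      show "k + d \<le> excess (ext_lev I j L) (j + I) I"
        using kd by (simp add: excess_ext_lev)
    qed (use jj I_pos in auto)
    moreover have "Hdet j' I B2 = P"
      unfolding P_def
    proof (rule Hdet_cong)
      fix u v assume uv: "u < j'" "I \<le> v" "v < j' + I"
      then show "B2 u v = B u v"
        using B[of "u - I" "v - I"] jj by (auto simp: B2_def)
    qed
    moreover have "Hdet (j - j') I (\<lambda>u v. B2 (j' + u) (j' + v)) = G"
    proof -
      have "j - j' = n" by (simp add: j_def j'_def)
      then show ?thesis
        unfolding G_def by (auto intro!: Hdet_cong simp: B2_def j_def j'_def add.commute add.left_commute)
    qed
    ultimately show ?thesis by simp
  qed
  have low: "coeff G b = 0" if "b < d" for b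
    unfolding G_def
  proof (rule coeff_Hdet_low)
    show "level_strict n I (\<lambda>v. L (i0 + v)) (\<lambda>u w. A $$ (i0 + u, i0 + w))"
      using strict by (auto simp: level_strict_def)
  qed (use that in \<open>simp add: d_def\<close>)
  have "coeff (P * G) (k + d) = (\<Sum>a\<le>k + d. coeff P a * coeff G (k + d - a))"
    by (rule coeff_mult)
  also have "\<dots> = (\<Sum>a\<in>{k}. coeff P a * coeff G (k + d - a))"
  proof (rule sum.mono_neutral_right)
    show "\<forall>a\<in>{..k + d} - {k}. coeff P a * coeff G (k + d - a) = 0"
    proof
      fix a assume "a \<in> {..k + d} - {k}"
      then consider "a < k" | "k + d - a < d" by fastforce
      then show "coeff P a * coeff G (k + d - a) = 0" using k(3) low by cases auto
    qed
  qed auto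
  also have "\<dots> = coeff P k * coeff G d" by simp
  finally have "coeff P k * coeff G d = 0" using zero by simp
  then show ?thesis using k(1) by (simp add: G_def d_def)
qed

end

section \<open>Stability under root subgroups\<close>

lemma mult_mat_nonzero:
  assumes "X \<in> carrier_mat N N" "Y \<in> carrier_mat N N" "r < N" "c < N" "(X * Y) $$ (r, c) \<noteq> (0 :: complex)"
  shows "\<exists>k<N. X $$ (r, k) \<noteq> 0 \<and> Y $$ (k, c) \<noteq> 0"
proof -
  have "(X * Y) $$ (r, c) = (\<Sum>k = 0..<N. X $$ (r, k) * Y $$ (k, c))"
    using assms(1-4) by (simp add: scalar_prod_def)
  then obtain k where "k < N" "X $$ (r, k) * Y $$ (k, c) \<noteq> 0"
    using assms(5) by (metis (no_types, lifting) atLeastLessThan_iff sum.not_neutral_contains_not_neutral)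
  then show ?thesis by auto
qed

text \<open>Closed sets that contain \<open>V\<close> contain its closure, so the intersection of
  the closure with \<open>S\<close> is again irreducible, and maximality of the component gives
  equality.\<close>

lemma orbital_variety_eq_closure:
  assumes comp: "irreducible_component_of X S V"
  shows "V = X closure_of V \<inter> S"
proof -
  have V: "V \<subseteq> S" "irreducible_in X V" "\<And>W. W \<subseteq> S \<Longrightarrow> irreducible_in X W \<Longrightarrow> V \<subseteq> W \<Longrightarrow> W = V"
    using comp by (auto simp: irreducible_component_of_def)
  have Vt: "V \<subseteq> topspace X" "V \<noteq> {}" using V(2) by (auto simp: irreducible_in_def)
  have sub: "V \<subseteq> X closure_of V \<inter> S" using closure_of_subset[OF Vt(1)] V(1) by auto
  have "irreducible_in X (X closure_of V \<inter> S)"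
    unfolding irreducible_in_def
  proof (intro conjI allI impI)
    show "X closure_of V \<inter> S \<subseteq> topspace X" using closure_of_subset_topspace[of X V] by blast
    show "X closure_of V \<inter> S \<noteq> {}" using sub Vt by auto
    fix C D assume CD: "closedin X C \<and> closedin X D \<and> X closure_of V \<inter> S \<subseteq> C \<union> D"
    then have "V \<subseteq> C \<or> V \<subseteq> D" using V(2) sub unfolding irreducible_in_def by blast
    then have "X closure_of V \<subseteq> C \<or> X closure_of V \<subseteq> D"
      using CD closure_of_minimal by blast
    then show "X closure_of V \<inter> S \<subseteq> C \<or> X closure_of V \<inter> S \<subseteq> D" by blast
  qed
  then show ?thesis using V(3)[OF _ _ sub] by auto
qed

text \<open>The block upper triangular matrices for the chains, that is the parabolic subalgebra
  whose nilradical is \<open>m_space N \<tau>\<close>.\<close>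

definition lev_weak :: "nat \<Rightarrow> nat set \<Rightarrow> complex mat \<Rightarrow> bool" where
  "lev_weak N \<tau> g \<longleftrightarrow> g \<in> carrier_mat N N \<and>
    (\<forall>r<N. \<forall>c<N. g $$ (r, c) \<noteq> 0 \<longrightarrow> lev \<tau> r \<le> lev \<tau> c)"

lemma lev_weak_mult:
  assumes "lev_weak N \<tau> g" "lev_weak N \<tau> h" shows "lev_weak N \<tau> (g * h)"
  unfolding lev_weak_def
proof (intro conjI allI impI)
  have gh: "g \<in> carrier_mat N N" "h \<in> carrier_mat N N" using assms by (auto simp: lev_weak_def)
  then show "g * h \<in> carrier_mat N N" by simp
  fix r c assume "r < N" "c < N" "(g * h) $$ (r, c) \<noteq> 0"
  then obtain k where k: "k < N" "g $$ (r, k) \<noteq> 0" "h $$ (k, c) \<noteq> 0" using mult_mat_nonzero[OF gh] by blast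
  then have "lev \<tau> r \<le> lev \<tau> k" "lev \<tau> k \<le> lev \<tau> c"
    using assms \<open>r < N\<close> \<open>c < N\<close> unfolding lev_weak_def by blast+
  then show "lev \<tau> r \<le> lev \<tau> c" by simp
qed

lemma conj_m_space:
  assumes g: "lev_weak N \<tau> g" "lev_weak N \<tau> h" and A: "A \<in> m_space N \<tau>"
  shows "g * A * h \<in> m_space N \<tau>"
proof -
  have carr: "g \<in> carrier_mat N N" "h \<in> carrier_mat N N" "A \<in> carrier_mat N N"
    using assms by (auto simp: lev_weak_def m_space_iff)
  have "lev \<tau> r < lev \<tau> c" if rc: "r < N" "c < N" "(g * A * h) $$ (r, c) \<noteq> 0" for r c
  proof -
    obtain k where k: "k < N" "(g * A) $$ (r, k) \<noteq> 0" "h $$ (k, c) \<noteq> 0"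
      using mult_mat_nonzero[OF mult_carrier_mat[OF carr(1,3)] carr(2)] rc by blast
    obtain l where l: "l < N" "g $$ (r, l) \<noteq> 0" "A $$ (l, k) \<noteq> 0"
      using mult_mat_nonzero[OF carr(1,3) rc(1) k(1)] k by blast
    have "lev \<tau> r \<le> lev \<tau> l" "lev \<tau> k \<le> lev \<tau> c" using g k l rc unfolding lev_weak_def by blast+
    moreover have "lev \<tau> l < lev \<tau> k" using A k l carr by (simp add: m_space_lev)
    ultimately show ?thesis by linarith
  qed
  then show ?thesis using carr by (subst m_space_lev) auto
qed

lemma GL_simps:
  "carrier (GL N) = Units (ring_mat TYPE(complex) N ())"
  "monoid.mult (GL N) = (*)" "monoid.one (GL N) = 1\<^sub>m N"
  by (simp_all add: GL_def units_of_def ring_mat_def)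

lemma group_GL: "Group.group (GL N)"
proof -
  interpret ring "ring_mat TYPE(complex) N ()" by (rule ring_mat)
  show ?thesis unfolding GL_def by (rule units_group)
qed

lemma GL_mem: "g \<in> carrier_mat N N \<Longrightarrow> h \<in> carrier_mat N N \<Longrightarrow> g * h = 1\<^sub>m N \<Longrightarrow> h * g = 1\<^sub>m N \<Longrightarrow>
    g \<in> carrier (GL N) \<and> inv\<^bsub>GL N\<^esub> g = h"
proof -
  assume gh: "g \<in> carrier_mat N N" "h \<in> carrier_mat N N" "g * h = 1\<^sub>m N" "h * g = 1\<^sub>m N"
  interpret group "GL N" by (rule group_GL)
  have "g \<in> carrier (GL N)" "h \<in> carrier (GL N)"
    using gh unfolding GL_simps Units_def by (auto simp: ring_mat_def)
  then show ?thesis using gh(4) by (auto simp: GL_simps(2,3) intro!: inv_equality)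
qed

lemma GL_inv:
  assumes "g \<in> carrier (GL N)"
  shows "g \<in> carrier_mat N N" "inv\<^bsub>GL N\<^esub> g \<in> carrier_mat N N" "g * inv\<^bsub>GL N\<^esub> g = 1\<^sub>m N" "inv\<^bsub>GL N\<^esub> g * g = 1\<^sub>m N"
    "inv\<^bsub>GL N\<^esub> g \<in> carrier (GL N)" "inv\<^bsub>GL N\<^esub> (inv\<^bsub>GL N\<^esub> g) = g"
proof -
  interpret group "GL N" by (rule group_GL)
  have sub: "carrier (GL N) \<subseteq> carrier_mat N N" unfolding GL_simps Units_def by (auto simp: ring_mat_def)
  show "inv\<^bsub>GL N\<^esub> g \<in> carrier (GL N)" using assms by simp
  then show "g \<in> carrier_mat N N" "inv\<^bsub>GL N\<^esub> g \<in> carrier_mat N N" using sub assms by auto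
  show "g * inv\<^bsub>GL N\<^esub> g = 1\<^sub>m N" using r_inv[OF assms] by (simp add: GL_simps)
  show "inv\<^bsub>GL N\<^esub> g * g = 1\<^sub>m N" using l_inv[OF assms] by (simp add: GL_simps)
  show "inv\<^bsub>GL N\<^esub> (inv\<^bsub>GL N\<^esub> g) = g" using assms by simp
qed

lemma elementary_inverse:
  assumes "a < N" "b < N" "a \<noteq> b"
  shows "(1\<^sub>m N + c \<cdot>\<^sub>m unit_mat N a b) * (1\<^sub>m N + (- c) \<cdot>\<^sub>m unit_mat N a b) = 1\<^sub>m N"
proof -
  let ?E = "unit_mat N a b"
  have c: "c \<cdot>\<^sub>m ?E \<in> carrier_mat N N" "(- c) \<cdot>\<^sub>m ?E \<in> carrier_mat N N" by simp_all
  have z: "(c \<cdot>\<^sub>m ?E) * ((- c) \<cdot>\<^sub>m ?E) = 0\<^sub>m N N"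
  proof -
    have "(c \<cdot>\<^sub>m ?E) * ((- c) \<cdot>\<^sub>m ?E) = (- c) \<cdot>\<^sub>m (c \<cdot>\<^sub>m (?E * ?E))"
      by (simp add: mult_smult_assoc_mat[of _ N N _ N] mult_smult_distrib[of _ N N _ N])
    also have EE: "?E * ?E = 0\<^sub>m N N" using assms by (simp add: unit_mat_mult)
    finally show ?thesis by simp
  qed
  have "(1\<^sub>m N + c \<cdot>\<^sub>m ?E) * (1\<^sub>m N + (- c) \<cdot>\<^sub>m ?E) =
      (1\<^sub>m N + c \<cdot>\<^sub>m ?E) * 1\<^sub>m N + (1\<^sub>m N + c \<cdot>\<^sub>m ?E) * ((- c) \<cdot>\<^sub>m ?E)"
    by (rule mult_add_distrib_mat[of _ N N _ N]) (use c in auto)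
  also have "(1\<^sub>m N + c \<cdot>\<^sub>m ?E) * ((- c) \<cdot>\<^sub>m ?E) = 1\<^sub>m N * ((- c) \<cdot>\<^sub>m ?E) + (c \<cdot>\<^sub>m ?E) * ((- c) \<cdot>\<^sub>m ?E)"
    by (rule add_mult_distrib_mat[of _ N N _ _ N]) (use c in auto)
  finally have e: "(1\<^sub>m N + c \<cdot>\<^sub>m ?E) * (1\<^sub>m N + (- c) \<cdot>\<^sub>m ?E) =
      (1\<^sub>m N + c \<cdot>\<^sub>m ?E) * 1\<^sub>m N + (1\<^sub>m N * ((- c) \<cdot>\<^sub>m ?E) + 0\<^sub>m N N)" unfolding z .
  show ?thesis unfolding e by (rule eq_matI) (simp_all add: unit_mat_def)
qed

text \<open>For \<open>k\<close> in \<open>\<tau>\<close> the numbers \<open>k\<close> and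
  \<open>k + 1\<close> are in one chain, so the unit matrices at both off-diagonal positions lie in
  a diagonal block; the inverse of a generator only changes the sign of its parameter.\<close>

lemma root_group_lev_weak:
  assumes k: "k \<in> \<tau>" "1 \<le> k" "k < N" and g: "g \<in> root_group N k"
  shows "g \<in> carrier (GL N) \<and> lev_weak N \<tau> g \<and> lev_weak N \<tau> (inv\<^bsub>GL N\<^esub> g)"
proof -
  interpret group "GL N" by (rule group_GL)
  have lv: "lev \<tau> k = lev \<tau> (k - 1)" using lev_Suc[of \<tau> "k - 1"] k by simp
  have E: "root_vec N (k, k) = unit_mat N (k - 1) k" using k by (simp add: root_vec_unit_mat)
  have Et: "transpose_mat (unit_mat N (k - 1) k) = unit_mat N k (k - 1)"
    by (rule eq_matI) (auto simp: unit_mat_def)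
  have weak: "lev_weak N \<tau> (1\<^sub>m N + c \<cdot>\<^sub>m unit_mat N a b)" if "lev \<tau> a = lev \<tau> b" for c a b
    using that by (auto simp: lev_weak_def unit_mat_def split: if_splits)
  have gen: "h \<in> carrier (GL N) \<and> lev_weak N \<tau> h \<and> lev_weak N \<tau> (inv\<^bsub>GL N\<^esub> h)"
    if h: "h = 1\<^sub>m N + c \<cdot>\<^sub>m unit_mat N a b" and ab: "a < N" "b < N" "a \<noteq> b" "lev \<tau> a = lev \<tau> b" for h c a b
  proof -
    have "h \<in> carrier (GL N) \<and> inv\<^bsub>GL N\<^esub> h = 1\<^sub>m N + (- c) \<cdot>\<^sub>m unit_mat N a b"
      unfolding h by (rule GL_mem) (use elementary_inverse[OF ab(1-3), of c] elementary_inverse[OF ab(1-3), of "- c"] in auto)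
    then show ?thesis using weak[OF ab(4)] h by simp
  qed
  have H: "h \<in> carrier (GL N) \<and> lev_weak N \<tau> h \<and> lev_weak N \<tau> (inv\<^bsub>GL N\<^esub> h)"
    if "h \<in> range (\<lambda>c. 1\<^sub>m N + c \<cdot>\<^sub>m root_vec N (k, k)) \<union> range (\<lambda>c. 1\<^sub>m N + c \<cdot>\<^sub>m transpose_mat (root_vec N (k, k)))" for h
    using that gen[of h _ "k - 1" k] gen[of h _ k "k - 1"] lv k unfolding E Et by auto
  show ?thesis
    using g unfolding root_group_def
  proof induction
    case one
    have "lev_weak N \<tau> (1\<^sub>m N)" by (auto simp: lev_weak_def)
    then show ?case using one_closed inv_one by (simp add: GL_simps(3))
  next
    case (incl h)
    then show ?case using H by blast
  next
    case (inv h)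
    then show ?case using H[OF inv] by simp
  next
    case (eng g h)
    then show ?case by (simp add: inv_mult_group) (simp add: GL_simps(2) lev_weak_mult)
  qed
qed

text \<open>Such a variety is the intersection of the nilradical with one nilpotent orbit, and both
  are stable under the root subgroups of \<open>\<tau>\<close>, as these lie in the parabolic
  subgroup. This serves to refute the case of degree one.\<close>

lemma tau_of_m_space_closure:
  assumes V: "orbital_variety N V" and cl: "zariski N closure_of V = m_space N \<tau>" and \<tau>: "\<tau> \<subseteq> {1..<N}"
  shows "\<tau> \<subseteq> tau N V"
proof
  fix k assume k: "k \<in> \<tau>"
  then have k': "1 \<le> k" "k < N" using \<tau> by auto
  obtain lam where comp: "irreducible_component_of (zariski N) (nilp_orbit N lam \<inter> strict_upper N) V"
    using V by (auto simp: orbital_variety_def)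
  have Veq: "V = m_space N \<tau> \<inter> nilp_orbit N lam"
    using orbital_variety_eq_closure[OF comp] cl by (auto simp: m_space_def)
  have conj: "g * A * inv\<^bsub>GL N\<^esub> g \<in> V"
    if g: "g \<in> carrier (GL N)" "lev_weak N \<tau> g" "lev_weak N \<tau> (inv\<^bsub>GL N\<^esub> g)" and A: "A \<in> V" for g A
  proof -
    note gi = GL_inv[OF g(1)]
    have Ac: "A \<in> carrier_mat N N" using A Veq by (auto simp: nilp_orbit_def)
    have "similar_mat (g * A * inv\<^bsub>GL N\<^esub> g) A"
      by (rule similar_matI[of _ _ g "inv\<^bsub>GL N\<^esub> g" N]) (use gi Ac in auto)
    then have "g * A * inv\<^bsub>GL N\<^esub> g \<in> nilp_orbit N lam"
      using A Veq gi(1,2) Ac similar_mat_trans by (auto simp: nilp_orbit_def jordan_nf_def)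
    then show ?thesis using conj_m_space[OF g(2,3)] A Veq by auto
  qed
  have "(\<lambda>A. g * A * inv\<^bsub>GL N\<^esub> g) ` V = V" if "g \<in> root_group N k" for g
  proof
    have g: "g \<in> carrier (GL N)" "lev_weak N \<tau> g" "lev_weak N \<tau> (inv\<^bsub>GL N\<^esub> g)"
      using root_group_lev_weak[OF k k' that] by auto
    note gi = GL_inv[OF g(1)]
    show "(\<lambda>A. g * A * inv\<^bsub>GL N\<^esub> g) ` V \<subseteq> V" using conj[OF g] by auto
    show "V \<subseteq> (\<lambda>A. g * A * inv\<^bsub>GL N\<^esub> g) ` V"
    proof
      fix A assume A: "A \<in> V"
      then have Ac: "A \<in> carrier_mat N N" using Veq by (auto simp: nilp_orbit_def)
      let ?h = "inv\<^bsub>GL N\<^esub> g"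
      have "?h * A * g \<in> V" using conj[of ?h A] g gi A by simp
      moreover have "g * (?h * A * g) * ?h = A"
      proof -
        have "g * (?h * A * g) * ?h = (g * ?h) * A * (g * ?h)"
          using gi(1,2) Ac by (simp add: assoc_mult_mat[of _ N N _ N _ N])
        then show ?thesis using gi(3) Ac by simp
      qed
      ultimately show "A \<in> (\<lambda>A. g * A * ?h) ` V" by (metis imageI)
    qed
  qed
  then show "k \<in> tau N V" using k' by (simp add: tau_def simple_roots_def)
qed

section \<open>The closure as a hypersurface\<close>

lemma excess_Suc: "excess L (Suc k) I = excess L k I + (if I \<le> gpos L k then 1 else 0)"
proof -
  have "{v. v < Suc k \<and> I \<le> gpos L v} =
      (if I \<le> gpos L k then insert k {v. v < k \<and> I \<le> gpos L v} else {v. v < k \<and> I \<le> gpos L v})"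
    by (auto simp: less_Suc_eq)
  then show ?thesis unfolding excess_gpos by (simp split: if_splits)
qed

text \<open>Joins the two numberings: vertex \<open>u\<close> of the path polynomial is matrix index
  \<open>i0 + u\<close>.\<close>

locale nilradical_chains =
  C: two_chains "lev \<tau>" i0 n I + P: path_poly n I i0 "\<lambda>v. lev \<tau> (i0 + v)" for \<tau> i0 n I +
  fixes N :: nat
  assumes N_ge: "i0 + n + I \<le> N"
begin

lemma edge_less: "(u, w) \<in> P.all_edges \<Longrightarrow> u < w"
  using P.all_edges_bound[of u w] lev_mono[of "i0 + w" "i0 + u" \<tau>] by (metis leD leI nat_add_left_cancel_le)

lemma vars_fpoly_free: "vars P.fpoly \<subseteq> free_pos N \<tau>"
proof
  fix v assume "v \<in> vars P.fpoly"
  then obtain u w where v: "v = (Suc (i0 + u), Suc (i0 + w))" and e: "(u, w) \<in> P.all_edges"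
    by (auto simp: P.vars_fpoly P.pvar_def)
  have "lev \<tau> (i0 + u) < lev \<tau> (i0 + w)" "w < n + I" using P.all_edges_bound[OF e] by auto
  then show "v \<in> free_pos N \<tau>"
    using edge_less[OF e] N_ge lev_less_iff[of "i0 + u" "i0 + w" \<tau>] by (simp add: v free_pos_iff)
qed

lemma vars_fpoly_triangle: "vars P.fpoly \<subseteq> pos_triangle (Suc i0) (i0 + n + I)"
proof
  fix v assume "v \<in> vars P.fpoly"
  then obtain u w where v: "v = (Suc (i0 + u), Suc (i0 + w))" and e: "(u, w) \<in> P.all_edges"
    by (auto simp: P.vars_fpoly P.pvar_def)
  then show "v \<in> pos_triangle (Suc i0) (i0 + n + I)"
    using edge_less[OF e] P.all_edges_bound[OF e] by (simp add: pos_triangle_def)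
qed

lemma vars_fpoly_extreme:
  "\<exists>w. (Suc i0, w) \<in> vars P.fpoly" "\<exists>u. (u, i0 + n + I) \<in> vars P.fpoly"
proof -
  have "P.pvar 0 (P.first (Suc (lev \<tau> (i0 + 0)))) \<in> vars P.fpoly"
    using P.row_first_edge unfolding P.vars_fpoly by (rule image_eqI[rotated]) simp
  then show "\<exists>w. (Suc i0, w) \<in> vars P.fpoly" by (auto simp: P.pvar_def)
  obtain u where "(u, n + I - 1) \<in> P.all_edges" using P.column_last_edge by blast
  then have "P.pvar u (n + I - 1) \<in> vars P.fpoly"
    unfolding P.vars_fpoly by (rule image_eqI[rotated]) simp
  moreover have "P.pvar u (n + I - 1) = (Suc (i0 + u), i0 + n + I)" using P.I_pos by (simp add: P.pvar_def)
  ultimately show "\<exists>u. (u, i0 + n + I) \<in> vars P.fpoly" by metis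
qed

text \<open>A nonzero value at one point would occur also at a generic point, where both corners
  have the Jordan types prescribed by \<open>T\<close>: the large one is divisible by one power of
  \<open>z\<close> more than its excess, the small one is not. There \<open>coeff_vanish\<close>
  gives the contradiction.\<close>

lemma eval_fpoly_vanishes:
  assumes irr: "irreducible_in (zariski N) V" and V: "V \<subseteq> m_space N \<tau>" and T: "tableau_of N V T"
    and below_end: "below T I (i0 + n + I) = Suc (excess (lev \<tau>) (i0 + n + I) I)"
    and below_start: "below T I (i0 + I) = excess (lev \<tau>) (i0 + I) I"
    and A: "A \<in> V"
  shows "eval_mpoly P.fpoly A = 0"
proof (rule ccontr)
  assume nz: "eval_mpoly P.fpoly A \<noteq> 0"
  have Vu: "V \<subseteq> strict_upper N" using V by (auto simp: m_space_def)
  have Vc: "V \<subseteq> carrier_mat N N" using Vu by (auto simp: strict_upper_def)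
  have box: "vars P.fpoly \<subseteq> box N" using vars_fpoly_free free_pos_box by blast
  have generic: "\<exists>U. openin (zariski N) U \<and> U \<inter> V \<noteq> {} \<and>
      (\<forall>A\<in>U \<inter> V. \<forall>e. hdiv k (corner k A) I e \<longleftrightarrow> e \<le> below T I k)" if k: "k \<le> N" for k
  proof -
    obtain U where "openin (zariski N) U" "U \<inter> V \<noteq> {}"
      "\<And>A I e. A \<in> U \<inter> V \<Longrightarrow> hdiv k (corner k A) I e \<longleftrightarrow> e \<le> below T I k"
      using tableau_of_hdiv[OF T Vu k] by blast
    then show ?thesis by (intro exI[of _ U]) simp
  qed
  have k: "i0 + I \<le> N" using N_ge by simp
  obtain U1 where U1: "openin (zariski N) U1" "U1 \<inter> V \<noteq> {}" "\<forall>A\<in>U1 \<inter> V. \<forall>e.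
      hdiv (i0 + n + I) (corner (i0 + n + I) A) I e \<longleftrightarrow> e \<le> below T I (i0 + n + I)"
    using generic[OF N_ge] by (elim exE conjE) (rule that)
  obtain U2 where U2: "openin (zariski N) U2" "U2 \<inter> V \<noteq> {}" "\<forall>A\<in>U2 \<inter> V. \<forall>e.
      hdiv (i0 + I) (corner (i0 + I) A) I e \<longleftrightarrow> e \<le> below T I (i0 + I)"
    using generic[OF k] by (elim exE conjE) (rule that)
  let ?D = "{A \<in> carrier_mat N N. eval_mpoly P.fpoly A \<noteq> 0}"
  have D: "openin (zariski N) ?D" "?D \<inter> V \<noteq> {}"
    using openin_zariski_basic[OF box] nz A Vc by auto
  have "U1 \<inter> U2 \<inter> V \<noteq> {}" by (rule irreducible_in_open_Int[OF irr U1(1) U2(1) U1(2) U2(2)])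
  then have "(U1 \<inter> U2) \<inter> ?D \<inter> V \<noteq> {}"
    by (rule irreducible_in_open_Int[OF irr openin_Int[OF U1(1) U2(1)] D(1) _ D(2)])
  then obtain B where B: "B \<in> U1 \<inter> V" "B \<in> U2 \<inter> V" "eval_mpoly P.fpoly B \<noteq> 0" by blast
  have Bm: "B \<in> m_space N \<tau>" "B \<in> carrier_mat N N" using B(1) V Vc by auto
  have strict: "lev \<tau> a < lev \<tau> b" if "a < i0 + n + I" "b < i0 + n + I" "B $$ (a, b) \<noteq> 0" for a b
    using Bm that N_ge by (simp add: m_space_lev)
  have "coeff (Hdet n I (\<lambda>u w. B $$ (i0 + u, i0 + w))) (excess (\<lambda>v. lev \<tau> (i0 + v)) (n + I) I) = 0"
  proof (rule C.coeff_vanish)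
    show "lev \<tau> a < lev \<tau> b" if "a < i0 + n + I" "b < i0 + n + I" "B $$ (a, b) \<noteq> 0" for a b
      by (rule strict[OF that])
    show "\<not> hdiv (i0 + I) (corner (i0 + I) B) I (Suc (excess (lev \<tau>) (i0 + I) I))"
      unfolding U2(3)[rule_format, OF B(2)] below_start by simp
    show "hdiv (i0 + n + I) (corner (i0 + n + I) B) I (Suc (excess (lev \<tau>) (i0 + n + I) I))"
      unfolding U1(3)[rule_format, OF B(1)] below_end by simp
  qed
  moreover have "ev (coord B) P.fpoly = coeff (Hdet n I (\<lambda>u w. B $$ (i0 + u, i0 + w))) P.d"
    by (rule P.ev_fpoly_Hdet) (use strict in \<open>auto simp: level_strict_def coord_def P.pvar_def\<close>)
  ultimately show False using B(3) by (simp add: eval_mpoly_ev P.d_def)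
qed

lemma closure_hypersurface:
  assumes irr: "irreducible_in (zariski N) V" and cl: "zariski N closure_of V \<subseteq> m_space N \<tau>"
    and V: "V \<subseteq> carrier_mat N N"
    and codim: "codim (zariski N) (zariski N closure_of V) (m_space N \<tau>) = 1"
    and vanish: "\<And>A. A \<in> V \<Longrightarrow> eval_mpoly P.fpoly A = 0"
  shows "zariski N closure_of V = hypersurface N \<tau> P.fpoly"
proof -
  note h = hypersurface_props[OF P.multilinear_fpoly P.prime_fpoly vars_fpoly_free]
  have "V \<subseteq> m_space N \<tau>" using closure_of_subset[of V "zariski N"] V cl by simp
  then have "V \<subseteq> hypersurface N \<tau> P.fpoly" using vanish by (auto simp: hypersurface_def)
  then have "zariski N closure_of V \<subseteq> hypersurface N \<tau> P.fpoly"
    using h(2) by (rule closure_of_minimal)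
  then show ?thesis
    using codim_one_unique[OF codim closedin_closure_of irreducible_in_closure[OF irr] h(2,1)
        closedin_m_space irreducible_m_space] h(3) by blast
qed

text \<open>All generators have the variables of \<open>fpoly\<close>, so the description in
  \<open>sigma_set\<close> has a unique solution: the interval given by the smallest row and the
  largest column that occur.\<close>

lemma sigma_set_eq:
  assumes cl: "zariski N closure_of V = hypersurface N \<tau> P.fpoly" and tau: "tau N V = \<tau>"
    and deg: "I \<noteq> 1 \<or> Suc (lev \<tau> i0) \<noteq> lev \<tau> (i0 + n)"
  shows "sigma_set N V = {Suc i0..i0 + n + I - 1}"
proof -
  have f: "vars P.fpoly \<subseteq> free_pos N (tau N V)" and cl': "zariski N closure_of V = hypersurface N (tau N V) P.fpoly"
    using vars_fpoly_free cl tau by auto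
  note gen = nonlinear_generator_hypersurface[OF P.multilinear_fpoly P.prime_fpoly f cl']
  have ng: "nonlinear_generator N V P.fpoly"
    using P.degree_fpoly deg by (intro gen(1)[OF P.homogeneous_fpoly]) simp
  obtain w u where wu: "(Suc i0, w) \<in> vars P.fpoly" "(u, i0 + n + I) \<in> vars P.fpoly"
    using vars_fpoly_extreme by blast
  have iff: "is_sigma_set N g \<sigma> \<longleftrightarrow> \<sigma> = {Suc i0..i0 + n + I - 1}" if "nonlinear_generator N V g" for g \<sigma>
    using gen(2)[OF that] vars_fpoly_triangle wu N_ge
    by (intro is_sigma_set_interval[of g _ _ w u]) simp_all
  show ?thesis unfolding sigma_set_def using ng iff by (intro the_equality) blast+
qed

text \<open>Two singleton chains that follow each other would give a linear equation, and the closure would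
  be the nilradical belonging to a larger set of simple roots.\<close>

lemma hypersurface_m_space:
  assumes I: "I = 1" "Suc (lev \<tau> i0) = lev \<tau> (i0 + n)"
    and last: "\<And>v. v < N \<Longrightarrow> lev \<tau> v = lev \<tau> (i0 + n) \<Longrightarrow> v < i0 + n + I"
  shows "Suc i0 \<notin> \<tau>" "hypersurface N \<tau> P.fpoly = m_space N (insert (Suc i0) \<tau>)"
proof -
  \<comment> \<open>A vertex between the two singleton chains would need a level strictly between
    consecutive ones.\<close>
  have n1: "n = 1"
  proof (rule ccontr)
    assume "n \<noteq> 1"
    then have "1 < n" using P.I_pos P.I_le by linarith
    then have "lev \<tau> (Suc i0) \<noteq> lev \<tau> i0" "lev \<tau> (Suc i0) \<noteq> lev \<tau> (i0 + n)"
      using C.start[of "Suc i0"] C.end_[of "Suc i0"] I(1) by auto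
    then show False using lev_Suc[of \<tau> i0] I(2) by (simp split: if_splits)
  qed
  show i: "Suc i0 \<notin> \<tau>" using lev_Suc[of \<tau> i0] I(2) n1 by auto
  have pred: "i0 \<notin> \<tau>" if "0 < i0"
  proof -
    have "i0 - 1 < i0 + n + I" "\<not> i0 \<le> i0 - 1" using that by simp_all
    then have "lev \<tau> (i0 - 1) \<noteq> lev \<tau> i0" using C.start by metis
    then show ?thesis using lev_Suc[of \<tau> "i0 - 1"] that by auto
  qed
  have succ: "Suc (Suc i0) \<notin> \<tau>" if "Suc (Suc i0) < N"
    using lev_Suc[of \<tau> "Suc i0"] last[of "Suc (Suc i0)"] that n1 I(1) by auto
  have free: "free_pos N (insert (Suc i0) \<tau>) = free_pos N \<tau> - {(Suc i0, Suc (Suc i0))}"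
  proof (rule Set.set_eqI, clarify)
    fix a b
    \<comment> \<open>An interval that needs the new root contains \<open>Suc i0\<close>. Its
      neighbours are not in \<open>\<tau>\<close> because both chains are singletons, so the
      interval consists of this root only.\<close>
    have eq: "a = Suc i0 \<and> b = Suc (Suc i0)"
      if sub: "{a..<b} \<subseteq> insert (Suc i0) \<tau>" and ns: "\<not> {a..<b} \<subseteq> \<tau>" and ab: "1 \<le> a" "b \<le> N"
    proof -
      have mem: "a \<le> Suc i0" "Suc i0 < b" using sub ns by (auto simp: subset_iff)
      have "\<not> a \<le> i0" using sub[THEN subsetD, of i0] pred mem ab by auto
      moreover have "\<not> Suc (Suc i0) < b" using sub[THEN subsetD, of "Suc (Suc i0)"] succ mem ab by auto
      ultimately show ?thesis using mem by linarith
    qed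
    have "{Suc i0..<Suc (Suc i0)} \<subseteq> insert (Suc i0) \<tau>" by auto
    moreover have "{a..<b} \<subseteq> insert (Suc i0) \<tau>" if "{a..<b} \<subseteq> \<tau>" using that by blast
    ultimately show "(a, b) \<in> free_pos N (insert (Suc i0) \<tau>) \<longleftrightarrow>
        (a, b) \<in> free_pos N \<tau> - {(Suc i0, Suc (Suc i0))}"
      unfolding Diff_iff singleton_iff free_pos_iff prod.inject using eq by blast
  qed
  have Ne: "Suc (Suc i0) \<le> N" using N_ge n1 I(1) by simp
  have free1: "(Suc i0, Suc (Suc i0)) \<in> free_pos N \<tau>" using i Ne by (auto simp: free_pos_iff)
  have d0: "P.d = 0"
  proof -
    have "gpos (\<lambda>v. lev \<tau> (i0 + v)) v = 0" if "v < 2" for v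
      using that I(2) n1 by (auto simp: gpos_def less_Suc_eq numeral_2_eq_2)
    then have "{v. v < 2 \<and> 1 \<le> gpos (\<lambda>v. lev \<tau> (i0 + v)) v} = {}" by force
    then show ?thesis unfolding P.d_def unfolding excess_gpos n1 I(1) by (simp only: one_add_one card.empty)
  qed
  \<comment> \<open>No vertex is left out, and for \<open>n = 1\<close> the determinant is the
    single entry at the position of the new root.\<close>
  have val: "eval_mpoly P.fpoly A = coord A (Suc i0, Suc (Suc i0))" if "A \<in> m_space N \<tau>" for A
  proof -
    have A: "A \<in> carrier_mat N N" using that by (simp add: m_space_iff)
    have "level_strict n I (\<lambda>v. lev \<tau> (i0 + v)) (\<lambda>u w. A $$ (i0 + u, i0 + w))"
      using that A N_ge by (simp add: m_space_lev level_strict_def)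
    then have "ev (coord A) P.fpoly = coeff (Hdet n I (\<lambda>u w. A $$ (i0 + u, i0 + w))) P.d"
      by (rule P.ev_fpoly_Hdet) (simp add: coord_def P.pvar_def)
    also have "\<dots> = A $$ (i0, Suc i0)"
      unfolding d0 by (simp add: n1 I(1) Hdet_def det_single Hmat_def)
    finally show ?thesis by (simp add: eval_mpoly_ev coord_def)
  qed
  show "hypersurface N \<tau> P.fpoly = m_space N (insert (Suc i0) \<tau>)"
  proof (rule Set.set_eqI)
    fix A
    have "A \<in> m_space N (insert (Suc i0) \<tau>) \<longleftrightarrow> A \<in> m_space N \<tau> \<and> coord A (Suc i0, Suc (Suc i0)) = 0"
      unfolding m_space_iff free using free1 free_pos_box[of N \<tau>] by auto
    then show "A \<in> hypersurface N \<tau> P.fpoly \<longleftrightarrow> A \<in> m_space N (insert (Suc i0) \<tau>)"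
      unfolding hypersurface_def using val by auto
  qed
qed

end

section \<open>Chains of the Richardson tableau\<close>

lemma finite_lev_set [simp]: "finite (lev_set N \<tau> l)"
  by (simp add: lev_set_def)

lemma lev_set_interval:
  assumes ne: "lev_set N \<tau> l \<noteq> {}"
  shows "lev_set N \<tau> l = {Min (lev_set N \<tau> l)..Max (lev_set N \<tau> l)}"
proof -
  have conv: "v \<in> lev_set N \<tau> l" if "a \<in> lev_set N \<tau> l" "b \<in> lev_set N \<tau> l" "a \<le> v" "v \<le> b" for a b v
  proof -
    have "lev \<tau> (a - 1) \<le> lev \<tau> (v - 1)" "lev \<tau> (v - 1) \<le> lev \<tau> (b - 1)"
      using that by (intro lev_mono; simp)+
    then show ?thesis using that by (simp add: lev_set_def)
  qed
  have "{Min (lev_set N \<tau> l)..Max (lev_set N \<tau> l)} \<subseteq> lev_set N \<tau> l"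
  proof
    fix v assume "v \<in> {Min (lev_set N \<tau> l)..Max (lev_set N \<tau> l)}"
    then show "v \<in> lev_set N \<tau> l"
      unfolding atLeastAtMost_iff
      by (elim conjE) (rule conv[OF Min_in[OF finite_lev_set ne] Max_in[OF finite_lev_set ne]])
  qed
  then show ?thesis by (intro equalityI) auto
qed

lemma lev_set_nonempty: "1 \<le> N \<Longrightarrow> l \<le> lev \<tau> (N - 1) \<Longrightarrow> lev_set N \<tau> l \<noteq> {}"
proof -
  assume "1 \<le> N" "l \<le> lev \<tau> (N - 1)"
  then obtain v where "v \<le> N - 1" "lev \<tau> v = l" using lev_surj by blast
  then have "Suc v \<in> lev_set N \<tau> l" using \<open>1 \<le> N\<close> by (auto simp: lev_set_def)
  then show ?thesis by blast
qed

text \<open>Each level has at most one vertex more than its excess over 1. This turns the length of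
  the first row of the Richardson tableau into a bound for the number of chains.\<close>

lemma levels_bound:
  assumes "1 \<le> N"
  shows "N \<le> Suc (lev \<tau> (N - 1)) + excess (lev \<tau>) N 1"
proof -
  let ?M = "lev \<tau> (N - 1)"
  have le: "lev \<tau> v \<le> ?M" if "v < N" for v using that by (intro lev_mono) simp
  have "N = (\<Sum>v\<in>{..<N}. 1)" by simp
  also have "\<dots> = (\<Sum>l\<in>{..?M}. \<Sum>v\<in>{v \<in> {..<N}. lev \<tau> v = l}. 1)"
    by (rule sum.group[symmetric]) (use le in auto)
  also have "\<dots> = (\<Sum>l\<le>?M. level_card (lev \<tau>) N l)" by (simp add: level_card_def)
  also have "\<dots> \<le> (\<Sum>l\<le>?M. 1 + (level_card (lev \<tau>) N l - 1))" by (rule sum_mono) simp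
  also have "\<dots> = Suc ?M + (\<Sum>l\<le>?M. level_card (lev \<tau>) N l - 1)"
    unfolding sum.distrib by simp
  also have "(\<Sum>l\<le>?M. level_card (lev \<tau>) N l - 1) = excess (lev \<tau>) N 1"
    by (rule excess_sum[symmetric]) (rule le)
  finally show ?thesis .
qed

text \<open>For \<open>N = 0\<close> the space has at most one element, so there is no strict
  inclusion between nonempty subsets and the codimension is 0.\<close>

lemma codim_one_carrier_pos:
  assumes "codim (zariski N) Y (m_space N \<tau>) = 1" shows "1 \<le> N"
proof (rule ccontr)
  assume "\<not> 1 \<le> N"
  then have N: "N = 0" by simp
  have single: "A = B" if "A \<in> m_space N \<tau>" "B \<in> m_space N \<tau>" for A B
    using that by (intro eq_matI) (auto simp: m_space_iff N)
  have "codim (zariski N) Y (m_space N \<tau>) \<le> 0"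
    unfolding codim_def
  proof (rule Sup_least, clarify)
    fix k and Z :: "nat \<Rightarrow> complex mat set"
    assume Z: "Z k \<subseteq> m_space N \<tau>" "\<forall>j\<le>k. closedin (zariski N) (Z j) \<and> irreducible_in (zariski N) (Z j)"
      "\<forall>j<k. Z j \<subset> Z (Suc j)"
    have "k = 0"
    proof (rule ccontr)
      assume "k \<noteq> 0"
      then have "Z (k - 1) \<subset> Z k" using Z(3)[rule_format, of "k - 1"] by simp
      moreover obtain A where "A \<in> Z (k - 1)"
        using Z(2)[rule_format, of "k - 1"] by (auto simp: irreducible_in_def)
      ultimately show False using single Z(1) by blast
    qed
    then show "enat k \<le> 0" by (simp add: zero_enat_def)
  qed
  then show False using assms by simp
qed

theorem corollary1:
  fixes N t s i j I :: nat
    and V VR :: "complex mat set"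
    and T TR :: "nat list list"
    and lam :: "nat list"
  assumes "hypersurface_orbital_variety N V"
    and "tableau_of N V T"
    and "richardson_orbital_variety N (tau N V) VR"
    and "tableau_of N VR TR"
    and "lam = map length TR"
    and "t \<in> {1..lam ! 0}"
    and "j = Max (chain N (tau N VR) t)"
    and "T = drop_box j TR"
    and "I = card (chain N (tau N VR) t)"
    and "s \<in> {1..<t}"
    and "card (chain N (tau N VR) s) = I"
    and "\<forall>r. s < r \<and> r < t \<longrightarrow> card (chain N (tau N VR) r) \<noteq> I"
    and "i = Min (chain N (tau N VR) s)"
  shows "sigma_set N V = {i..j - 1}"
proof -
  define \<tau> where "\<tau> = tau N V"
  define M where "M = lev \<tau> (N - 1)"
  have tau_VR: "tau N VR = \<tau>" and clR: "zariski N closure_of VR = m_space N \<tau>" and VR: "orbital_variety N VR"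
    using assms(3) by (auto simp: richardson_orbital_variety_def \<tau>_def)
  have V: "orbital_variety N V" and clV: "zariski N closure_of V \<subseteq> m_space N \<tau>"
    and codim: "codim (zariski N) (zariski N closure_of V) (m_space N \<tau>) = 1"
    using assms(1) by (auto simp: hypersurface_orbital_variety_def \<tau>_def)
  have irrV: "irreducible_in (zariski N) V" and upV: "V \<subseteq> strict_upper N"
    using V by (auto simp: orbital_variety_def irreducible_component_of_def)
  have irrR: "irreducible_in (zariski N) VR" and upR: "VR \<subseteq> strict_upper N"
    using VR by (auto simp: orbital_variety_def irreducible_component_of_def)
  have \<tau>: "\<tau> \<subseteq> {1..<N}" by (auto simp: \<tau>_def tau_def simple_roots_def)
  have N: "1 \<le> N" using codim by (rule codim_one_carrier_pos)
  have VC: "V \<subseteq> carrier_mat N N" using upV by (auto simp: strict_upper_def)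
  have Vm: "V \<subseteq> m_space N \<tau>" using closure_of_subset[of V "zariski N"] VC clV by simp
  have stR: "standard_tableau N TR" using assms(4) by (simp add: tableau_of_def)
  have belowR: "below TR J k = excess (lev \<tau>) k J" if "k \<le> N" for J k
    by (rule below_richardson[OF irrR upR clR assms(4) that])

  have t0: "1 \<le> t" using assms(6) by simp
  \<comment> \<open>The first row of \<open>TR\<close> has \<open>N\<close> minus the boxes below
    it, that is \<open>N\<close> minus the excess over 1, and this is at most the number
    \<open>M + 1\<close> of levels.\<close>
  have tM: "t \<le> Suc M"
  proof -
    have "TR \<noteq> []" using stR N by (auto simp: standard_tableau_def)
    then have "t \<le> length (TR ! 0)" using assms(5,6) by simp
    then show ?thesis using levels_bound[OF N, of \<tau>] by (simp add: first_row_length[OF stR N] belowR M_def)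
  qed
  have chain: "chain N (tau N VR) q = lev_set N \<tau> (q - 1)" if "1 \<le> q" "q \<le> t" for q
    unfolding tau_VR by (rule chain_lev_set[OF \<tau> N]) (use that tM in \<open>auto simp: M_def\<close>)
  have s: "1 \<le> s" "s < t" using assms(10) by auto
  have ne: "lev_set N \<tau> (q - 1) \<noteq> {}" if "q \<le> t" for q
    using that tM by (intro lev_set_nonempty[OF N]) (simp add: M_def)
  have Cs: "lev_set N \<tau> (s - 1) = {i..Max (lev_set N \<tau> (s - 1))}"
    using lev_set_interval[OF ne[of s]] s chain[of s] assms(13) by simp
  have Ct: "lev_set N \<tau> (t - 1) = {Min (lev_set N \<tau> (t - 1))..j}"
    using lev_set_interval[OF ne[of t]] t0 chain[of t] assms(7) by simp
  have cards: "card (lev_set N \<tau> (s - 1)) = I" "card (lev_set N \<tau> (t - 1)) = I"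
    using assms(9,11) chain[of s] chain[of t] s t0 by auto
  have I: "0 < I" using cards(2) ne[of t] by (auto simp: card_gt_0_iff lev_set_def)
  have "i \<in> lev_set N \<tau> (s - 1)"
    unfolding assms(13) chain[OF s(1) less_imp_le[OF s(2)]] using ne[of s] s by (intro Min_in) simp_all
  then have i1: "1 \<le> i" by (simp add: lev_set_def)
  have Cs': "lev_set N \<tau> (s - 1) = {i..<i + I}"
  proof -
    define b where "b = Max (lev_set N \<tau> (s - 1))"
    have eq: "lev_set N \<tau> (s - 1) = {i..b}" using Cs by (simp add: b_def)
    then have "Suc b - i = I" using cards(1) by simp
    then have "Suc b = i + I" using I by simp
    then show ?thesis unfolding eq by (metis atLeastLessThanSuc_atLeastAtMost)
  qed
  have jI: "I \<le> j" and Ct': "lev_set N \<tau> (t - 1) = {Suc j - I..j}"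
  proof -
    define a where "a = Min (lev_set N \<tau> (t - 1))"
    have eq: "lev_set N \<tau> (t - 1) = {a..j}" using Ct by (simp add: a_def)
    then have "Suc j - a = I" using cards(2) by simp
    moreover have "1 \<le> a" using eq I cards(2) by (force simp: lev_set_def)
    ultimately show "I \<le> j" "lev_set N \<tau> (t - 1) = {Suc j - I..j}" using I eq by auto
  qed
  have memS: "v < N \<and> lev \<tau> v = s - 1 \<longleftrightarrow> i \<le> Suc v \<and> Suc v < i + I" for v
    using arg_cong[OF Cs', of "\<lambda>X. Suc v \<in> X"] by (simp add: lev_set_def Suc_le_eq)
  have memT: "v < N \<and> lev \<tau> v = t - 1 \<longleftrightarrow> Suc j - I \<le> Suc v \<and> Suc v \<le> j" for v
    using arg_cong[OF Ct', of "\<lambda>X. Suc v \<in> X"] by (simp add: lev_set_def Suc_le_eq)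
  have jN: "j \<le> N" "lev \<tau> (j - 1) = t - 1" "lev \<tau> (j - I) = t - 1"
    using memT[of "j - 1"] memT[of "j - I"] I jI by auto
  have levi: "lev \<tau> (i - 1) = s - 1" "lev \<tau> (i + I - 2) = s - 1"
    using memS[of "i - 1"] memS[of "i + I - 2"] I i1 by auto

  \<comment> \<open>Vertices are counted from 0, hence \<open>i - 1\<close>; \<open>n\<close> is
    chosen such that the upper chain begins at vertex \<open>j - I\<close>, so that
    \<open>i0 + n + I = j\<close>.\<close>
  define i0 n where "i0 = i - 1" and "n = j - I - i0"
  have before: "i0 + I \<le> j - I"
  proof (rule ccontr)
    assume "\<not> i0 + I \<le> j - I"
    then have "lev \<tau> (j - I) \<le> lev \<tau> (i + I - 2)" by (intro lev_mono) (use i1 in \<open>simp add: i0_def\<close>)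
    then show False using levi jN s by simp
  qed
  have n: "i0 + n = j - I" "i0 + n + I = j" "I \<le> n" using before jI by (auto simp: n_def)
  have start: "lev \<tau> v = lev \<tau> i0 \<longleftrightarrow> i0 \<le> v \<and> v < i0 + I" if "v < i0 + n + I" for v
    using memS[of v] that n jN(1) i1 levi(1) by (auto simp: i0_def)
  have end_: "lev \<tau> v = lev \<tau> (i0 + n) \<longleftrightarrow> i0 + n \<le> v" if "v < i0 + n + I" for v
    using memT[of v] that n jN jI by auto
  \<comment> \<open>A level \<open>l\<close> strictly between is the chain with number
    \<open>Suc l\<close>, to which the assumption on intermediate chains applies.\<close>
  have mid: "level_card (\<lambda>v. lev \<tau> (i0 + v)) (n + I) l \<noteq> I"
    if l: "lev \<tau> (i0 + 0) < l" "l < lev \<tau> (i0 + n)" for l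
  proof -
    have "lev \<tau> i0 = s - 1" unfolding i0_def by (rule levi(1))
    moreover have "lev \<tau> (i0 + n) = t - 1" by (simp only: n(1) jN(3))
    ultimately have l': "s < Suc l" "Suc l < t" using l s by simp_all
    have rng: "i0 \<le> v \<and> v < j" if "lev \<tau> v = l" for v
      using that l lev_mono[of v i0 \<tau>] lev_mono[of "j - 1" v \<tau>] jN(2,3) n(1) by force
    have "lev_set N \<tau> l = (\<lambda>v. Suc (i0 + v)) ` {v. v < n + I \<and> lev \<tau> (i0 + v) = l}"
    proof (intro equalityI subsetI)
      fix v assume "v \<in> lev_set N \<tau> l"
      then have v: "1 \<le> v" "lev \<tau> (v - 1) = l" by (auto simp: lev_set_def)
      then have "i0 \<le> v - 1" "v - 1 < j" using rng by auto
      then show "v \<in> (\<lambda>v. Suc (i0 + v)) ` {v. v < n + I \<and> lev \<tau> (i0 + v) = l}"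
        using v n by (intro image_eqI[of _ _ "v - 1 - i0"]) auto
    qed (use n jN(1) in \<open>auto simp: lev_set_def\<close>)
    then have "card (lev_set N \<tau> l) = level_card (\<lambda>v. lev \<tau> (i0 + v)) (n + I) l"
      by (simp add: level_card_def card_image inj_on_def)
    then show ?thesis using assms(12)[rule_format, of "Suc l"] l' chain[of "Suc l"] by simp
  qed
  interpret nilradical_chains \<tau> i0 n I N
  proof (unfold_locales)
    show "lev \<tau> v = lev \<tau> i0 \<longleftrightarrow> i0 \<le> v \<and> v < i0 + I" if "v < i0 + n + I" for v by (rule start[OF that])
    show "lev \<tau> v = lev \<tau> (i0 + n) \<longleftrightarrow> i0 + n \<le> v" if "v < i0 + n + I" for v by (rule end_[OF that])
    show "lev \<tau> (i0 + v) = lev \<tau> (i0 + 0) \<longleftrightarrow> v < I" if "v < n + I" for v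
      using start[of "i0 + v"] that by simp
    show "lev \<tau> (i0 + v) = lev \<tau> (i0 + n) \<longleftrightarrow> n \<le> v" if "v < n + I" for v
      using end_[of "i0 + v"] that by simp
    show "lev \<tau> (i0 + Suc v) \<le> Suc (lev \<tau> (i0 + v))" for v by (simp add: lev_Suc)
  qed (use I n jN(1) mid in \<open>auto intro: lev_mono\<close>)

  \<comment> \<open>As the last of the \<open>I\<close> numbers of its chain, vertex
    \<open>j - 1\<close> raises the excess exactly for parameters up to \<open>I - 1\<close>. This
    puts \<open>j\<close> into row \<open>I - 1\<close> of \<open>TR\<close>, with rows numbered
    from 0.\<close>
  have gpos: "gpos (lev \<tau>) (j - 1) = I - 1"
  proof -
    have "{w. w < j - 1 \<and> lev \<tau> w = lev \<tau> (j - 1)} = {j - I..<j - 1}"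
    proof (rule Set.set_eqI)
      fix w
      show "w \<in> {w. w < j - 1 \<and> lev \<tau> w = lev \<tau> (j - 1)} \<longleftrightarrow> w \<in> {j - I..<j - 1}"
        unfolding mem_Collect_eq jN(2) atLeastLessThan_iff using memT[of w] jN(1) jI by linarith
    qed
    then show ?thesis using jI by (simp add: gpos_def)
  qed
  have j1: "1 \<le> j" using I jI by simp
  have ex: "excess (lev \<tau>) j J = excess (lev \<tau>) (j - 1) J + (if J \<le> I - 1 then 1 else 0)" for J
    using excess_Suc[of "lev \<tau>" "j - 1" J] j1 gpos by simp
  have row: "I - 1 < length TR" "j \<in> set (TR ! (I - 1))"
    by (rule tableau_row[OF stR j1]; use I jN(1) ex in \<open>simp add: belowR\<close>)+
  have belowT: "below T I k = excess (lev \<tau>) k I + (if j \<le> k then 1 else 0)" if "k \<le> N" for k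
    unfolding assms(8) using below_drop_box[OF stR _ row] I that by (simp add: belowR)
  \<comment> \<open>The dropped entry \<open>j\<close> is counted in the large corner but not in the
    one of size \<open>i0 + I\<close>, which ends before the upper chain.\<close>
  have bT: "below T I (i0 + n + I) = Suc (excess (lev \<tau>) (i0 + n + I) I)"
    "below T I (i0 + I) = excess (lev \<tau>) (i0 + I) I"
    using belowT[of j] belowT[of "i0 + I"] n before jN(1) I by auto
  note closure = closure_hypersurface[OF irrV clV VC codim
      eval_fpoly_vanishes[OF irrV Vm assms(2) bT]]
  \<comment> \<open>In the excluded case the closure would be the nilradical for
    \<open>\<tau>\<close> enlarged by \<open>Suc i0\<close>, and the variety would be stable under
    the root subgroup of this simple root, contrary to the choice of \<open>\<tau>\<close> as its
    full tau-invariant.\<close>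
  have "I \<noteq> 1 \<or> Suc (lev \<tau> i0) \<noteq> lev \<tau> (i0 + n)"
  proof (rule ccontr)
    assume "\<not> ?thesis"
    then have deg: "I = 1" "Suc (lev \<tau> i0) = lev \<tau> (i0 + n)" by auto
    have "v < i0 + n + I" if "v < N" "lev \<tau> v = lev \<tau> (i0 + n)" for v
      using memT[of v] that n jN(3) by simp
    note h = hypersurface_m_space[OF deg this]
    have "insert (Suc i0) \<tau> \<subseteq> tau N V"
      by (rule tau_of_m_space_closure[OF V])
        (use closure h(2) \<tau> n jN(1) I before in auto)
    then show False using h(1) by (simp add: \<tau>_def)
  qed
  from sigma_set_eq[OF closure \<tau>_def[symmetric] this] show ?thesis
    unfolding n(2) using i1 by (simp add: i0_def)
qed

end
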